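(* Let $\mathcal{M}=\{1^{m_1},\ldots,n^{m_n}\}$ with all $m_i\ge1$, $M=m_1+\cdots+m_n$ and $k=M-n+1$. There is a bijection $\Psi:\mathcal{T}_{\mathcal{M}}\to\mathcal{B}_{n,k}$ such that for every $T\in\mathcal{T}_{\mathcal{M}}$, with $\Pi=\Psi(T)$, $$\sum_{T'\in[T]}x^{\mathrm{cdes}(T')}y^{\mathrm{casc}(T')}z^{\mathrm{leaf}^*(T')}=\sum_{\Pi'\in[\Pi]}x^{\mathrm{des}(\Pi')}y^{\mathrm{asc}(\Pi')}z^{\mathrm{emp}(\Pi')}.$$ Consequently $$\sum_{T\in\mathcal{T}_{\mathcal{M}}}x^{\mathrm{cdes}(T)}y^{\mathrm{casc}(T)}z^{\mathrm{leaf}^*(T)}=\sum_{\Pi\in\mathcal{B}_{n,k}}x^{\mathrm{des}(\Pi)}y^{\mathrm{asc}(\Pi)}z^{\mathrm{emp}(\Pi)},$$ and $$(M-n+1)\,\overline{Q}_{\mathcal{M}}(x,y,z)=n!\,[u^n]\bigl(A(x,y,u)-1+z\bigr)^{M-n+1}.$$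
   Context: VE-labeled trees: all trees are rooted plane trees with edges directed toward the root; the edge from $v$ to its parent starts at $v$. $\mathcal{T}_{\mathcal{M}}$ is the set of plane rooted trees with $M-\#\{i:m_i>1\}$ edges such that: (1) vertex labels are distinct and form exactly $\{0,1,\ldots,M-n\}\cup\{s_i:m_i=1\}$ ($s_i$ formal symbols); (2) a vertex has label $s_i$ iff it is a leaf whose edge to its parent has label $i$; (3) edge labels form exactly the multiset in which each $i$ with $m_i>1$ appears $m_i-1$ times and each $i$ with $m_i=1$ appears once, and equally labeled edges are adjacent sibling edges; (4) equally labeled edges have starting vertices increasingly labeled from left to right, and for edges with labels $e_1\ne e_2$ starting at integer-labeled vertices $v_1,v_2$, $e_1<e_2$ iff $v_1<v_2$. Tree statistics: for a word $w_1\cdots w_r$, $\mathrm{cdes}$ (resp. $\mathrm{casc}$) counts $i\in[r]$ with $w_i>w_{i+1}$ (resp. $<$) where $w_{r+1}=w_1$. For a vertex $v$ with child edges labeled $a_1,\ldots,a_d$ left to right: if $v$ is the root, $\mathrm{cdes}(v)=\mathrm{des}(a_1\cdots a_d)$, $\mathrm{casc}(v)=\mathrm{asc}(a_1\cdots a_d)$ (ordinary counts with $a_0=a_{d+1}=0$); otherwise with $b$ the label of the edge to the parent, $\mathrm{cdes}(v)=\mathrm{cdes}(ba_1\cdots a_d)$, $\mathrm{casc}(v)=\mathrm{casc}(ba_1\cdots a_d)$. $\mathrm{cdes}(T),\mathrm{casc}(T)$ are the sums over all vertices; $\mathrm{leaf}^*(T)$ is the number of integer-labeled leaves. Two trees $T,T'\in\mathcal{T}_{\mathcal{M}}$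 are equivalent if, for each vertex label, the labeled edges ending at that vertex in $T'$ are a rearrangement of those in $T$ (i.e. $T'$ arises from $T$ by reordering children); $[T]$ is the class of $T$. Partitions: $\mathcal{B}_{n,k}$ is the set of $k$-tuples $\Pi=(\pi^{(0)},\ldots,\pi^{(k-1)})$ of words with distinct letters (possibly empty) whose underlying sets form a partition of $[n]$. For a word $w=w_1\cdots w_m$ with distinct letters, with $w_0=w_{m+1}=0$, $\mathrm{des}(w)$, $\mathrm{asc}(w)$, $\mathrm{plat}(w)$ count $0\le i\le m$ with $w_i>w_{i+1}$, $w_i<w_{i+1}$, $w_i=w_{i+1}$ (so only the empty word has a plateau). $\mathrm{des}(\Pi)=\sum_i\mathrm{des}(\pi^{(i)})$, $\mathrm{asc}(\Pi)=\sum_i\mathrm{asc}(\pi^{(i)})$, $\mathrm{emp}(\Pi)=\sum_i\mathrm{plat}(\pi^{(i)})$ (the number of empty blocks). $\Pi\sim\Pi'$ if each block of $\Pi'$ is a rearrangement of the corresponding block of $\Pi$; $[\Pi]$ is the class. Quasi-Stirling: $\overline{\mathcal{Q}}_{\mathcal{M}}$ is the set of permutations $\pi_1\cdots\pi_M$ of the multiset $\mathcal{M}$ with no subsequence $abab$, $a\ne b$; $\overline{Q}_{\mathcal{M}}(x,y,z)=\sum_{\pi}x^{\mathrm{des}(\pi)}y^{\mathrm{asc}(\pi)}z^{\mathrm{plat}(\pi)}$ with statistics as for words above (convention $\pi_0=\pi_{M+1}=0$). $A_n(x,y)=\sum_{\sigma\in\mathfrak{S}_n}x^{\mathrm{des}(\sigma)}y^{\mathrm{asc}(\sigma)}$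 (same conventions, $A_0=1$), and $A(x,y,u)=\sum_{n\ge0}A_n(x,y)u^n/n!$. *)

theory Defs
  imports
    "HOL-Computational_Algebra.Computational_Algebra"
    "HOL-Combinatorics.Multiset_Permutations"
    "HOL-Library.Sublist"
begin

section \<open>Words\<close>

text \<open>The ordinary statistics use the convention \<open>w\<^sub>0 = w\<^sub>m\<^sub>+\<^sub>1 = 0\<close>.\<close>

definition padded :: "nat list \<Rightarrow> nat list" where
  "padded w = 0 # w @ [0]"

definition des :: "nat list \<Rightarrow> nat" where
  "des w = card {i. i \<le> length w \<and> padded w ! i > padded w ! (i + 1)}"

definition asc :: "nat list \<Rightarrow> nat" where
  "asc w = card {i. i \<le> length w \<and> padded w ! i < padded w ! (i + 1)}"

definition plat :: "nat list \<Rightarrow> nat" where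
  "plat w = card {i. i \<le> length w \<and> padded w ! i = padded w ! (i + 1)}"

definition cdes :: "nat list \<Rightarrow> nat" where
  "cdes w = card {i. i < length w \<and> w ! i > w ! ((i + 1) mod length w)}"

definition casc :: "nat list \<Rightarrow> nat" where
  "casc w = card {i. i < length w \<and> w ! i < w ! ((i + 1) mod length w)}"


section \<open>Vertex- and edge-labeled plane trees\<close>

datatype vlabel = Num nat | Sym nat

text \<open>
  The children of a vertex are listed from left to right, each together with the label of the
  edge that joins it to its parent.
\<close>

datatype vetree = Node (vlab: vlabel) (children: "(nat \<times> vetree) list")

text \<open>
  A vertex is represented by the subtree hanging from it; the first entry of \<open>vertices T\<close> is
  the root.
\<close>

fun vertices :: "vetree \<Rightarrow> vetree list" where
  "vertices (Node v cs) = Node v cs # concat (map (\<lambda>(e, t). vertices t) cs)"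

text \<open>The non-root vertices, each paired with the label of the edge to its parent.\<close>

definition nonroot :: "vetree \<Rightarrow> (nat \<times> vetree) list" where
  "nonroot T = concat (map children (vertices T))"

text \<open>Edges as triples (label of starting vertex, edge label, label of ending vertex).\<close>

definition edges :: "vetree \<Rightarrow> (vlabel \<times> nat \<times> vlabel) list" where
  "edges T = concat (map (\<lambda>u. map (\<lambda>(e, t). (vlab t, e, vlab u)) (children u)) (vertices T))"

text \<open>
  The multiset with \<open>m i\<close> copies of each \<open>i\<close> in \<open>[n]\<close> is described by the pair \<open>n\<close>, \<open>m\<close>.
  \<open>Sym i\<close> is the formal symbol \<open>s\<^sub>i\<close>; it is available only when \<open>m i = 1\<close>, so the condition that a
  vertex has label \<open>s\<^sub>i\<close> iff it is a leaf below an edge labeled \<open>i\<close> is imposed for those \<open>i\<close> only.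
  The root may carry any label \<open>Num a\<close>. Edges with equal labels must end at the same vertex and
  form an interval among its child edges. Such edges exist only for \<open>m i > 2\<close>, when all of them
  start at integer-labeled vertices.
\<close>

definition VE_trees :: "nat \<Rightarrow> (nat \<Rightarrow> nat) \<Rightarrow> vetree set" where
  "VE_trees n m = {T. let M = (\<Sum>i=1..n. m i) in
     length (edges T) = M - card {i \<in> {1..n}. m i > 1} \<and>
     distinct (map vlab (vertices T)) \<and>
     set (map vlab (vertices T)) = Num ` {0..M - n} \<union> Sym ` {i \<in> {1..n}. m i = 1} \<and>
     (\<forall>i \<in> {1..n}. m i = 1 \<longrightarrow> (\<forall>t \<in> set (vertices T).
        vlab t = Sym i \<longleftrightarrow> children t = [] \<and> (i, t) \<in> set (nonroot T))) \<and>
     mset (map (\<lambda>(s, e, v). e) (edges T)) =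
       (\<Sum>i=1..n. replicate_mset (if m i > 1 then m i - 1 else 1) i) \<and>
     (\<forall>s e v s' v'. (s, e, v) \<in> set (edges T) \<longrightarrow> (s', e, v') \<in> set (edges T) \<longrightarrow> v = v') \<and>
     (\<forall>u \<in> set (vertices T). \<forall>p q r. p < q \<longrightarrow> q < r \<longrightarrow> r < length (children u) \<longrightarrow>
        fst (children u ! p) = fst (children u ! r) \<longrightarrow>
        fst (children u ! q) = fst (children u ! p)) \<and>
     (\<forall>u \<in> set (vertices T). \<forall>p q. p < q \<longrightarrow> q < length (children u) \<longrightarrow>
        fst (children u ! p) = fst (children u ! q) \<longrightarrow>
        (\<exists>a b. vlab (snd (children u ! p)) = Num a \<and> vlab (snd (children u ! q)) = Num b \<and>
               a < b)) \<and>
     (\<forall>a e v a' e' v'. (Num a, e, v) \<in> set (edges T) \<longrightarrow> (Num a', e', v') \<in> set (edges T) \<longrightarrow>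
        e \<noteq> e' \<longrightarrow> (e < e' \<longleftrightarrow> a < a'))}"

definition cdes_tree :: "vetree \<Rightarrow> nat" where
  "cdes_tree T = des (map fst (children T)) +
     (\<Sum>(b, t) \<leftarrow> nonroot T. cdes (b # map fst (children t)))"

definition casc_tree :: "vetree \<Rightarrow> nat" where
  "casc_tree T = asc (map fst (children T)) +
     (\<Sum>(b, t) \<leftarrow> nonroot T. casc (b # map fst (children t)))"

definition leaf_star :: "vetree \<Rightarrow> nat" where
  "leaf_star T = length (filter (\<lambda>t. children t = [] \<and> (\<exists>a. vlab t = Num a)) (vertices T))"

definition tree_equiv :: "vetree \<Rightarrow> vetree \<Rightarrow> bool" where
  "tree_equiv T T' \<longleftrightarrow> (\<forall>v. mset (filter (\<lambda>(s, e, u). u = v) (edges T')) =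
                              mset (filter (\<lambda>(s, e, u). u = v) (edges T)))"

definition tree_class :: "nat \<Rightarrow> (nat \<Rightarrow> nat) \<Rightarrow> vetree \<Rightarrow> vetree set" where
  "tree_class n m T = {T' \<in> VE_trees n m. tree_equiv T T'}"


section \<open>Ordered partitions into words\<close>

definition partitions :: "nat \<Rightarrow> nat \<Rightarrow> nat list list set" where
  "partitions n k = {P. length P = k \<and> (\<forall>i<k. distinct (P ! i)) \<and>
     (\<forall>i<k. \<forall>j<k. i \<noteq> j \<longrightarrow> set (P ! i) \<inter> set (P ! j) = {}) \<and>
     (\<Union>i<k. set (P ! i)) = {1..n}}"

definition des_part :: "nat list list \<Rightarrow> nat" where
  "des_part P = (\<Sum>w \<leftarrow> P. des w)"

definition asc_part :: "nat list list \<Rightarrow> nat" where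
  "asc_part P = (\<Sum>w \<leftarrow> P. asc w)"

definition emp_part :: "nat list list \<Rightarrow> nat" where
  "emp_part P = (\<Sum>w \<leftarrow> P. plat w)"

definition part_equiv :: "nat list list \<Rightarrow> nat list list \<Rightarrow> bool" where
  "part_equiv P P' \<longleftrightarrow> list_all2 (\<lambda>w w'. mset w' = mset w) P P'"

definition part_class :: "nat \<Rightarrow> nat \<Rightarrow> nat list list \<Rightarrow> nat list list set" where
  "part_class n k P = {P' \<in> partitions n k. part_equiv P P'}"


section \<open>Quasi-Stirling permutations\<close>

definition quasi_stirling :: "nat \<Rightarrow> (nat \<Rightarrow> nat) \<Rightarrow> nat list set" where
  "quasi_stirling n m =
     {\<pi> \<in> permutations_of_multiset (\<Sum>i=1..n. replicate_mset (m i) i).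
        \<not> (\<exists>a b. a \<noteq> b \<and> subseq [a, b, a, b] \<pi>)}"


section \<open>Generating functions\<close>

text \<open>\<open>\<rat>[x, y, z]\<close> as iterated univariate polynomials \<open>\<rat>[x][y][z]\<close>.\<close>

type_synonym pol3 = "rat poly poly poly"

definition const3 :: "rat \<Rightarrow> pol3" where "const3 c = [:[:[:c:]:]:]"
definition ind_x :: pol3 where "ind_x = [:[:[:0, 1:]:]:]"
definition ind_y :: pol3 where "ind_y = [:[:0, 1:]:]"
definition ind_z :: pol3 where "ind_z = [:0, 1:]"

definition Qbar :: "nat \<Rightarrow> (nat \<Rightarrow> nat) \<Rightarrow> pol3" where
  "Qbar n m = (\<Sum>\<pi> \<in> quasi_stirling n m. ind_x ^ des \<pi> * ind_y ^ asc \<pi> * ind_z ^ plat \<pi>)"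

definition eulerian :: "nat \<Rightarrow> pol3" where
  "eulerian n = (\<Sum>\<sigma> \<in> permutations_of_set {1..n}. ind_x ^ des \<sigma> * ind_y ^ asc \<sigma>)"

definition eulerian_egf :: "pol3 fps" where
  "eulerian_egf = Abs_fps (\<lambda>n. const3 (1 / fact n) * eulerian n)"

end

theory Submission imports Defs begin

text \<open>
  Listing the integer-labeled vertices of a tree in preorder, and recording at each of them the word
  formed by the distinct labels of its child edges, gives a \<open>k\<close>-tuple of words whose letters partition
  \<open>[n]\<close>. As a letter \<open>b\<close> opens \<open>m b - 1\<close> further vertices, the tuples that arise are those satisfying a
  Lukasiewicz condition, and by the cycle lemma exactly one of the \<open>k\<close> rotations of any tuple satisfies
  it. The root label \<open>r\<close> is one of \<open>k\<close> free choices and forces all other vertex labels, so rotating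
  the preorder tuple by \<open>r\<close> is the bijection \<open>\<Psi>\<close>; it preserves the multiset of words.

  Both class sums factor over the words. Below an edge labeled \<open>b\<close>, the arrangements of a set \<open>S\<close>
  contribute the sum of the cyclic statistics of \<open>b w\<close> over all \<open>w\<close>; cyclic rotation and an order
  isomorphism show that it depends on the size of \<open>S\<close> only, hence equals the contribution for \<open>b = 0\<close>.
  The total sums follow by averaging over classes.

  A quasi-Stirling permutation splits uniquely into blocks \<open>b W b W' b \<dots> b\<close>, which is the plane tree
  without its vertex labels; the statistics add up vertex by vertex, so that each of the \<open>k\<close> root labels
  contributes one copy of \<open>Qbar\<close>.
\<close>

section \<open>Adjacent pairs in words\<close>

text \<open>\<open>\<Psi>\<close> need not carry classes to classes: exchanging two subtrees
  permutes the entries of the preorder tuple, while a class of tuples fixes the letters at each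
  position. So class sums are never matched term by term. Class sums and class sizes on both sides
  are products over words of a quantity depending only on the length of the word, hence depend only
  on the multiset of words, which rotation keeps. Sizes matter as well as sums: a total is the sum
  over all elements of the average over the class of that element, and \<open>\<Psi>\<close> matches
  the averages.

  The dependence on length alone has one obstacle. The set S together with the parent label b is
  order isomorphic to {0,...,|S|}, but the isomorphism sends b to its rank and not to 0. Summing
  over all cyclic arrangements, where no letter is distinguished, removes the difference.

  The number k counts integer-labeled vertices: the root, and m_i - 1 starting points for each i.
  The symbols s_i only mark the ends of edges that open no further vertex.\<close>

fun cnt :: "(nat \<Rightarrow> nat \<Rightarrow> bool) \<Rightarrow> nat list \<Rightarrow> nat" where
  "cnt R (x # y # zs) = (if R x y then 1 else 0) + cnt R (y # zs)"
| "cnt R _ = 0"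

lemma cnt_conv_card: "cnt R xs = card {i. Suc i < length xs \<and> R (xs ! i) (xs ! Suc i)}"
proof (induction R xs rule: cnt.induct)
  case (1 R x y zs)
  let ?A = "{i. Suc i < length (y # zs) \<and> R ((y # zs) ! i) ((y # zs) ! Suc i)}"
  have eq: "{i. Suc i < length (x # y # zs) \<and> R ((x # y # zs) ! i) ((x # y # zs) ! Suc i)}
      = (if R x y then {0} else {}) \<union> Suc ` ?A"
    (is "?L = ?R")
  proof (rule set_eqI)
    show "i \<in> ?L \<longleftrightarrow> i \<in> ?R" for i by (cases i) auto
  qed
  have "finite ?A" by (rule finite_subset[of _ "{..<length (y#zs)}"]) auto
  moreover have "card (Suc ` ?A) = card ?A" by (simp add: card_image)
  ultimately show ?case unfolding eq 1[symmetric]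
    by (subst card_Un_disjoint) (auto simp: 1)
qed auto

text \<open>The letter \<open>a\<close> is kept on both sides, so no adjacent pair is lost at the
  cut. This makes \<open>mon\<close> multiplicative under cutting.\<close>

lemma cnt_append: "cnt R (xs @ a # ys) = cnt R (xs @ [a]) + cnt R (a # ys)"
proof (induction xs)
  case (Cons x xs)
  then show ?case by (cases xs) auto
qed simp

lemma cnt_map:
  assumes "\<And>a b. a \<in> set xs \<Longrightarrow> b \<in> set xs \<Longrightarrow> R (f a) (f b) = R a b"
  shows "cnt R (map f xs) = cnt R xs"
  using assms by (induction R xs rule: cnt.induct) auto

lemma des_conv_cnt: "des w = cnt (>) (0 # w @ [0])"
  and asc_conv_cnt: "asc w = cnt (<) (0 # w @ [0])"
  and plat_conv_cnt: "plat w = cnt (=) (0 # w @ [0])"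
  unfolding des_def asc_def plat_def cnt_conv_card padded_def
  by (auto intro!: arg_cong[where f = card])

lemma cyclic_nth_conv:
  assumes "i < length (b # w)"
  shows "(b # w) ! ((i + 1) mod length (b # w)) = (b # w @ [b]) ! Suc i"
  using assms by (cases "i = length w") (auto simp: nth_append)

text \<open>Repeating the first letter at the end replaces the cyclic index. With
  \<open>b = 0\<close> the same expression is the ordinary statistic of \<open>w\<close>, so the
  root can be treated as a vertex below an edge labeled 0.\<close>

lemma cdes_Cons: "cdes (b # w) = cnt (>) (b # w @ [b])"
  unfolding cdes_def cnt_conv_card
  by (intro arg_cong[where f = card] Collect_cong conj_cong)
     (use cyclic_nth_conv[of _ b w] in \<open>auto simp: nth_append nth_Cons split: nat.splits if_splits\<close>)

lemma casc_Cons: "casc (b # w) = cnt (<) (b # w @ [b])"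
  unfolding casc_def cnt_conv_card
  by (intro arg_cong[where f = card] Collect_cong conj_cong)
     (use cyclic_nth_conv[of _ b w] in \<open>auto simp: nth_append nth_Cons split: nat.splits if_splits\<close>)

definition mon :: "nat list \<Rightarrow> pol3" where
  "mon xs = ind_x ^ cnt (>) xs * ind_y ^ cnt (<) xs * ind_z ^ cnt (=) xs"

lemma mon_append: "mon (xs @ a # ys) = mon (xs @ [a]) * mon (a # ys)"
  unfolding mon_def cnt_append[of _ xs a ys] by (simp add: power_add algebra_simps)

lemma mon_single [simp]: "mon [a] = 1"
  by (simp add: mon_def)

lemma cnt_eq_distinct: "distinct xs \<Longrightarrow> cnt (=) xs = 0"
  by (induction xs rule: induct_list012) auto

text \<open>Between distinct letters the only possible plateau is \<open>b b\<close> itself. The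
  exponent of \<open>ind_z\<close> thus marks an empty block or a vertex without children.\<close>

lemma cnt_eq_closed:
  assumes "distinct w" "b \<notin> set w"
  shows "cnt (=) (b # w @ [b]) = (if w = [] then 1 else 0)"
proof (cases w)
  case (Cons a v)
  have "cnt (=) (b # w @ [b]) = cnt (=) (a # v @ [b])" using Cons assms by auto
  also have "distinct (a # v @ [b])" using Cons assms by auto
  from cnt_eq_distinct[OF this] have "cnt (=) (a # v @ [b]) = 0" .
  finally show ?thesis using Cons by simp
qed simp

section \<open>Summation over cyclic arrangements\<close>

definition mon_cyc :: "nat list \<Rightarrow> pol3" where
  "mon_cyc u = mon (u @ [hd u])"

text \<open>A cyclic statistic does not see where the cycle is cut, so the cut may be moved to any
  letter \<open>c\<close>.\<close>

lemma mon_cyc_rotate: "mon_cyc (xs @ c # ys) = mon (c # (ys @ xs) @ [c])"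
proof (cases xs)
  case (Cons a zs)
  have "mon_cyc (xs @ c # ys) = mon ((a # zs) @ c # ys @ [a])"
    using Cons by (simp add: mon_cyc_def)
  also have "\<dots> = mon ((a # zs) @ [c]) * mon (c # ys @ [a])" by (rule mon_append)
  also have "\<dots> = mon ((c # ys) @ a # zs @ [c])"
    using mon_append[of "c # ys" a "zs @ [c]"] by (simp add: mult.commute)
  finally show ?thesis using Cons by simp
qed (simp add: mon_cyc_def)

text \<open>Every permutation of \<open>insert c S\<close> is a rotation of exactly one word that
  starts with \<open>c\<close>, and the \<open>card S + 1\<close> rotations of that word share its
  cyclic statistic. The index \<open>j\<close> is the number of letters behind
  \<open>c\<close>.\<close>

lemma sum_mon_cyc:
  assumes "finite S" "c \<notin> S"
  shows "(\<Sum>u \<in> permutations_of_set (insert c S). mon_cyc u) =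
    of_nat (Suc (card S)) * (\<Sum>w \<in> permutations_of_set S. mon (c # w @ [c]))"
proof -
  let ?f = "\<lambda>(j, w). drop j w @ c # take j w"
  let ?A = "{..card S} \<times> permutations_of_set S"
  have inj: "inj_on ?f ?A"
  proof (rule inj_onI, clarify)
    fix j w j' w'
    assume h: "w \<in> permutations_of_set S" "w' \<in> permutations_of_set S" "j \<le> card S" "j' \<le> card S"
      and eq: "drop j w @ c # take j w = drop j' w' @ c # take j' w'"
    have "c \<notin> set w" "c \<notin> set w'" using h assms by (auto simp: permutations_of_set_def)
    hence "c \<notin> set (drop j w)" "c \<notin> set (drop j' w')" "c \<notin> set (take j w)" "c \<notin> set (take j' w')"
      by (auto dest: in_set_dropD in_set_takeD)
    hence e: "drop j w = drop j' w'" "take j w = take j' w'"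
      using eq by (auto simp: append_Cons_eq_iff)
    moreover have "length w = card S" "length w' = card S"
      using h by (auto simp: length_finite_permutations_of_set)
    ultimately show "j = j' \<and> w = w'"
      by (metis append_take_drop_id h(3,4) length_take min.absorb2)
  qed
  have img: "?f ` ?A = permutations_of_set (insert c S)"
  proof (intro equalityI subsetI)
    fix u assume "u \<in> ?f ` ?A"
    then obtain j w where w: "w \<in> permutations_of_set S" "u = drop j w @ c # take j w" by auto
    have "mset u = mset (c # (take j w @ drop j w))" unfolding w(2) mset.simps mset_append by simp
    hence "mset u = mset (c # w)" by simp
    moreover have "set w = S" "distinct w" using w by (auto simp: permutations_of_set_def)
    ultimately show "u \<in> permutations_of_set (insert c S)"
      using assms by (metis distinct.simps(2) list.simps(15) mset_eq_imp_distinct_iff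
          mset_eq_setD permutations_of_setI)
  next
    fix u assume u: "u \<in> permutations_of_set (insert c S)"
    hence u': "distinct u" "set u = insert c S" by (auto simp: permutations_of_set_def)
    then obtain xs ys where s: "u = xs @ c # ys" by (metis insertI1 split_list)
    have "ys @ xs \<in> permutations_of_set S" using u' s assms
      by (auto simp: permutations_of_set_def)
    moreover from this have "length ys \<le> card S"
      using length_finite_permutations_of_set[of "ys @ xs" S] by simp
    ultimately show "u \<in> ?f ` ?A" using s by (intro image_eqI[of _ _ "(length ys, ys @ xs)"]) auto
  qed
  have "(\<Sum>u \<in> permutations_of_set (insert c S). mon_cyc u) = (\<Sum>p\<in>?A. mon_cyc (?f p))"
    unfolding img[symmetric] by (rule sum.reindex[OF inj, unfolded o_def])
  also have "\<dots> = (\<Sum>(j, w)\<in>?A. mon (c # w @ [c]))"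
    by (intro sum.cong refl) (simp add: mon_cyc_rotate case_prod_beta split_beta)
  also have "\<dots> = (\<Sum>j\<le>card S. \<Sum>w\<in>permutations_of_set S. mon (c # w @ [c]))"
    by (rule sum.cartesian_product[symmetric])
  finally show ?thesis by simp
qed

lemma order_iso_finite_nat:
  fixes X Y :: "nat set"
  assumes "finite X" "finite Y" "card X = card Y"
  obtains f where "bij_betw f X Y" "strict_mono_on X f"
proof -
  let ?N = "{..<card X}"
  obtain h where h: "bij_betw h ?N X" "strict_mono_on ?N h"
    using ex_bij_betw_strict_mono_card[OF assms(1)] by blast
  obtain h' where h': "bij_betw h' ?N Y" "strict_mono_on ?N h'"
    using ex_bij_betw_strict_mono_card[OF assms(2)] assms(3) by metis
  let ?g = "inv_into ?N h"
  have g: "bij_betw ?g X ?N" using h(1) by (rule bij_betw_inv_into)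
  have "strict_mono_on X (h' \<circ> ?g)"
  proof (rule strict_mono_onI)
    fix a b assume ab: "a \<in> X" "b \<in> X" "a < b"
    have N: "?g a \<in> ?N" "?g b \<in> ?N" using g ab by (auto dest: bij_betwE)
    have "h (?g a) < h (?g b)" using ab h(1) by (simp add: bij_betw_inv_into_right)
    hence "?g a < ?g b" using strict_mono_on_less[OF h(2) N] by simp
    thus "(h' \<circ> ?g) a < (h' \<circ> ?g) b" using strict_mono_onD[OF h'(2) N] by simp
  qed
  moreover have "bij_betw (h' \<circ> ?g) X Y" using g h'(1) by (rule bij_betw_trans)
  ultimately show thesis using that by blast
qed

text \<open>Only comparisons between letters of the cycle enter, and an increasing bijection
  preserves all three of them. \<open>X\<close> is nonempty so that \<open>hd\<close> commutes with
  the map.\<close>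

lemma sum_mon_cyc_cong:
  assumes "finite X" "finite Y" "card X = card Y" "X \<noteq> {}"
  shows "(\<Sum>u \<in> permutations_of_set X. mon_cyc u) = (\<Sum>u \<in> permutations_of_set Y. mon_cyc u)"
proof -
  obtain f where f: "bij_betw f X Y" "strict_mono_on X f" using order_iso_finite_nat assms by metis
  have inj: "inj_on f X" using f bij_betw_def by blast
  have lt: "f a < f b \<longleftrightarrow> a < b" if "a \<in> X" "b \<in> X" for a b
    using strict_mono_on_less[OF f(2) that] .
  have "permutations_of_set Y = map f ` permutations_of_set X"
    using permutations_of_set_image_inj[OF inj] f by (simp add: bij_betw_def)
  moreover have "inj_on (map f) (permutations_of_set X)"
    using inj by (intro inj_onI) (auto simp: permutations_of_set_def map_eq_conv
        dest!: map_inj_on)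
  ultimately have "(\<Sum>u \<in> permutations_of_set Y. mon_cyc u) =
      (\<Sum>u \<in> permutations_of_set X. mon_cyc (map f u))"
    by (simp add: sum.reindex)
  also have "\<dots> = (\<Sum>u \<in> permutations_of_set X. mon_cyc u)"
  proof (intro sum.cong refl)
    fix u assume "u \<in> permutations_of_set X"
    hence u: "set u = X" "u \<noteq> []" using assms(4) by (auto simp: permutations_of_set_def)
    have m: "map f u @ [hd (map f u)] = map f (u @ [hd u])" using u by (simp add: list.map_sel)
    have s: "set (u @ [hd u]) = X" using u hd_in_set[of u] by auto
    have "cnt R (map f (u @ [hd u])) = cnt R (u @ [hd u])" if "R = (>) \<or> R = (<) \<or> R = (=)" for R
    proof (rule cnt_map)
      fix a b assume "a \<in> set (u @ [hd u])" "b \<in> set (u @ [hd u])"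
      hence "a \<in> X" "b \<in> X" using s by blast+
      thus "R (f a) (f b) = R a b" using that lt inj_on_eq_iff[OF inj] by fastforce
    qed
    thus "mon_cyc (map f u) = mon_cyc u" unfolding mon_cyc_def m mon_def by simp
  qed
  finally show ?thesis by simp
qed

text \<open>Total weight of the arrangements of one block. The value at 0 is z although
  \<open>eulerian 0\<close> is 1, because an empty block has a plateau. Up to the factor 1/d! these
  are the coefficients of A - 1 + z.\<close>

definition block_poly :: "nat \<Rightarrow> pol3" where
  "block_poly d = (if d = 0 then ind_z else eulerian d)"

text \<open>\<open>insert b S\<close> and {0..d} both have d + 1 elements, so their cyclic sums
  agree. Each cyclic sum is d + 1 times the sum over words closed by one chosen letter,
  \<open>b\<close> in the first set and 0 in the second.\<close>

lemma sum_mon_closed: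
  assumes S: "finite S" "b \<notin> S"
  shows "(\<Sum>w \<in> permutations_of_set S. mon (b # w @ [b])) = block_poly (card S)"
proof (cases "S = {}")
  case True
  then show ?thesis by (simp add: mon_def block_poly_def)
next
  case False
  define d where "d = card S"
  have d: "d \<noteq> 0" using False S by (simp add: d_def)
  have "of_nat (Suc d) * (\<Sum>w \<in> permutations_of_set S. mon (b # w @ [b])) =
      (\<Sum>u \<in> permutations_of_set (insert b S). mon_cyc u)"
    using sum_mon_cyc[OF S] by (simp add: d_def)
  also have "\<dots> = (\<Sum>u \<in> permutations_of_set (insert 0 {1..d}). mon_cyc u)"
    by (rule sum_mon_cyc_cong) (use S in \<open>auto simp: d_def\<close>)
  also have "\<dots> = of_nat (Suc d) * (\<Sum>w \<in> permutations_of_set {1..d}. mon (0 # w @ [0]))"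
    using sum_mon_cyc[of "{1..d}" 0] by simp
  \<comment> \<open>The factor d + 1 can be cancelled: the polynomial ring is an integral domain of
    characteristic 0.\<close>
  finally have "(\<Sum>w \<in> permutations_of_set S. mon (b # w @ [b])) =
      (\<Sum>w \<in> permutations_of_set {1..d}. mon (0 # w @ [0]))"
    by (simp only: mult_cancel_left of_nat_eq_0_iff) auto
  also have "\<dots> = eulerian d" unfolding eulerian_def
  proof (intro sum.cong refl)
    fix w assume "w \<in> permutations_of_set {1..d}"
    hence "distinct w" "0 \<notin> set w" "w \<noteq> []" using d by (auto simp: permutations_of_set_def)
    thus "mon (0 # w @ [0]) = ind_x ^ des w * ind_y ^ asc w"
      using cnt_eq_closed[of w 0] by (simp add: mon_def des_conv_cnt asc_conv_cnt)
  qed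
  finally show ?thesis using d by (simp add: block_poly_def d_def)
qed

section \<open>The generating function of ordered partitions\<close>

lemma distinct_concat_iff:
  "distinct (concat P) \<longleftrightarrow> (\<forall>i<length P. distinct (P ! i)) \<and>
     (\<forall>i<length P. \<forall>j<length P. i \<noteq> j \<longrightarrow> set (P ! i) \<inter> set (P ! j) = {})"
proof (induction P)
  case (Cons w P)
  have "distinct (concat (w # P)) \<longleftrightarrow> distinct w \<and> distinct (concat P) \<and>
      (\<forall>i<length P. set w \<inter> set (P ! i) = {})"
    by (auto simp: set_conv_nth[of P])
  also have "\<dots> \<longleftrightarrow> (\<forall>i<length (w # P). distinct ((w # P) ! i)) \<and>
     (\<forall>i<length (w # P). \<forall>j<length (w # P). i \<noteq> j \<longrightarrow> set ((w # P) ! i) \<inter> set ((w # P) ! j) = {})"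
    unfolding Cons.IH by (simp add: All_less_Suc2 Int_commute) blast
  finally show ?case .
qed simp

text \<open>Stated for an arbitrary set of letters, so that an induction on \<open>k\<close> can
  remove the first word together with its letters.\<close>

definition word_tuples :: "nat set \<Rightarrow> nat \<Rightarrow> nat list list set" where
  "word_tuples S k = {P. length P = k \<and> distinct (concat P) \<and> set (concat P) = S}"

lemma partitions_conv: "partitions n k = word_tuples {1..n} k"
proof -
  have "(\<Union>i<k. set (P ! i)) = set (concat P)" if "length P = k" for P :: "nat list list"
    using that by (auto simp: set_conv_nth[of P])
  thus ?thesis unfolding partitions_def word_tuples_def distinct_concat_iff by auto
qed

lemma word_tuples_0: "word_tuples S 0 = (if S = {} then {[]} else {})"
  by (auto simp: word_tuples_def)

lemma word_tuples_Suc: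
  "word_tuples S (Suc k) =
    (\<lambda>(U, w, P). w # P) ` (SIGMA U:Pow S. permutations_of_set U \<times> word_tuples (S - U) k)"
proof (intro equalityI subsetI)
  fix Q assume Q: "Q \<in> word_tuples S (Suc k)"
  then obtain w P where "Q = w # P" by (cases Q) (auto simp: word_tuples_def)
  with Q show "Q \<in> (\<lambda>(U, w, P). w # P) `
      (SIGMA U:Pow S. permutations_of_set U \<times> word_tuples (S - U) k)"
    by (intro image_eqI[of _ _ "(set w, w, P)"]) (auto simp: word_tuples_def permutations_of_set_def)
next
  fix Q assume "Q \<in> (\<lambda>(U, w, P). w # P) `
      (SIGMA U:Pow S. permutations_of_set U \<times> word_tuples (S - U) k)"
  then obtain U w P where "Q = w # P" "U \<subseteq> S" "set w = U" "distinct w"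
    "length P = k" "distinct (concat P)" "set (concat P) = S - U"
    unfolding word_tuples_def permutations_of_set_def by (auto simp del: set_concat)
  thus "Q \<in> word_tuples S (Suc k)"
    unfolding word_tuples_def by (simp del: set_concat) blast
qed

lemma finite_word_tuples: "finite S \<Longrightarrow> finite (word_tuples S k)"
  by (induction k arbitrary: S) (auto simp: word_tuples_0 word_tuples_Suc intro!: finite_SigmaI)

lemma sum_word_tuples_Suc:
  fixes h :: "nat list \<Rightarrow> 'b::comm_semiring_1"
  assumes "finite S"
  shows "(\<Sum>P\<in>word_tuples S (Suc k). \<Prod>w\<leftarrow>P. h w) =
    (\<Sum>U\<in>Pow S. (\<Sum>w\<in>permutations_of_set U. h w) * (\<Sum>P\<in>word_tuples (S - U) k. \<Prod>w\<leftarrow>P. h w))"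
proof -
  let ?I = "SIGMA U:Pow S. permutations_of_set U \<times> word_tuples (S - U) k"
  have inj: "inj_on (\<lambda>(U, w, P). w # P) ?I"
    by (rule inj_onI) (auto simp: permutations_of_set_def)
  have "(\<Sum>P\<in>word_tuples S (Suc k). \<Prod>w\<leftarrow>P. h w) = (\<Sum>(U, w, P)\<in>?I. h w * (\<Prod>w\<leftarrow>P. h w))"
    unfolding word_tuples_Suc sum.reindex[OF inj] by (intro sum.cong) auto
  also have "\<dots> = (\<Sum>U\<in>Pow S. \<Sum>(w, P)\<in>permutations_of_set U \<times> word_tuples (S - U) k.
      h w * (\<Prod>w\<leftarrow>P. h w))"
    by (rule sum.Sigma[symmetric]) (use assms finite_word_tuples in auto)
  also have "\<dots> = (\<Sum>U\<in>Pow S. (\<Sum>w\<in>permutations_of_set U. h w) *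
      (\<Sum>P\<in>word_tuples (S - U) k. \<Prod>w\<leftarrow>P. h w))"
    by (intro sum.cong refl) (simp add: sum_product sum.cartesian_product)
  finally show ?thesis .
qed

lemma sum_Pow_card:
  fixes g :: "nat \<Rightarrow> 'b::comm_semiring_1"
  assumes "finite S"
  shows "(\<Sum>U\<in>Pow S. g (card U)) = (\<Sum>j\<le>card S. of_nat (card S choose j) * g j)"
proof -
  have "(\<Sum>U\<in>Pow S. g (card U)) = (\<Sum>j\<le>card S. \<Sum>U\<in>{U \<in> Pow S. card U = j}. g (card U))"
    by (rule sum.group[symmetric]) (use assms in \<open>auto intro: card_mono\<close>)
  also have "\<dots> = (\<Sum>j\<le>card S. of_nat (card S choose j) * g j)"
    using n_subsets[OF assms] by (intro sum.cong refl) (simp add: Pow_def)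
  finally show ?thesis .
qed

lemma const3_mult: "const3 a * const3 b = const3 (a * b)"
  by (simp add: const3_def)

lemma const3_of_nat: "const3 (of_nat a) = of_nat a"
  by (simp add: const3_def of_nat_poly)

text \<open>The scalars 1/j! enter \<open>pol3\<close> only through \<open>const3\<close>, so the
  identity is checked over the rationals and carried over.\<close>

lemma fact_mult_const3_inverse:
  assumes "j \<le> N"
  shows "fact N * const3 (1 / fact j) = of_nat (N choose j) * fact (N - j)"
proof -
  have "fact N * const3 (1 / fact j) = const3 (of_nat (fact N) * (1 / fact j))"
    unfolding const3_mult[symmetric] const3_of_nat by simp
  also have "of_nat (fact N) * (1 / fact j) = (of_nat ((N choose j) * fact (N - j)) :: rat)"
    using binomial_fact[OF assms, where 'a = rat] by simp
  also have "const3 \<dots> = of_nat (N choose j) * fact (N - j)"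
    unfolding const3_of_nat by simp
  finally show ?thesis .
qed

text \<open>Subtracting 1 and adding z affects the constant coefficient only, which is where
  \<open>block_poly\<close> departs from \<open>eulerian\<close>.\<close>

lemma fps_nth_block_series:
  "fps_nth (eulerian_egf - 1 + fps_const ind_z) d = const3 (1 / fact d) * block_poly d"
proof (cases "d = 0")
  case True
  have "const3 1 = 1" using const3_of_nat[of 1] by simp
  moreover have "eulerian 0 = 1" by (simp add: eulerian_def des_conv_cnt asc_conv_cnt)
  ultimately show ?thesis using True by (simp add: eulerian_egf_def block_poly_def)
qed (simp add: eulerian_egf_def block_poly_def)

text \<open>The first word takes a set \<open>U\<close> of letters and leaves a tuple on the rest.
  The summand depends on \<open>U\<close> only through its size, so the recursion is a binomial
  convolution, that is, multiplication of exponential generating functions.\<close>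

lemma sum_word_tuples_mon:
  assumes "finite S" "0 \<notin> S"
  shows "(\<Sum>P\<in>word_tuples S k. \<Prod>w\<leftarrow>P. mon (0 # w @ [0])) =
    fact (card S) * fps_nth ((eulerian_egf - 1 + fps_const ind_z) ^ k) (card S)"
  using assms
proof (induction k arbitrary: S)
  case 0
  then show ?case by (auto simp: word_tuples_0)
next
  case (Suc k)
  let ?E = "eulerian_egf - 1 + fps_const ind_z" and ?N = "card S"
  have "(\<Sum>P\<in>word_tuples S (Suc k). \<Prod>w\<leftarrow>P. mon (0 # w @ [0])) =
      (\<Sum>U\<in>Pow S. block_poly (card U) * (fact (?N - card U) * fps_nth (?E ^ k) (?N - card U)))"
    unfolding sum_word_tuples_Suc[OF Suc.prems(1)]
  proof (intro sum.cong refl)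
    fix U assume U: "U \<in> Pow S"
    have fin: "finite U" using U Suc.prems finite_subset by blast
    have "card (S - U) = ?N - card U" using U fin by (simp add: card_Diff_subset)
    moreover have "0 \<notin> U" using U Suc.prems by auto
    ultimately show "(\<Sum>w\<in>permutations_of_set U. mon (0 # w @ [0])) *
        (\<Sum>P\<in>word_tuples (S - U) k. \<Prod>w\<leftarrow>P. mon (0 # w @ [0])) =
      block_poly (card U) * (fact (?N - card U) * fps_nth (?E ^ k) (?N - card U))"
      using Suc.IH[of "S - U"] sum_mon_closed[OF fin] Suc.prems by simp
  qed
  also have "\<dots> = (\<Sum>j\<le>?N. of_nat (?N choose j) *
      (block_poly j * (fact (?N - j) * fps_nth (?E ^ k) (?N - j))))"
    by (rule sum_Pow_card) fact
  also have "\<dots> = (\<Sum>j\<le>?N. fact ?N * (fps_nth ?E j * fps_nth (?E ^ k) (?N - j)))"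
  proof (intro sum.cong refl)
    fix j assume "j \<in> {..?N}"
    hence "fact ?N * const3 (1 / fact j) = of_nat (?N choose j) * fact (?N - j)"
      by (intro fact_mult_const3_inverse) simp
    from arg_cong[OF this, of "\<lambda>c. c * (block_poly j * fps_nth (?E ^ k) (?N - j))"]
    show "of_nat (?N choose j) * (block_poly j * (fact (?N - j) * fps_nth (?E ^ k) (?N - j))) =
        fact ?N * (fps_nth ?E j * fps_nth (?E ^ k) (?N - j))"
      unfolding fps_nth_block_series by (simp only: mult.assoc mult.left_commute)
  qed
  also have "\<dots> = fact ?N * fps_nth (?E ^ Suc k) ?N"
    by (simp add: fps_mult_nth sum_distrib_left atLeast0AtMost)
  finally show ?case .
qed

section \<open>The cycle lemma\<close>

text \<open>\<open>s\<close> counts the vertices announced but not yet visited in a preorder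
  traversal: each entry visits one and announces \<open>g w\<close> more. The sequence has to end
  exactly when none is left; \<open>s = 1\<close> describes a single tree.\<close>

fun luk :: "('a \<Rightarrow> nat) \<Rightarrow> nat \<Rightarrow> 'a list \<Rightarrow> bool" where
  "luk g s [] \<longleftrightarrow> s = 0"
| "luk g s (w # ws) \<longleftrightarrow> 0 < s \<and> luk g (s - 1 + g w) ws"

lemma luk_iff:
  "luk g s ws \<longleftrightarrow> s + sum_list (map g ws) = length ws \<and>
     (\<forall>j<length ws. j < s + sum_list (map g (take j ws)))"
proof (induction ws arbitrary: s)
  case (Cons w ws)
  show ?case unfolding luk.simps Cons.IH by (cases s) (auto simp: All_less_Suc2)
qed simp

text \<open>A proper prefix of such a sequence has sum at least its length. If \<open>xs\<close>
  were nonempty, both parts would be proper prefixes, and the total sum would reach the total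
  length, whereas it is one less.\<close>

lemma luk_rotate_unique:
  assumes "luk g 1 (xs @ ys)" "luk g 1 (ys @ xs)" "ys \<noteq> []"
  shows "xs = []"
proof (rule ccontr)
  assume "xs \<noteq> []"
  have "length xs < 1 + sum_list (map g xs)"
    using assms(1,3) unfolding luk_iff by (auto dest!: spec[of _ "length xs"])
  moreover have "length ys < 1 + sum_list (map g ys)"
    using assms(2) \<open>xs \<noteq> []\<close> unfolding luk_iff by (auto dest!: spec[of _ "length ys"])
  moreover have "1 + sum_list (map g (xs @ ys)) = length (xs @ ys)"
    using assms(1) unfolding luk_iff by simp
  ultimately show False by simp
qed

text \<open>Cutting at the first minimum of the partial sums.\<close>

lemma luk_rotate_exists:
  assumes sum: "1 + sum_list (map g ws) = length ws"
  shows "\<exists>d<length ws. luk g 1 (rotate d ws)"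
proof -
  define k where "k = length ws"
  define h where "h j = int (sum_list (map g (take j ws))) - int j" for j
  have k: "0 < k" unfolding k_def sum[symmetric] by simp
  define \<mu> where "\<mu> = Min (h ` {..<k})"
  have \<mu>: "\<mu> \<in> h ` {..<k}" unfolding \<mu>_def by (rule Min_in) (use k in auto)
  define d where "d = (LEAST j. j < k \<and> h j = \<mu>)"
  have d: "d < k \<and> h d = \<mu>" unfolding d_def by (rule LeastI_ex) (use \<mu> in auto)
  have ge: "h d \<le> h j" if "j < k" for j
    using that d unfolding \<mu>_def by (auto intro: Min_le)
  have gt: "h d < h j" if "j < d" for j
  proof -
    have "h j \<noteq> \<mu>" using that not_less_Least[of j "\<lambda>j. j < k \<and> h j = \<mu>"] d
      unfolding d_def[symmetric] by auto
    thus ?thesis using ge[of j] that d by auto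
  qed
  have hk: "h k = -1" using sum by (simp add: h_def k_def)
  have rot: "rotate d ws = drop d ws @ take d ws"
    using d by (simp add: rotate_drop_take k_def)
  have "luk g 1 (rotate d ws)" unfolding luk_iff
  proof (intro conjI allI impI)
    have "sum_list (map g (rotate d ws)) = sum_list (map g (take d ws @ drop d ws))"
      unfolding rot map_append sum_list_append by simp
    thus "1 + sum_list (map g (rotate d ws)) = length (rotate d ws)" using sum by simp
  next
    fix j assume "j < length (rotate d ws)"
    hence j: "j < k" by (simp add: k_def)
    have split: "sum_list (map g (take (a + b) ws)) = sum_list (map g (take a ws)) +
        sum_list (map g (take b (drop a ws)))" for a b
      by (simp add: take_add)
    show "j < 1 + sum_list (map g (take j (rotate d ws)))"
    proof (cases "d + j < k")
      case True
      have t: "take j (rotate d ws) = take j (drop d ws)" using True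
        by (simp add: rot k_def)
      show ?thesis using ge[OF True] split[of d j] unfolding t h_def by linarith
    next
      \<comment> \<open>The prefix wraps around the end. The full turn costs 1, because
        \<open>h k\<close> is -1, and this is repaid by the strict inequality to the left of the
        first minimum.\<close>
      case False
      define i where "i = d + j - k"
      have i: "i < d" "j = (k - d) + i" using False j d by (auto simp: i_def)
      have t: "take j (rotate d ws) = drop d ws @ take i ws" using i d
        by (simp add: rot k_def min_def take_all)
      have "sum_list (map g (take k ws)) = sum_list (map g (take d ws)) + sum_list (map g (drop d ws))"
        using split[of d "k - d"] d by (simp add: k_def)
      thus ?thesis using gt[OF i(1)] hk i d unfolding t h_def by simp linarith
    qed
  qed
  thus ?thesis using d k_def by blast
qed

lemma rotate_inject: "rotate r xs = rotate r ys \<longleftrightarrow> xs = ys"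
  by (induction r arbitrary: xs ys) (auto dest: injD[OF inj_rotate1])

text \<open>Each member of \<open>A\<close> has exactly one rotation satisfying \<open>luk\<close>;
  that rotation and the offset leading back from it serve as coordinates on
  \<open>A\<close>.\<close>

lemma luk_bij_betw_rotate:
  assumes sum: "\<And>ws. ws \<in> A \<Longrightarrow> length ws = k \<and> 1 + sum_list (map g ws) = k"
    and closed: "\<And>ws d. ws \<in> A \<Longrightarrow> rotate d ws \<in> A"
  shows "bij_betw (\<lambda>(r, ws). rotate r ws) ({..<k} \<times> {ws \<in> A. luk g 1 ws}) A"
  unfolding bij_betw_def
proof (intro conjI equalityI subsetI)
  have *: "r' \<le> r" if A: "ws \<in> A" "luk g 1 ws" "ws' \<in> A" "luk g 1 ws'" and r: "r' < k" "r < k"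
    and eq: "rotate r ws = rotate r' ws'" for r ws r' ws'
  proof (rule ccontr)
    assume "\<not> r' \<le> r"
    define e where "e = r' - r"
    have e: "r' = r + e" "0 < e" "e < k" using \<open>\<not> r' \<le> r\<close> r by (auto simp: e_def)
    have "ws = rotate e ws'" using eq e(1) rotate_rotate[of r e ws']
      by (metis rotate_inject)
    hence "ws = drop e ws' @ take e ws'" using e sum A by (simp add: rotate_drop_take)
    moreover have "luk g 1 (take e ws' @ drop e ws')" "drop e ws' \<noteq> []" using A e sum by auto
    ultimately have "take e ws' = []" using luk_rotate_unique[of g "take e ws'" "drop e ws'"] A(2) by simp
    thus False using e sum[OF A(3)] by auto
  qed
  show "inj_on (\<lambda>(r, ws). rotate r ws) ({..<k} \<times> {ws \<in> A. luk g 1 ws})"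
  proof (rule inj_onI, clarsimp)
    fix r ws r' ws' assume h: "ws \<in> A" "luk g (Suc 0) ws" "ws' \<in> A" "luk g (Suc 0) ws'" "r' < k" "r < k"
      "rotate r ws = rotate r' ws'"
    hence "r = r'" using *[of ws ws' r' r] *[of ws' ws r r'] by simp
    thus "r = r' \<and> ws = ws'" using h(7) by (simp add: rotate_inject)
  qed
next
  fix ws assume A: "ws \<in> A"
  then obtain d where d: "d < k" "luk g 1 (rotate d ws)" using luk_rotate_exists sum by metis
  have len: "length ws = k" using sum A by auto
  show "ws \<in> (\<lambda>(r, ws). rotate r ws) ` ({..<k} \<times> {ws \<in> A. luk g 1 ws})"
  proof (cases "d = 0")
    case True
    then show ?thesis using A d by (intro image_eqI[of _ _ "(0, ws)"]) auto
  next
    \<comment> \<open>The rotation by \<open>d\<close> is undone by a rotation by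
      \<open>k - d\<close>, an admissible offset since \<open>d\<close> is positive.\<close>
    case False
    have "rotate (k - d) (rotate d ws) = rotate k ws" using d by (simp add: rotate_rotate)
    also have "\<dots> = ws" using len by (simp add: rotate_id)
    finally show ?thesis using A d closed False
      by (intro image_eqI[of _ _ "(k - d, rotate d ws)"]) auto
  qed
qed (use closed in auto)

section \<open>A description of the trees by local conditions\<close>

lemma distinct_remdups_adj_Cons:
  "distinct (remdups_adj (x # xs)) \<longleftrightarrow> distinct (remdups_adj xs) \<and> (x \<in> set xs \<longrightarrow> x = hd xs)"
  by (cases xs) (auto simp: remdups_adj_Cons')

text \<open>This turns the adjacency condition on equally labeled siblings into distinctness of the
  word left after collapsing runs.\<close>

lemma distinct_remdups_adj_iff:
  "distinct (remdups_adj xs) \<longleftrightarrow>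
    (\<forall>p q r. p < q \<longrightarrow> q < r \<longrightarrow> r < length xs \<longrightarrow> xs ! p = xs ! r \<longrightarrow> xs ! q = xs ! p)"
    (is "_ = ?C xs")
proof (induction xs)
  case (Cons x xs)
  let ?R = "\<forall>q r. q < r \<longrightarrow> r < length xs \<longrightarrow> x = xs ! r \<longrightarrow> xs ! q = x"
  have step: "?C (x # xs) \<longleftrightarrow> ?C xs \<and> ?R"
  proof (intro iffI conjI allI impI)
    fix p q r assume L: "?C (x # xs)" and "p < q" "q < r" "r < length xs" "xs ! p = xs ! r"
    thus "xs ! q = xs ! p" using L[rule_format, of "Suc p" "Suc q" "Suc r"] by simp
  next
    fix q r assume L: "?C (x # xs)" and "q < r" "r < length xs" "x = xs ! r"
    thus "xs ! q = x" using L[rule_format, of 0 "Suc q" "Suc r"] by simp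
  next
    fix p q r assume h: "?C xs \<and> ?R" "p < q" "q < r" "r < length (x # xs)" "(x # xs) ! p = (x # xs) ! r"
    obtain q' where q': "q = Suc q'" using h(2) by (cases q) auto
    obtain r' where r': "r = Suc r'" using h(3) by (cases r) auto
    note qr = q' r'
    show "(x # xs) ! q = (x # xs) ! p"
    proof (cases p)
      case 0
      then show ?thesis using h qr by auto
    next
      case (Suc p')
      then show ?thesis using conjunct1[OF h(1), rule_format, of p' q' r'] h(2-5) qr Suc by simp
    qed
  qed
  have "?R \<longleftrightarrow> (x \<in> set xs \<longrightarrow> x = hd xs)" if C: "?C xs"
  proof (intro iffI impI allI)
    assume R: ?R "x \<in> set xs"
    then obtain r where r: "r < length xs" "xs ! r = x" by (auto simp: in_set_conv_nth)
    show "x = hd xs"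
    proof (cases "r = 0")
      case True
      then show ?thesis using r by (simp add: hd_conv_nth)
    next
      case False
      hence "xs ! 0 = x" using R(1)[rule_format, of 0 r] r by simp
      thus ?thesis using r by (cases xs) auto
    qed
  next
    fix q r assume h: "x \<in> set xs \<longrightarrow> x = hd xs" "q < r" "r < length xs" "x = xs ! r"
    have x0: "x = xs ! 0" using h by (cases xs) auto
    show "xs ! q = x"
    proof (cases "q = 0")
      case False
      hence "xs ! q = xs ! 0" using C[rule_format, of 0 q r] h(2-4) x0 by simp
      thus ?thesis using x0 by simp
    qed (simp add: x0)
  qed
  note eq = this
  show ?case unfolding distinct_remdups_adj_Cons step Cons.IH
    by (rule conj_cong[OF refl eq[symmetric]])
qed simp

text \<open>If equal keys are contiguous, collecting the entries key by key in the order of first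
  occurrence moves nothing.\<close>

lemma concat_filter_remdups_adj:
  assumes "distinct (remdups_adj (map fst cs))"
  shows "concat (map (\<lambda>b. filter (\<lambda>c. fst c = b) cs) (remdups_adj (map fst cs))) = cs"
  using assms
proof (induction cs)
  case (Cons c cs)
  let ?F = "\<lambda>cs b. filter (\<lambda>c. fst c = b) cs"
  have IH: "concat (map (?F cs) (remdups_adj (map fst cs))) = cs"
    using Cons by (simp add: distinct_remdups_adj_Cons)
  show ?case
  proof (cases "fst c \<in> set (map fst cs)")
    case False
    hence "?F cs (fst c) = []" by (metis (mono_tags, lifting) filter_False image_eqI list.set_map)
    moreover have m: "map (?F (c # cs)) (remdups_adj (map fst cs)) = map (?F cs) (remdups_adj (map fst cs))"
      using False by (intro map_cong) auto
    moreover have r: "remdups_adj (map fst (c # cs)) = fst c # remdups_adj (map fst cs)"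
      using False by (cases cs) auto
    ultimately show ?thesis unfolding r unfolding list.map(2) m concat.simps IH by simp
  next
    case True
    then obtain d ds where ds: "cs = d # ds" by (cases cs) auto
    have hd: "fst c = fst d" using Cons.prems True
      unfolding list.map(2) distinct_remdups_adj_Cons ds by auto
    have rd: "remdups_adj (map fst (c # cs)) = remdups_adj (map fst cs)" using hd ds by simp
    obtain bs where bs: "remdups_adj (map fst cs) = fst c # bs"
      unfolding ds using hd by (metis list.simps(9) remdups_adj_Cons_alt)
    have nb: "fst c \<notin> set bs" using Cons.prems unfolding rd bs by simp
    have m: "map (?F (c # cs)) bs = map (?F cs) bs" using nb by (intro map_cong) auto
    show ?thesis using IH unfolding rd bs unfolding list.map(2) m concat.simps by simp
  qed
qed simp

lemma remdups_adj_concat_replicate: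
  assumes "distinct bs" "\<forall>b\<in>set bs. c b \<noteq> 0"
  shows "remdups_adj (concat (map (\<lambda>b. replicate (c b) b) bs)) = bs"
  using assms
proof (induction bs)
  case (Cons b bs)
  have rep: "remdups_adj (replicate k b @ ys) = b # remdups_adj ys"
    if "k \<noteq> 0" "b \<notin> set ys" for k ys
    using that
  proof (induction k)
    case (Suc k)
    then show ?case by (cases k; cases ys) auto
  qed simp
  show ?case using Cons rep[of "c b" "concat (map (\<lambda>b. replicate (c b) b) bs)"] by auto
qed simp

lemma distinct_concat_map_eq:
  assumes "distinct (concat (map f xs))" "x \<in> set xs" "y \<in> set xs" "e \<in> set (f x)" "e \<in> set (f y)"
  shows "x = y"
  using assms by (induction xs) auto

lemma down_closed_lessThan:
  fixes D :: "nat set"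
  assumes "D \<subseteq> {..<K}" "\<And>x y. y \<in> D \<Longrightarrow> x < y \<Longrightarrow> x \<in> D"
  shows "D = {..<card D}"
proof -
  have fin: "finite D" using assms(1) finite_subset by blast
  have "x < card D" if "x \<in> D" for x
  proof -
    have "{..x} \<subseteq> D" using that assms(2) by (auto simp: le_less)
    from card_mono[OF fin this] show ?thesis by simp
  qed
  hence "D \<subseteq> {..<card D}" by auto
  thus ?thesis by (rule card_subset_eq[OF finite_lessThan]) simp
qed

text \<open>By monotonicity the preimage of the values below \<open>c\<close> is an initial segment,
  and its size is the sum of the earlier fibre sizes. So the fibres are consecutive intervals with
  forced end points.\<close>

lemma mono_fibers:
  fixes f d :: "nat \<Rightarrow> nat"
  assumes ran: "\<And>x. x < K \<Longrightarrow> f x \<in> {1..n}"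
    and mono: "\<And>x y. x < y \<Longrightarrow> y < K \<Longrightarrow> f x \<le> f y"
    and fib: "\<And>b. b \<in> {1..n} \<Longrightarrow> card {x. x < K \<and> f x = b} = d b"
    and b: "b \<in> {1..n}"
  shows "{x. x < K \<and> f x = b} = {sum d {1..<b} ..< sum d {1..<b} + d b}"
proof -
  have lt: "{x. x < K \<and> f x < c} = {..<sum d {1..<c}}" if c: "c \<le> Suc n" for c
  proof -
    let ?D = "{x. x < K \<and> f x < c}"
    have "card ?D = card (\<Union>b\<in>{1..<c}. {x. x < K \<and> f x = b})"
      using ran by (intro arg_cong[where f = card]) fastforce
    also have "\<dots> = (\<Sum>b\<in>{1..<c}. card {x. x < K \<and> f x = b})"
      by (rule card_UN_disjoint) auto
    also have "\<dots> = sum d {1..<c}" using fib c by (intro sum.cong) auto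
    finally show ?thesis
      using down_closed_lessThan[of ?D K] mono by (fastforce dest: order.strict_trans1)
  qed
  have "{x. x < K \<and> f x = b} = {x. x < K \<and> f x < Suc b} - {x. x < K \<and> f x < b}" by auto
  also have "\<dots> = {..<sum d {1..<Suc b}} - {..<sum d {1..<b}}" using lt[of b] lt[of "Suc b"] b by simp
  finally show ?thesis using b by auto
qed

text \<open>Collapsing runs loses nothing: equal neighbours are neither ascents nor descents, and
  the length of a run is fixed by \<open>m\<close>.\<close>

definition word :: "vetree \<Rightarrow> nat list" where
  "word u = remdups_adj (map fst (children u))"

definition child_labels :: "vetree \<Rightarrow> (nat \<times> vlabel) list" where
  "child_labels u = map (\<lambda>(e, t). (e, vlab t)) (children u)"

text \<open>Increasing enumeration of the integers other than \<open>r\<close>, that is, of the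
  integer labels left once the root has taken \<open>r\<close>.\<close>

definition skip :: "nat \<Rightarrow> nat \<Rightarrow> nat" where
  "skip r x = (if x < r then x else Suc x)"

text \<open>Integer labels grow with the labels of the edges above them, so the group below the
  edges labeled \<open>b\<close> starts after the groups of all smaller edge labels, of sizes
  \<open>m i - 1\<close>.\<close>

definition fibre_start :: "(nat \<Rightarrow> nat) \<Rightarrow> nat \<Rightarrow> nat" where
  "fibre_start m b = (\<Sum>i\<in>{1..<b}. m i - 1)"

definition fibre :: "(nat \<Rightarrow> nat) \<Rightarrow> nat \<Rightarrow> nat \<Rightarrow> nat list" where
  "fibre m r b = map (skip r) [fibre_start m b ..< fibre_start m b + (m b - 1)]"

definition labels :: "(nat \<Rightarrow> nat) \<Rightarrow> nat \<Rightarrow> nat \<Rightarrow> vlabel list" where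
  "labels m r b = (if m b = 1 then [Sym b] else map Num (fibre m r b))"

text \<open>Everything that concerns a vertex and its children once the root label is known: the
  blocks come in the order of \<open>word u\<close>, each with its forced starting labels. What
  stays global in \<open>rooted_trees\<close> is the root label and that each letter occurs in
  exactly one word.\<close>

definition local_ok :: "(nat \<Rightarrow> nat) \<Rightarrow> nat \<Rightarrow> vetree \<Rightarrow> bool" where
  "local_ok m r u \<longleftrightarrow>
     child_labels u = concat (map (\<lambda>b. map (Pair b) (labels m r b)) (word u)) \<and>
     (\<forall>i. vlab u = Sym i \<longrightarrow> children u = [])"

definition rooted_trees :: "nat \<Rightarrow> (nat \<Rightarrow> nat) \<Rightarrow> nat \<Rightarrow> vetree set" where
  "rooted_trees n m r = {T. vlab T = Num r \<and> (\<forall>u\<in>set (vertices T). local_ok m r u) \<and>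
     distinct (concat (map word (vertices T))) \<and> set (concat (map word (vertices T))) = {1..n}}"

lemma strict_mono_skip: "strict_mono (skip r)"
  by (auto simp: strict_mono_def skip_def)

lemma inj_skip: "inj (skip r)"
  by (rule strict_mono_imp_inj_on[OF strict_mono_skip])

lemma skip_less_iff [simp]: "skip r x < skip r y \<longleftrightarrow> x < y"
  using strict_mono_less[OF strict_mono_skip] .

lemma skip_image: "r \<le> K \<Longrightarrow> skip r ` {..<K} = {0..K} - {r}"
proof (intro equalityI subsetI)
  fix y assume "r \<le> K" "y \<in> {0..K} - {r}"
  thus "y \<in> skip r ` {..<K}"
    by (cases "y < r") (auto simp: skip_def intro: image_eqI[of _ _ y] image_eqI[of _ _ "y - 1"])
qed (auto simp: skip_def)

lemma fibre_start_mono: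
  assumes "1 \<le> b" "b < c"
  shows "fibre_start m b + (m b - 1) \<le> fibre_start m c"
proof -
  have "fibre_start m b + (m b - 1) = (\<Sum>i\<in>{1..<Suc b}. m i - 1)"
    using assms by (simp add: fibre_start_def)
  also have "\<dots> \<le> fibre_start m c" unfolding fibre_start_def using assms by (intro sum_mono2) auto
  finally show ?thesis .
qed

lemma set_fibre: "set (fibre m r b) = skip r ` {fibre_start m b ..< fibre_start m b + (m b - 1)}"
  by (simp add: fibre_def)

lemma fibre_less:
  assumes "1 \<le> b" "b < c" "x \<in> set (fibre m r b)" "y \<in> set (fibre m r c)"
  shows "x < y"
  using assms fibre_start_mono[OF assms(1,2), of m] by (auto simp: set_fibre)

lemma sorted_fibre: "sorted_wrt (<) (fibre m r b)"
  by (simp add: fibre_def sorted_wrt_map)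

lemma UN_intervals:
  "(\<Union>b\<in>{1..n}. {fibre_start m b ..< fibre_start m b + (m b - 1)}) = {..<\<Sum>i=1..n. m i - 1}"
proof (induction n)
  case (Suc n)
  have "(\<Union>b\<in>{1..Suc n}. {fibre_start m b ..< fibre_start m b + (m b - 1)}) =
     {fibre_start m (Suc n) ..< fibre_start m (Suc n) + (m (Suc n) - 1)} \<union> {..<\<Sum>i=1..n. m i - 1}"
    unfolding Suc.IH[symmetric] by (simp add: atLeastAtMostSuc_conv)
  also have "fibre_start m (Suc n) = (\<Sum>i=1..n. m i - 1)"
    unfolding fibre_start_def by (simp add: atLeastLessThanSuc_atLeastAtMost)
  finally show ?case by (auto simp: ivl_disj_un)
qed simp

lemma UN_fibre:
  assumes "r \<le> (\<Sum>i=1..n. m i - 1)"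
  shows "(\<Union>b\<in>{1..n}. set (fibre m r b)) = {0..\<Sum>i=1..n. m i - 1} - {r}"
  unfolding skip_image[OF assms, symmetric] UN_intervals[symmetric] set_fibre by blast

lemma length_labels:
  "length (labels m r b) = (if m b = 1 then 1 else m b - 1)"
  by (simp add: labels_def fibre_def)

lemma labels_nonempty: "1 \<le> m b \<Longrightarrow> labels m r b \<noteq> []"
  by (auto simp: labels_def fibre_def)

lemma distinct_labels: "distinct (labels m r b)"
  using sorted_fibre[of m r b] strict_sorted_iff[of "fibre m r b"]
  by (auto simp: labels_def distinct_map inj_on_def)

lemma labels_disjoint:
  assumes "1 \<le> b" "1 \<le> c" "b \<noteq> c"
  shows "set (labels m r b) \<inter> set (labels m r c) = {}"
proof -
  have *: "x \<noteq> y" if "x \<in> set (fibre m r b)" "y \<in> set (fibre m r c)" for x y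
    using fibre_less[of b c x m r y] fibre_less[of c b y m r x] that assms
    by (cases "b < c") (auto simp: linorder_neq_iff)
  show ?thesis using assms(3) by (auto simp: labels_def dest: *)
qed

lemma Num_in_labels_iff: "1 \<le> m b \<Longrightarrow> Num a \<in> set (labels m r b) \<longleftrightarrow> a \<in> set (fibre m r b)"
  by (auto simp: labels_def fibre_def)

lemma Sym_in_labels_iff: "Sym i \<in> set (labels m r b) \<longleftrightarrow> m b = 1 \<and> i = b"
  by (auto simp: labels_def)

lemma mset_concat_map: "mset (concat (map f xs)) = (\<Sum>x\<leftarrow>xs. mset (f x))"
  by (induction xs) auto

lemma nonroot_Node:
  "mset (nonroot (Node v cs)) = mset cs + (\<Sum>(e, t)\<leftarrow>cs. mset (nonroot t))"
proof -
  have "mset (concat (map children (concat (map (\<lambda>(e, t). vertices t) cs)))) =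
      (\<Sum>(e, t)\<leftarrow>cs. mset (nonroot t))"
    by (induction cs) (auto simp: nonroot_def)
  thus ?thesis by (simp add: nonroot_def)
qed

text \<open>\<open>vertices\<close> is in preorder while \<open>nonroot\<close> keeps siblings
  together, so the comparison is one of multisets.\<close>

lemma mset_vertices: "mset (vertices T) = add_mset T (image_mset snd (mset (nonroot T)))"
proof (induction T rule: vertices.induct)
  case (1 v cs)
  have "mset (vertices (Node v cs)) =
      add_mset (Node v cs) (\<Sum>(e, t)\<leftarrow>cs. add_mset t (image_mset snd (mset (nonroot t))))"
  proof -
    have "(\<Sum>(e, t)\<leftarrow>cs. mset (vertices t)) = (\<Sum>(e, t)\<leftarrow>cs. add_mset t (image_mset snd (mset (nonroot t))))"
      using 1 by (intro arg_cong[where f = sum_list] map_cong) auto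
    thus ?thesis by (simp add: mset_concat_map case_prod_unfold)
  qed
  also have "(\<Sum>(e, t)\<leftarrow>cs. add_mset t (image_mset snd (mset (nonroot t)))) =
      image_mset snd (mset cs + (\<Sum>(e, t)\<leftarrow>cs. mset (nonroot t)))"
    by (induction cs) auto
  finally show ?case by (simp add: nonroot_Node)
qed

lemma edges_conv:
  "edges T = concat (map (\<lambda>u. map (\<lambda>(e, l). (l, e, vlab u)) (child_labels u)) (vertices T))"
  unfolding edges_def child_labels_def by (simp add: o_def case_prod_unfold)

lemma edges_nonroot: "map (\<lambda>(s, e, v). (s, e)) (edges T) = map (\<lambda>(e, t). (vlab t, e)) (nonroot T)"
  unfolding edges_def nonroot_def by (simp add: map_concat o_def case_prod_unfold)

lemma set_word: "set (word u) = fst ` set (children u)"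
  by (simp add: word_def)

lemma in_edges_iff:
  "(s, e, v) \<in> set (edges T) \<longleftrightarrow> (\<exists>u\<in>set (vertices T). vlab u = v \<and> (e, s) \<in> set (child_labels u))"
  unfolding edges_conv by auto

lemma in_nonroot_iff: "c \<in> set (nonroot T) \<longleftrightarrow> (\<exists>u\<in>set (vertices T). c \<in> set (children u))"
  by (auto simp: nonroot_def)

lemma set_vertices: "set (vertices T) = insert T (snd ` set (nonroot T))"
  using arg_cong[OF mset_vertices[of T], of set_mset] by simp

lemma mset_vertex_labels:
  "mset (map vlab (vertices T)) = add_mset (vlab T) (mset (map (\<lambda>(e, t). vlab t) (nonroot T)))"
proof -
  have "mset (map vlab (vertices T)) = image_mset vlab (mset (vertices T))" by simp
  also have "\<dots> = add_mset (vlab T) (image_mset (\<lambda>(e, t). vlab t) (mset (nonroot T)))"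
    unfolding mset_vertices by (simp add: image_mset.compositionality o_def case_prod_unfold)
  finally show ?thesis by simp
qed

lemma card_1_eq: "card A = 1 \<Longrightarrow> a \<in> A \<Longrightarrow> A = {a}"
  by (metis card_1_singletonE singletonD)

section \<open>The tree conditions imply the local form\<close>

locale multiplicities =
  fixes n :: nat and m :: "nat \<Rightarrow> nat"
  assumes m_pos: "\<And>i. i \<in> {1..n} \<Longrightarrow> 1 \<le> m i"
begin

abbreviation "K \<equiv> \<Sum>i=1..n. m i - 1"

text \<open>Subtraction of naturals is truncated; it distributes over the sum here because every
  \<open>m i\<close> is at least 1.\<close>

lemma sum_minus_n: "(\<Sum>i=1..n. m i) - n = K"
proof -
  have "(\<Sum>i=1..n. m i) = (\<Sum>i=1..n. (m i - 1) + 1)"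
    by (intro sum.cong refl) (use m_pos in fastforce)
  also have "\<dots> = K + n" by (subst sum.distrib) simp
  finally show ?thesis by simp
qed

lemma sum_length_labels:
  "(\<Sum>i=1..n. length (labels m r i)) = (\<Sum>i=1..n. m i) - card {i \<in> {1..n}. m i > 1}"
proof -
  have "(\<Sum>i=1..n. m i) = (\<Sum>i=1..n. length (labels m r i) + (if m i > 1 then 1 else 0))"
    by (intro sum.cong refl) (use m_pos in \<open>fastforce simp: length_labels\<close>)
  also have "\<dots> = (\<Sum>i=1..n. length (labels m r i)) + card {i \<in> {1..n}. m i > 1}"
    by (subst sum.distrib) (simp add: sum.If_cases Int_def)
  finally show ?thesis by simp
qed

context
  fixes T :: vetree
  assumes T: "T \<in> VE_trees n m"
begin

lemmas VE = T[unfolded VE_trees_def Let_def sum_minus_n mem_Collect_eq]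

lemma VE_distinct: "distinct (map vlab (vertices T))"
  using VE[THEN conjunct2, THEN conjunct1] .

lemma VE_labels: "set (map vlab (vertices T)) = Num ` {0..K} \<union> Sym ` {i \<in> {1..n}. m i = 1}"
  using VE[THEN conjunct2, THEN conjunct2, THEN conjunct1] .

lemma VE_Sym: "\<And>i t. i \<in> {1..n} \<Longrightarrow> m i = 1 \<Longrightarrow> t \<in> set (vertices T) \<Longrightarrow>
        vlab t = Sym i \<longleftrightarrow> children t = [] \<and> (i, t) \<in> set (nonroot T)"
  using VE[THEN conjunct2, THEN conjunct2, THEN conjunct2, THEN conjunct1] by blast

lemma VE_edge_labels: "mset (map (\<lambda>(s, e, v). e) (edges T)) =
       (\<Sum>i=1..n. replicate_mset (if m i > 1 then m i - 1 else 1) i)"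
  using VE[THEN conjunct2, THEN conjunct2, THEN conjunct2, THEN conjunct2, THEN conjunct1] .

lemma VE_same_end: "\<And>s e v s' v'. (s, e, v) \<in> set (edges T) \<Longrightarrow> (s', e, v') \<in> set (edges T) \<Longrightarrow> v = v'"
  using VE[THEN conjunct2, THEN conjunct2, THEN conjunct2, THEN conjunct2, THEN conjunct2, THEN conjunct1] by blast

lemma VE_contiguous: "\<And>u p q r. u \<in> set (vertices T) \<Longrightarrow> p < q \<Longrightarrow> q < r \<Longrightarrow> r < length (children u) \<Longrightarrow>
        fst (children u ! p) = fst (children u ! r) \<Longrightarrow>
        fst (children u ! q) = fst (children u ! p)"
  using VE[THEN conjunct2, THEN conjunct2, THEN conjunct2, THEN conjunct2, THEN conjunct2, THEN conjunct2, THEN conjunct1] by blast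

lemma VE_increasing: "\<And>u p q. u \<in> set (vertices T) \<Longrightarrow> p < q \<Longrightarrow> q < length (children u) \<Longrightarrow>
        fst (children u ! p) = fst (children u ! q) \<Longrightarrow>
        (\<exists>a b. vlab (snd (children u ! p)) = Num a \<and> vlab (snd (children u ! q)) = Num b \<and> a < b)"
  using VE[THEN conjunct2, THEN conjunct2, THEN conjunct2, THEN conjunct2, THEN conjunct2, THEN conjunct2, THEN conjunct2, THEN conjunct1] by blast

lemma VE_order: "\<And>a e v a' e' v'. (Num a, e, v) \<in> set (edges T) \<Longrightarrow> (Num a', e', v') \<in> set (edges T) \<Longrightarrow>
        e \<noteq> e' \<Longrightarrow> (e < e' \<longleftrightarrow> a < a')"
  using VE[THEN conjunct2, THEN conjunct2, THEN conjunct2, THEN conjunct2, THEN conjunct2, THEN conjunct2, THEN conjunct2, THEN conjunct2] by blast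

lemma distinct_nonroot_labels: "distinct (map (\<lambda>(e, t). vlab t) (nonroot T))"
  and root_label_notin: "vlab T \<notin> set (map (\<lambda>(e, t). vlab t) (nonroot T))"
proof -
  have "mset (vlab T # map (\<lambda>(e, t). vlab t) (nonroot T)) = mset (map vlab (vertices T))"
    unfolding mset_vertex_labels by simp
  hence "distinct (vlab T # map (\<lambda>(e, t). vlab t) (nonroot T))"
    using VE_distinct mset_eq_imp_distinct_iff by blast
  thus "distinct (map (\<lambda>(e, t). vlab t) (nonroot T))"
    "vlab T \<notin> set (map (\<lambda>(e, t). vlab t) (nonroot T))" by simp_all
qed

text \<open>A root labeled \<open>Sym i\<close> would have to hang below an edge labeled
  \<open>i\<close>, and its label would then occur a second time among the non-root
  vertices.\<close>

lemma VE_root: obtains r where "vlab T = Num r" "r \<le> K"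
proof (cases "vlab T")
  case (Num r)
  hence "Num r \<in> set (map vlab (vertices T))" by (simp add: set_vertices)
  hence "r \<le> K" unfolding VE_labels by auto
  thus ?thesis using that Num by blast
next
  case (Sym i)
  have root: "T \<in> set (vertices T)" by (simp add: set_vertices)
  hence "Sym i \<in> set (map vlab (vertices T))" using Sym by (metis image_eqI set_map)
  hence "i \<in> {1..n}" "m i = 1" unfolding VE_labels by auto
  hence "(i, T) \<in> set (nonroot T)" using VE_Sym Sym root by blast
  thus ?thesis using root_label_notin by force
qed

definition pairs :: "(nat \<times> vlabel) set" where
  "pairs = (\<lambda>(e, t). (e, vlab t)) ` set (nonroot T)"

lemma pairs_edges: "(b, l) \<in> pairs \<longleftrightarrow> (\<exists>v. (l, b, v) \<in> set (edges T))"
  unfolding pairs_def in_edges_iff child_labels_def by (force simp: in_nonroot_iff)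

lemma pairs_unique: "(b, l) \<in> pairs \<Longrightarrow> (c, l) \<in> pairs \<Longrightarrow> b = c"
proof -
  assume "(b, l) \<in> pairs" "(c, l) \<in> pairs"
  then obtain t t' where t: "(b, t) \<in> set (nonroot T)" "(c, t') \<in> set (nonroot T)" "vlab t = l" "vlab t' = l"
    by (auto simp: pairs_def)
  thus "b = c" using distinct_nonroot_labels by (force simp: distinct_map inj_on_def)
qed

text \<open>Starting vertices have distinct labels, so counting these labels counts the edges
  labeled \<open>b\<close>.\<close>

lemma count_edge_label:
  assumes "b \<in> {1..n}"
  shows "card {l. (b, l) \<in> pairs} = (if m b > 1 then m b - 1 else 1)"
proof -
  let ?N = "filter (\<lambda>(e, t). e = b) (nonroot T)"
  have "map (\<lambda>(s, e, v). e) (edges T) = map snd (map (\<lambda>(s, e, v). (s, e)) (edges T))"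
    by (simp add: o_def case_prod_unfold)
  also have "\<dots> = map fst (nonroot T)"
    unfolding edges_nonroot by (simp add: o_def case_prod_unfold)
  finally have "mset (map fst (nonroot T)) = (\<Sum>i=1..n. replicate_mset (if m i > 1 then m i - 1 else 1) i)"
    using VE_edge_labels by simp
  from arg_cong[OF this, of "\<lambda>A. count A b"]
  have "count (mset (map fst (nonroot T))) b = (if m b > 1 then m b - 1 else 1)"
    unfolding count_sum count_replicate_mset using assms by simp
  moreover have "count (mset (map fst xs)) b = length (filter (\<lambda>(e, t). e = b) xs)"
    for xs :: "(nat \<times> vetree) list"
    by (induction xs) auto
  moreover have "distinct (map (\<lambda>(e, t). vlab t) ?N)"
    using distinct_nonroot_labels by (simp add: distinct_map_filter)
  from distinct_card[OF this] have "card (set (map (\<lambda>(e, t). vlab t) ?N)) = length ?N" by simp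
  moreover have "set (map (\<lambda>(e, t). vlab t) ?N) = {l. (b, l) \<in> pairs}"
    by (force simp: pairs_def)
  ultimately show ?thesis by simp
qed

lemma pairs_label_range: "(b, l) \<in> pairs \<Longrightarrow> b \<in> {1..n}"
proof -
  assume "(b, l) \<in> pairs"
  then obtain v where "(l, b, v) \<in> set (edges T)" by (auto simp: pairs_edges)
  hence "b \<in> set_mset (mset (map (\<lambda>(s, e, v). e) (edges T)))" by force
  also have "\<dots> \<subseteq> {1..n}" unfolding VE_edge_labels by (auto simp: set_mset_sum split: if_splits)
  finally show ?thesis .
qed

lemma snd_pairs:
  assumes r: "vlab T = Num r"
  shows "snd ` pairs = Num ` ({0..K} - {r}) \<union> Sym ` {i \<in> {1..n}. m i = 1}"
proof -
  have "insert (Num r) (snd ` pairs) = Num ` {0..K} \<union> Sym ` {i \<in> {1..n}. m i = 1}"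
    unfolding VE_labels[symmetric] set_map set_vertices pairs_def
    by (simp add: r image_image case_prod_unfold)
  moreover have "Num r \<notin> snd ` pairs"
    using root_label_notin by (simp add: r pairs_def image_image case_prod_unfold)
  moreover have "Num r \<notin> Sym ` {i \<in> {1..n}. m i = 1}" by auto
  moreover have "Num ` ({0..K} - {r}) = Num ` {0..K} - {Num r}" by auto
  moreover have "insert x A = B \<union> C \<Longrightarrow> x \<notin> A \<Longrightarrow> x \<notin> C \<Longrightarrow> D = B - {x} \<Longrightarrow> A = D \<union> C"
    for x :: vlabel and A B C D by auto
  ultimately show ?thesis by presburger
qed

lemma Sym_pair_iff: "(b, Sym i) \<in> pairs \<longleftrightarrow> i = b \<and> b \<in> {1..n} \<and> m b = 1"
proof -
  have "i \<in> {1..n} \<and> m i = 1" if "(b, Sym i) \<in> pairs" for b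
  proof -
    obtain r where r: "vlab T = Num r" using VE_root by blast
    have "Sym i \<in> snd ` pairs" using that by (rule image_eqI[rotated]) simp
    thus ?thesis unfolding snd_pairs[OF r] by auto
  qed
  moreover have "(i, Sym i) \<in> pairs" if i: "i \<in> {1..n}" "m i = 1"
  proof -
    have "Sym i \<in> vlab ` set (vertices T)" using VE_labels i by simp
    then obtain t where t: "t \<in> set (vertices T)" "vlab t = Sym i" by auto
    hence "(i, t) \<in> set (nonroot T)" using VE_Sym[OF i] by simp
    thus ?thesis unfolding pairs_def using t by force
  qed
  ultimately show ?thesis using pairs_unique by blast
qed

text \<open>
  The integer labels increase weakly with the edge labels above them, so the root label alone fixes
  which vertices hang below the edges labeled \<open>b\<close>.
\<close>

lemma pairs_labels:
  assumes r: "vlab T = Num r" "r \<le> K" and b: "b \<in> {1..n}"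
  shows "{l. (b, l) \<in> pairs} = set (labels m r b)"
proof (cases "m b = 1")
  case True
  have "Sym b \<in> {l. (b, l) \<in> pairs}" using True b Sym_pair_iff by simp
  moreover have "card {l. (b, l) \<in> pairs} = 1" using count_edge_label[OF b] True by simp
  ultimately show ?thesis using True by (simp add: labels_def card_1_eq)
next
  case False
  \<comment> \<open>\<open>f x\<close> is the label of the edge above the \<open>x\<close>-th
    non-root integer. Its fibre over \<open>c\<close> has \<open>m c - 1\<close> elements also when
    \<open>m c = 1\<close>, as the only edge labeled \<open>c\<close> then starts at
    \<open>Sym c\<close>.\<close>
  define f where "f x = (THE c. (c, Num (skip r x)) \<in> pairs)" for x
  have f: "(c, Num (skip r x)) \<in> pairs \<longleftrightarrow> f x = c" if "x < K" for x c
  proof -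
    have "skip r x \<in> {0..K} - {r}" using skip_image[OF r(2)] that by blast
    hence "Num (skip r x) \<in> snd ` pairs" using snd_pairs[OF r(1)] by blast
    then obtain c' where c': "(c', Num (skip r x)) \<in> pairs" by auto
    hence "f x = c'" unfolding f_def using pairs_unique by blast
    thus ?thesis using c' pairs_unique by blast
  qed
  have Num_pairs: "{l. (c, l) \<in> pairs} \<inter> range Num = (Num \<circ> skip r) ` {x. x < K \<and> f x = c}" for c
  proof (intro equalityI subsetI)
    fix l assume l: "l \<in> {l. (c, l) \<in> pairs} \<inter> range Num"
    then obtain a where a: "l = Num a" "(c, Num a) \<in> pairs" by auto
    hence "Num a \<in> snd ` pairs" by force
    hence "a \<in> skip r ` {..<K}" unfolding snd_pairs[OF r(1)] skip_image[OF r(2)] by auto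
    then obtain x where "x < K" "a = skip r x" by auto
    thus "l \<in> (Num \<circ> skip r) ` {x. x < K \<and> f x = c}" using a f by auto
  qed (use f in auto)
  have inj: "inj (Num \<circ> skip r)" by (rule inj_compose[OF _ inj_skip]) (simp add: inj_def)
  have big: "{l. (c, l) \<in> pairs} \<subseteq> range Num" if "m c \<noteq> 1" for c
  proof
    fix l assume "l \<in> {l. (c, l) \<in> pairs}"
    thus "l \<in> range Num" using Sym_pair_iff that by (cases l) auto
  qed
  have fib: "card {x. x < K \<and> f x = c} = m c - 1" if c: "c \<in> {1..n}" for c
  proof -
    have "card {x. x < K \<and> f x = c} = card ((Num \<circ> skip r) ` {x. x < K \<and> f x = c})"
      by (rule card_image[symmetric]) (use inj inj_on_subset in blast)
    also have "\<dots> = card ({l. (c, l) \<in> pairs} \<inter> range Num)" unfolding Num_pairs ..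
    also have "\<dots> = m c - 1"
    proof (cases "m c = 1")
      case True
      have "Sym c \<in> {l. (c, l) \<in> pairs}" using True c Sym_pair_iff by simp
      moreover have "card {l. (c, l) \<in> pairs} = 1" using count_edge_label[OF c] True by simp
      ultimately have "{l. (c, l) \<in> pairs} = {Sym c}" by (simp add: card_1_eq)
      thus ?thesis using True by auto
    next
      case False
      hence "{l. (c, l) \<in> pairs} \<inter> range Num = {l. (c, l) \<in> pairs}" using big by blast
      thus ?thesis using count_edge_label[OF c] False m_pos[OF c] by simp
    qed
    finally show ?thesis .
  qed
  have "{x. x < K \<and> f x = b} =
      {sum (\<lambda>i. m i - 1) {1..<b} ..< sum (\<lambda>i. m i - 1) {1..<b} + (m b - 1)}"
  proof (rule mono_fibers[OF _ _ fib b])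
    fix x assume "x < K"
    thus "f x \<in> {1..n}" using f pairs_label_range by blast
  next
    fix x y assume xy: "x < y" "y < K"
    hence "(f x, Num (skip r x)) \<in> pairs" "(f y, Num (skip r y)) \<in> pairs" using f by simp_all
    then obtain v w where "(Num (skip r x), f x, v) \<in> set (edges T)" "(Num (skip r y), f y, w) \<in> set (edges T)"
      unfolding pairs_edges by blast
    from VE_order[OF this] xy show "f x \<le> f y" by (cases "f x = f y") auto
  qed
  hence "{x. x < K \<and> f x = b} = {fibre_start m b ..< fibre_start m b + (m b - 1)}"
    by (simp add: fibre_start_def)
  moreover have "{l. (b, l) \<in> pairs} = (Num \<circ> skip r) ` {x. x < K \<and> f x = b}"
    by (rule trans[OF Int_absorb2[OF big[OF False], symmetric] Num_pairs])
  ultimately show ?thesis using False by (simp add: labels_def set_fibre image_comp)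
qed

text \<open>All edges labeled \<open>b\<close> end at the same vertex, so the block of
  \<open>b\<close> there carries the full set of forced labels. The increase from left to right then
  fixes their order.\<close>

lemma VE_local_ok:
  assumes r: "vlab T = Num r" "r \<le> K" and u: "u \<in> set (vertices T)"
  shows "local_ok m r u" and "distinct (word u)"
proof -
  show dw: "distinct (word u)" unfolding word_def distinct_remdups_adj_iff
  proof (intro allI impI)
    fix p q r assume "p < q" "q < r" "r < length (map fst (children u))"
      "map fst (children u) ! p = map fst (children u) ! r"
    thus "map fst (children u) ! q = map fst (children u) ! p"
      using VE_contiguous[OF u, of p q r] by simp
  qed
  let ?cs = "children u"
  have block: "map (\<lambda>(e, t). (e, vlab t)) (filter (\<lambda>c. fst c = b) ?cs) = map (Pair b) (labels m r b)"
    if b: "b \<in> set (word u)" for b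
  proof -
    define ls where "ls = map (\<lambda>c. vlab (snd c)) (filter (\<lambda>c. fst c = b) ?cs)"
    obtain t where t: "(b, t) \<in> set ?cs" using b by (auto simp: set_word)
    hence "(b, vlab t) \<in> pairs" using u by (force simp: pairs_def in_nonroot_iff)
    hence b1: "b \<in> {1..n}" using pairs_label_range by blast
    have "set ls = {l. (b, l) \<in> pairs}"
    proof (intro equalityI subsetI)
      fix l assume "l \<in> set ls"
      thus "l \<in> {l. (b, l) \<in> pairs}" using u by (force simp: ls_def pairs_def in_nonroot_iff)
    next
      fix l assume "l \<in> {l. (b, l) \<in> pairs}"
      then obtain v where v: "(l, b, v) \<in> set (edges T)" by (auto simp: pairs_edges)
      moreover have "(vlab t, b, vlab u) \<in> set (edges T)"
        using t u by (force simp: in_edges_iff child_labels_def)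
      ultimately have "v = vlab u" using VE_same_end by blast
      with v obtain u' where u': "u' \<in> set (vertices T)" "vlab u' = vlab u" "(b, l) \<in> set (child_labels u')"
        by (auto simp: in_edges_iff)
      hence "u' = u" using VE_distinct u by (auto simp: distinct_map dest: inj_onD)
      thus "l \<in> set ls" using u' by (force simp: ls_def child_labels_def)
    qed
    hence set_ls: "set ls = set (labels m r b)" using pairs_labels[OF r b1] by simp
    let ?Q = "\<lambda>c d. fst c = fst d \<longrightarrow> (\<exists>a a'. vlab (snd c) = Num a \<and> vlab (snd d) = Num a' \<and> a < a')"
    have "sorted_wrt ?Q ?cs" unfolding sorted_wrt_iff_nth_less using VE_increasing[OF u] by blast
    hence "sorted_wrt ?Q (filter (\<lambda>c. fst c = b) ?cs)" by (rule sorted_wrt_filter)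
    hence sw: "sorted_wrt (\<lambda>l l'. \<exists>a a'. l = Num a \<and> l' = Num a' \<and> a < a') ls"
      unfolding ls_def sorted_wrt_map by (rule sorted_wrt_mono_rel[rotated]) auto
    have "ls = labels m r b"
    proof (cases "m b = 1")
      case True
      hence s: "set ls = {Sym b}" using set_ls by (simp add: labels_def)
      then obtain l ls' where l: "ls = l # ls'" by (cases ls) auto
      \<comment> \<open>A second entry would have to be related to the first, but the relation holds
        between integer labels only.\<close>
      have "ls' = []" using sw s l by (cases ls') auto
      thus ?thesis using s l True by (simp add: labels_def)
    next
      case False
      define as where "as = map (\<lambda>l. case l of Num a \<Rightarrow> a | Sym i \<Rightarrow> i) ls"
      have ran: "set ls = Num ` set (fibre m r b)" using set_ls False by (simp add: labels_def)
      have ls: "ls = map Num as" unfolding as_def map_map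
        by (rule map_idI[symmetric]) (use ran in auto)
      have "set as = set (fibre m r b)" using ran unfolding ls by (auto simp: inj_image_eq_iff inj_def)
      moreover have "sorted_wrt (<) as" using sw unfolding ls by (simp add: sorted_wrt_map)
      ultimately have "as = fibre m r b" using sorted_fibre[of m r b]
        by (metis strict_sorted_equal)
      thus ?thesis using False ls by (simp add: labels_def)
    qed
    moreover have "map (\<lambda>(e, t). (e, vlab t)) (filter (\<lambda>c. fst c = b) ?cs) = map (Pair b) ls"
      unfolding ls_def by (auto intro!: map_cong)
    ultimately show ?thesis by simp
  qed
  have "child_labels u = map (\<lambda>(e, t). (e, vlab t)) (concat (map (\<lambda>b. filter (\<lambda>c. fst c = b) ?cs) (word u)))"
    unfolding child_labels_def word_def concat_filter_remdups_adj[OF dw[unfolded word_def]] ..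
  also have "\<dots> = concat (map (\<lambda>b. map (Pair b) (labels m r b)) (word u))"
    unfolding map_concat map_map o_def using block by (intro arg_cong[where f = concat] map_cong) auto
  finally have "child_labels u = \<dots>" .
  moreover have "children u = []" if i: "vlab u = Sym i" for i
  proof -
    have "Sym i \<in> set (map vlab (vertices T))" using i u by force
    hence "i \<in> {1..n}" "m i = 1" unfolding VE_labels by auto
    thus ?thesis using VE_Sym u i by blast
  qed
  ultimately show "local_ok m r u" by (simp add: local_ok_def)
qed

lemma VE_rooted:
  assumes r: "vlab T = Num r" "r \<le> K"
  shows "T \<in> rooted_trees n m r"
proof -
  have ex: "\<exists>l. (l, e, vlab u) \<in> set (edges T)" if "u \<in> set (vertices T)" "e \<in> set (word u)" for u e
    using that by (force simp: set_word in_edges_iff child_labels_def)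
  have "distinct (concat (map word (vertices T)))" unfolding distinct_concat_iff
  proof (intro conjI allI impI)
    fix i assume "i < length (map word (vertices T))"
    thus "distinct (map word (vertices T) ! i)" using VE_local_ok(2)[OF r] by simp
  next
    fix i j assume ij: "i < length (map word (vertices T))" "j < length (map word (vertices T))" "i \<noteq> j"
    show "set (map word (vertices T) ! i) \<inter> set (map word (vertices T) ! j) = {}"
    proof (rule ccontr)
      assume "\<not> ?thesis"
      then obtain e where e: "e \<in> set (word (vertices T ! i))" "e \<in> set (word (vertices T ! j))" using ij by auto
      then obtain l l' where "(l, e, vlab (vertices T ! i)) \<in> set (edges T)"
        "(l', e, vlab (vertices T ! j)) \<in> set (edges T)" using ij ex by (metis length_map nth_mem)
      hence "vlab (vertices T ! i) = vlab (vertices T ! j)" by (rule VE_same_end)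
      thus False using VE_distinct ij by (auto simp: distinct_conv_nth)
    qed
  qed
  moreover have "set (concat (map word (vertices T))) = fst ` pairs"
    by (force simp: set_word pairs_def in_nonroot_iff)
  moreover have "fst ` pairs = {1..n}"
  proof (intro equalityI subsetI)
    fix b assume b: "b \<in> {1..n}"
    hence "set (labels m r b) \<noteq> {}" using labels_nonempty[of m b r] m_pos by simp
    then obtain l where "l \<in> set (labels m r b)" by (meson ex_in_conv)
    hence "(b, l) \<in> pairs" using pairs_labels[OF r b] by blast
    thus "b \<in> fst ` pairs" by (rule image_eqI[rotated]) simp
  qed (use pairs_label_range in auto)
  ultimately show ?thesis using r VE_local_ok(1)[OF r] by (simp add: rooted_trees_def)
qed

end

end

lemma concat_map_concat_map: "concat (map (\<lambda>u. concat (map f (g u))) us) = concat (map f (concat (map g us)))"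
  by (induction us) auto

lemma mset_concat_map_perm:
  assumes "distinct W" "set W = {1..n}"
  shows "mset (concat (map f W)) = (\<Sum>i=1..n. mset (f i))"
  unfolding mset_concat_map using assms by (metis sum_list_distinct_conv_sum_set)

section \<open>The local form implies the tree conditions\<close>

context multiplicities
begin

context
  fixes T :: vetree and r :: nat
  assumes T: "T \<in> rooted_trees n m r" and r_le: "r \<le> K"
begin

abbreviation "W \<equiv> concat (map word (vertices T))"

lemma rooted_root: "vlab T = Num r"
  and rooted_local_ok: "u \<in> set (vertices T) \<Longrightarrow> local_ok m r u"
  and rooted_distinct: "distinct W"
  and rooted_letters: "set W = {1..n}"
  using T by (auto simp: rooted_trees_def)

lemma rooted_child_labels: "u \<in> set (vertices T) \<Longrightarrow>
    child_labels u = concat (map (\<lambda>b. map (Pair b) (labels m r b)) (word u))"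
  using rooted_local_ok by (simp add: local_ok_def)

lemma rooted_nonroot:
  "map (\<lambda>(e, t). (e, vlab t)) (nonroot T) = concat (map (\<lambda>b. map (Pair b) (labels m r b)) W)"
proof -
  have "map (\<lambda>(e, t). (e, vlab t)) (nonroot T) = concat (map child_labels (vertices T))"
    unfolding nonroot_def child_labels_def map_concat by (simp add: o_def)
  also have "\<dots> = concat (map (\<lambda>u. concat (map (\<lambda>b. map (Pair b) (labels m r b)) (word u))) (vertices T))"
    using rooted_child_labels by (intro arg_cong[where f = concat] map_cong refl) auto
  finally show ?thesis unfolding concat_map_concat_map .
qed

lemma rooted_word_range: "u \<in> set (vertices T) \<Longrightarrow> b \<in> set (word u) \<Longrightarrow> b \<in> {1..n}"
  using rooted_letters by auto

lemma rooted_nonroot_iff: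
  "(\<exists>t. (b, t) \<in> set (nonroot T) \<and> vlab t = l) \<longleftrightarrow> b \<in> {1..n} \<and> l \<in> set (labels m r b)"
proof -
  have "(\<exists>t. (b, t) \<in> set (nonroot T) \<and> vlab t = l) \<longleftrightarrow>
      (b, l) \<in> set (map (\<lambda>(e, t). (e, vlab t)) (nonroot T))" by force
  also have "\<dots> \<longleftrightarrow> b \<in> set W \<and> l \<in> set (labels m r b)" unfolding rooted_nonroot by auto
  finally show ?thesis unfolding rooted_letters .
qed

lemma rooted_vertex_labels:
  "mset (map vlab (vertices T)) = mset (Num r # concat (map (labels m r) W))"
proof -
  have "map (\<lambda>(e, t). vlab t) (nonroot T) = map snd (map (\<lambda>(e, t). (e, vlab t)) (nonroot T))"
    by (simp add: case_prod_unfold)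
  also have "\<dots> = concat (map (labels m r) W)"
    unfolding rooted_nonroot map_concat map_map o_def by simp
  finally show ?thesis unfolding mset_vertex_labels rooted_root by simp
qed

lemma rooted_distinct_labels: "distinct (map vlab (vertices T))"
proof -
  have "Num r \<notin> set (labels m r b)" for b
  proof -
    have "skip r x \<noteq> r" for x by (simp add: skip_def)
    hence "r \<notin> set (fibre m r b)" unfolding set_fibre by (metis imageE)
    thus ?thesis by (auto simp: labels_def)
  qed
  moreover have "distinct (concat (map (labels m r) us))" if "distinct us" "set us \<subseteq> {1..n}" for us
    using that
  proof (induction us)
    case (Cons b us)
    have "set (labels m r b) \<inter> set (labels m r c) = {}" if "c \<in> set us" for c
      using Cons.prems that by (intro labels_disjoint) auto
    thus ?case using Cons by (auto simp: distinct_labels)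
  qed simp
  ultimately have "distinct (Num r # concat (map (labels m r) W))"
    using rooted_distinct rooted_letters by auto
  thus ?thesis using rooted_vertex_labels mset_eq_imp_distinct_iff by blast
qed

lemma rooted_label_set:
  "set (map vlab (vertices T)) = Num ` {0..K} \<union> Sym ` {i \<in> {1..n}. m i = 1}"
proof -
  have "set (map vlab (vertices T)) = set (Num r # concat (map (labels m r) W))"
    using rooted_vertex_labels by (metis set_mset_mset)
  also have "\<dots> = insert (Num r) (\<Union>b\<in>{1..n}. set (labels m r b))"
  proof -
    have "set (concat (map f ws)) = (\<Union>b\<in>set ws. set (f b))" for f :: "nat \<Rightarrow> vlabel list" and ws by auto
    thus ?thesis unfolding rooted_letters[symmetric] list.set by blast
  qed
  also have "(\<Union>b\<in>{1..n}. set (labels m r b)) = Num ` (\<Union>b\<in>{1..n}. set (fibre m r b)) \<union> Sym ` {i \<in> {1..n}. m i = 1}"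
  proof -
    have *: "set (labels m r b) = Num ` set (fibre m r b) \<union> (if m b = 1 then {Sym b} else {})" for b
      by (simp add: labels_def fibre_def image_image)
    show ?thesis unfolding * image_UN UN_Un_distrib by (intro arg_cong2[where f = "(\<union>)"]) auto
  qed
  also have "\<dots> = Num ` ({0..K} - {r}) \<union> Sym ` {i \<in> {1..n}. m i = 1}"
    unfolding UN_fibre[OF r_le] ..
  also have "insert (Num r) \<dots> = Num ` {0..K} \<union> Sym ` {i \<in> {1..n}. m i = 1}"
    using r_le by auto
  finally show ?thesis .
qed

lemma rooted_edge_labels: "mset (map (\<lambda>(s, e, v). e) (edges T)) =
       (\<Sum>i=1..n. replicate_mset (if m i > 1 then m i - 1 else 1) i)"
proof -
  have "map (\<lambda>(s, e, v). e) (edges T) = map snd (map (\<lambda>(s, e, v). (s, e)) (edges T))"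
    by (simp add: case_prod_unfold)
  also have "\<dots> = map fst (map (\<lambda>(e, t). (e, vlab t)) (nonroot T))"
    unfolding edges_nonroot by (simp add: case_prod_unfold)
  also have "\<dots> = concat (map (\<lambda>b. replicate (length (labels m r b)) b) W)"
    unfolding rooted_nonroot map_concat map_map o_def by (simp add: map_replicate_const)
  also have "mset \<dots> = (\<Sum>i=1..n. mset (replicate (length (labels m r i)) i))"
    by (rule mset_concat_map_perm[OF rooted_distinct rooted_letters])
  also have "\<dots> = (\<Sum>i=1..n. replicate_mset (if m i > 1 then m i - 1 else 1) i)"
    by (intro sum.cong refl) (use m_pos in \<open>fastforce simp: length_labels\<close>)
  finally show ?thesis .
qed

lemma rooted_length_edges: "length (edges T) = (\<Sum>i=1..n. m i) - card {i \<in> {1..n}. m i > 1}"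
proof -
  have "length (edges T) = size (mset (map (\<lambda>(s, e, v). e) (edges T)))" by simp
  also have "\<dots> = (\<Sum>i=1..n. if m i > 1 then m i - 1 else 1)"
    unfolding rooted_edge_labels size_multiset_sum size_replicate_mset ..
  also have "\<dots> = (\<Sum>i=1..n. length (labels m r i))"
    by (intro sum.cong refl) (use m_pos in \<open>fastforce simp: length_labels\<close>)
  finally show ?thesis unfolding sum_length_labels .
qed

lemma rooted_Sym:
  assumes i: "i \<in> {1..n}" "m i = 1" and t: "t \<in> set (vertices T)"
  shows "vlab t = Sym i \<longleftrightarrow> children t = [] \<and> (i, t) \<in> set (nonroot T)"
proof
  assume l: "vlab t = Sym i"
  hence "t \<noteq> T" using rooted_root by auto
  then obtain e where e: "(e, t) \<in> set (nonroot T)" using t by (auto simp: set_vertices)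
  hence "Sym i \<in> set (labels m r e)" using rooted_nonroot_iff[of e "Sym i"] l by blast
  thus "children t = [] \<and> (i, t) \<in> set (nonroot T)"
    using e l rooted_local_ok[OF t] by (auto simp: Sym_in_labels_iff local_ok_def)
next
  assume "children t = [] \<and> (i, t) \<in> set (nonroot T)"
  hence "vlab t \<in> set (labels m r i)" using rooted_nonroot_iff by blast
  thus "vlab t = Sym i" using i by (simp add: labels_def)
qed

lemma rooted_in_edges:
  assumes "(s, e, v) \<in> set (edges T)"
  obtains u where "u \<in> set (vertices T)" "vlab u = v" "e \<in> set (word u)" "s \<in> set (labels m r e)" "e \<in> {1..n}"
proof -
  obtain u where u: "u \<in> set (vertices T)" "vlab u = v" "(e, s) \<in> set (child_labels u)"
    using assms by (auto simp: in_edges_iff)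
  hence "e \<in> set (word u)" "s \<in> set (labels m r e)" using rooted_child_labels by auto
  thus thesis using that u rooted_word_range by blast
qed

lemma rooted_same_end:
  assumes "(s, e, v) \<in> set (edges T)" "(s', e, v') \<in> set (edges T)"
  shows "v = v'"
proof -
  obtain u where u: "u \<in> set (vertices T)" "vlab u = v" "e \<in> set (word u)"
    using rooted_in_edges[OF assms(1)] by blast
  obtain u' where u': "u' \<in> set (vertices T)" "vlab u' = v'" "e \<in> set (word u')"
    using rooted_in_edges[OF assms(2)] by blast
  show ?thesis using distinct_concat_map_eq[OF rooted_distinct u(1) u'(1) u(3) u'(3)] u u' by simp
qed

lemma rooted_distinct_word: "u \<in> set (vertices T) \<Longrightarrow> distinct (word u)"
  using rooted_distinct by (auto simp: distinct_concat_iff in_set_conv_nth)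

lemma rooted_contiguous:
  assumes "u \<in> set (vertices T)" "p < q" "q < s" "s < length (children u)"
    "fst (children u ! p) = fst (children u ! s)"
  shows "fst (children u ! q) = fst (children u ! p)"
  using rooted_distinct_word[OF assms(1), unfolded word_def distinct_remdups_adj_iff, rule_format,
      of p q s] assms by simp

text \<open>Within one block the labels increase because \<open>fibre\<close> does. Entries of
  different blocks carry different edge labels, as the word of a vertex is distinct, so nothing is
  required of them.\<close>

lemma rooted_increasing:
  assumes u: "u \<in> set (vertices T)" and pq: "p < q" "q < length (children u)"
    "fst (children u ! p) = fst (children u ! q)"
  shows "\<exists>a b. vlab (snd (children u ! p)) = Num a \<and> vlab (snd (children u ! q)) = Num b \<and> a < b"
proof -
  let ?Q = "\<lambda>c d. fst c = fst d \<longrightarrow> (\<exists>a b. snd c = Num a \<and> snd d = Num b \<and> a < b)"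
  have lab: "sorted_wrt ?Q (map (Pair b) (labels m r b))" for b
    using sorted_fibre[of m r b] by (simp add: labels_def sorted_wrt_map)
  have "sorted_wrt ?Q (concat (map (\<lambda>b. map (Pair b) (labels m r b)) bs))" if "distinct bs" for bs
    using that
  proof (induction bs)
    case (Cons b bs)
    thus ?case using lab[of b] by (auto simp: sorted_wrt_append)
  qed simp
  hence "sorted_wrt ?Q (child_labels u)"
    using rooted_child_labels[OF u] rooted_distinct_word[OF u] by simp
  hence "?Q (child_labels u ! p) (child_labels u ! q)"
    using pq by (simp add: sorted_wrt_iff_nth_less child_labels_def)
  thus ?thesis using pq by (simp add: child_labels_def case_prod_unfold)
qed

lemma rooted_order:
  assumes "(Num a, e, v) \<in> set (edges T)" "(Num a', e', v') \<in> set (edges T)" "e \<noteq> e'"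
  shows "e < e' \<longleftrightarrow> a < a'"
proof -
  have "e \<in> {1..n}" "Num a \<in> set (labels m r e)" using rooted_in_edges[OF assms(1)] by blast+
  moreover have "e' \<in> {1..n}" "Num a' \<in> set (labels m r e')" using rooted_in_edges[OF assms(2)] by blast+
  ultimately have *: "1 \<le> e" "1 \<le> e'" "a \<in> set (fibre m r e)" "a' \<in> set (fibre m r e')"
    using m_pos by (auto simp: Num_in_labels_iff)
  show ?thesis using fibre_less[of e e' a m r a'] fibre_less[of e' e a' m r a] * assms(3)
    by (cases e e' rule: linorder_cases) auto
qed

lemma rooted_VE: "T \<in> VE_trees n m"
  unfolding VE_trees_def Let_def sum_minus_n mem_Collect_eq
  by (intro conjI; (rule rooted_length_edges rooted_distinct_labels rooted_label_set rooted_edge_labels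
      | (intro allI ballI impI, rule rooted_Sym, assumption+)
      | (intro allI ballI impI, rule rooted_order, assumption+)
      | (intro allI ballI impI, rule rooted_increasing, assumption+)
      | (intro allI ballI impI, rule rooted_contiguous, assumption+)
      | (intro allI ballI impI, rule rooted_same_end, assumption+)))

end

lemma VE_trees_conv: "VE_trees n m = (\<Union>r\<in>{..K}. rooted_trees n m r)"
proof (intro equalityI subsetI)
  fix T assume T: "T \<in> VE_trees n m"
  obtain r where r: "vlab T = Num r" "r \<le> K" by (rule VE_root[OF T])
  thus "T \<in> (\<Union>r\<in>{..K}. rooted_trees n m r)" using VE_rooted[OF T r] by blast
next
  fix T assume "T \<in> (\<Union>r\<in>{..K}. rooted_trees n m r)"
  then obtain r where "r \<le> K" "T \<in> rooted_trees n m r" by blast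
  thus "T \<in> VE_trees n m" by (intro rooted_VE)
qed

end

section \<open>Plane trees without vertex labels\<close>

text \<open>
  A tree is determined by its root label and a plane tree in which every edge label carries the list
  of the subtrees below its \<open>m b - 1\<close> edges; the leaf \<open>Sym b\<close> is left implicit.
\<close>

datatype qtree = QN "(nat \<times> qtree list) list"

lemma size_qtree_child:
  assumes "(b, ts) \<in> set bs" "t \<in> set ts"
  shows "size t < size (QN bs)"
proof -
  have "size t < Suc (size_list size ts)" using assms(2) by (induction ts) auto
  also have "\<dots> \<le> size_prod (\<lambda>_. 0) (size_list size) (b, ts)" by simp
  also have "\<dots> \<le> size_list (size_prod (\<lambda>_. 0) (size_list size)) bs" using assms(1)
    by (induction bs) auto
  finally show ?thesis by simp
qed

function qvalid :: "(nat \<Rightarrow> nat) \<Rightarrow> qtree \<Rightarrow> bool" where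
  "qvalid m (QN bs) \<longleftrightarrow> (\<forall>(b, ts)\<in>set bs. length ts = m b - 1 \<and> (\<forall>t\<in>set ts. qvalid m t))"
  by pat_completeness auto
termination by (relation "measure (\<lambda>(m, q). size q)") (auto dest: size_qtree_child)

function dfs :: "qtree \<Rightarrow> nat list list" where
  "dfs (QN bs) = map fst bs # concat (map (\<lambda>(b, ts). concat (map dfs ts)) bs)"
  by pat_completeness auto
termination by (relation "measure size") (auto dest: size_qtree_child)

text \<open>\<open>b\<close> stands in front and behind each of the subtree words, hence occurs
  \<open>m b\<close> times at this edge label if there are \<open>m b - 1\<close> subtrees.\<close>

function qword :: "qtree \<Rightarrow> nat list" where
  "qword (QN bs) = concat (map (\<lambda>(b, ts). b # concat (map (\<lambda>t. qword t @ [b]) ts)) bs)"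
  by pat_completeness auto
termination by (relation "measure size") (auto dest: size_qtree_child)

text \<open>The argument \<open>b\<close> is the label of the edge above; it closes the word of the
  vertex on both sides.\<close>

function qweight :: "nat \<Rightarrow> qtree \<Rightarrow> pol3" where
  "qweight b (QN bs) = mon (b # map fst bs @ [b]) * (\<Prod>(c, ts)\<leftarrow>bs. \<Prod>t\<leftarrow>ts. qweight c t)"
  by pat_completeness auto
termination by (relation "measure (\<lambda>(b, q). size q)") (auto dest: size_qtree_child)

text \<open>In a valid tree with positive \<open>m b\<close>, the list \<open>ts\<close> is empty
  exactly if \<open>m b = 1\<close>, when the single edge leads to the leaf \<open>Sym b\<close>.
  The new integer labels depend on \<open>r\<close> and \<open>b\<close> only, never on the shape of
  the tree.\<close>

function mk :: "(nat \<Rightarrow> nat) \<Rightarrow> nat \<Rightarrow> vlabel \<Rightarrow> qtree \<Rightarrow> vetree" where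
  "mk m r v (QN bs) = Node v (concat (map (\<lambda>(b, ts).
     if ts = [] then [(b, Node (Sym b) [])]
     else map (\<lambda>(a, t). (b, mk m r (Num a) t)) (zip (fibre m r b) ts)) bs))"
  by pat_completeness auto
termination by (relation "measure (\<lambda>(m, r, v, q). size q)") (auto dest: size_qtree_child set_zip_rightD)

lemma qtree_induct [case_names QN]:
  assumes "\<And>bs. (\<And>b ts t. (b, ts) \<in> set bs \<Longrightarrow> t \<in> set ts \<Longrightarrow> P t) \<Longrightarrow> P (QN bs)"
  shows "P q"
proof (induction q rule: measure_induct_rule[of size])
  case (less q)
  then show ?case using assms size_qtree_child by (cases q) blast
qed

section \<open>Preorder sequences of words\<close>

text \<open>The number of vertices announced by a visit, in the sense of \<open>luk\<close>; an edge
  to a symbol leaf announces none.\<close>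

definition step :: "(nat \<Rightarrow> nat) \<Rightarrow> nat list \<Rightarrow> nat" where
  "step m w = (\<Sum>b\<leftarrow>w. m b - 1)"

text \<open>Preorder run as a stack: visiting a root puts its subtrees in front of the waiting
  trees. This is the recursion of \<open>luk\<close>, and the reason for working with
  forests.\<close>

lemma dfs_forest_Cons:
  "concat (map dfs (QN bs # ts)) = map fst bs # concat (map dfs (concat (map snd bs) @ ts))"
proof -
  have "concat (map (\<lambda>(b, ts). concat (map dfs ts)) bs) = concat (map dfs (concat (map snd bs)))"
    by (induction bs) auto
  thus ?thesis by simp
qed

lemma length_concat_snd:
  assumes "\<forall>(b, ts)\<in>set bs. length ts = m b - 1"
  shows "length (concat (map snd bs)) = step m (map fst bs)"
  using assms by (induction bs) (auto simp: step_def)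

lemma concat_snd_inject:
  assumes "map fst bs = map fst bs'" "concat (map snd bs) = concat (map snd bs')"
    "\<forall>(b, ts)\<in>set bs. length ts = l b" "\<forall>(b, ts)\<in>set bs'. length ts = l b"
  shows "bs = bs'"
  using assms
proof (induction bs arbitrary: bs')
  case (Cons c bs)
  then obtain c' bs'' where "bs' = c' # bs''" by (cases bs') auto
  with Cons show ?case by (cases c; cases c') (auto simp: append_eq_append_conv)
qed simp

lemma concat_snd_exists:
  assumes "length ts = step m w"
  shows "\<exists>bs. map fst bs = w \<and> (\<forall>(b, ts)\<in>set bs. length ts = m b - 1) \<and> concat (map snd bs) = ts"
  using assms
proof (induction w arbitrary: ts)
  case (Cons b w)
  have "length (drop (m b - 1) ts) = step m w" using Cons.prems by (simp add: step_def)
  from Cons.IH[OF this] obtain bs where bs: "map fst bs = w"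
    "\<forall>(b, ts)\<in>set bs. length ts = m b - 1" "concat (map snd bs) = drop (m b - 1) ts" by blast
  show ?case using bs Cons.prems
    by (intro exI[of _ "(b, take (m b - 1) ts) # bs"]) (auto simp: step_def)
qed (simp add: step_def)

lemma dfs_nonempty [simp]: "dfs q \<noteq> []"
  by (cases q) simp

lemma luk_dfs_forest:
  assumes "\<forall>t\<in>set ts. qvalid m t"
  shows "luk (step m) (length ts) (concat (map dfs ts))"
  using assms
proof (induction "concat (map dfs ts)" arbitrary: ts)
  case Nil
  then show ?case by (cases ts) auto
next
  case (Cons w ws)
  then obtain bs ts' where ts: "ts = QN bs # ts'" by (cases ts) (auto elim: qvalid.cases, metis qtree.exhaust)
  have v: "\<forall>t\<in>set (concat (map snd bs) @ ts'). qvalid m t" using Cons.prems ts by fastforce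
  have l: "length (concat (map snd bs)) = step m (map fst bs)"
    using Cons.prems ts by (intro length_concat_snd) auto
  have "ws = concat (map dfs (concat (map snd bs) @ ts'))"
    using Cons.hyps(2) unfolding ts dfs_forest_Cons by simp
  from Cons.hyps(1)[OF this v] l show ?case unfolding ts dfs_forest_Cons by (simp add: add.commute)
qed

text \<open>The first entry names the edge labels at the root, and \<open>qvalid\<close> tells how
  many subtrees each of them carries. So the stack after one visit, known by induction, can be cut
  back in one way only.\<close>

lemma dfs_forest_inject:
  assumes "concat (map dfs ts) = concat (map dfs ts')" "length ts = length ts'"
    "\<forall>t\<in>set ts. qvalid m t" "\<forall>t\<in>set ts'. qvalid m t"
  shows "ts = ts'"
  using assms
proof (induction "concat (map dfs ts)" arbitrary: ts ts')
  case Nil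
  then show ?case by (cases ts) auto
next
  case (Cons w ws)
  then obtain q us q' us' where ts0: "ts = q # us" "ts' = q' # us'" by (cases ts; cases ts') auto
  obtain bs bs' where qs: "q = QN bs" "q' = QN bs'" by (metis qtree.exhaust)
  note ts = ts0[unfolded qs]
  let ?C = "\<lambda>bs. concat (map snd bs)"
  have lens: "\<forall>(b, ts)\<in>set bs. length ts = m b - 1" "\<forall>(b, ts)\<in>set bs'. length ts = m b - 1"
    using Cons.prems ts by auto
  have v: "\<forall>t\<in>set (?C bs @ us). qvalid m t" "\<forall>t\<in>set (?C bs' @ us'). qvalid m t"
    using Cons.prems ts by fastforce+
  have eq: "map fst bs = map fst bs'" "concat (map dfs (?C bs @ us)) = concat (map dfs (?C bs' @ us'))"
    "ws = concat (map dfs (?C bs @ us))"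
    using Cons.hyps(2) Cons.prems(1) unfolding ts dfs_forest_Cons by simp_all
  have l: "length (?C bs) = length (?C bs')"
    unfolding length_concat_snd[OF lens(1)] length_concat_snd[OF lens(2)] eq(1) ..
  have "length us = length us'" using Cons.prems(2) ts by simp
  hence "?C bs @ us = ?C bs' @ us'"
    using Cons.hyps(1)[OF eq(3) eq(2) _ v] l by simp
  hence "?C bs = ?C bs'" "us = us'" using l by auto
  thus ?case using concat_snd_inject[OF eq(1) _ lens] ts by simp
qed

text \<open>The sequence is decoded from its end: the forest of the tail is built first, and its
  first \<open>step m w\<close> trees become the subtrees of the vertex with word
  \<open>w\<close>.\<close>

lemma dfs_forest_exists:
  assumes "luk (step m) s ws"
  shows "\<exists>ts. length ts = s \<and> (\<forall>t\<in>set ts. qvalid m t) \<and> concat (map dfs ts) = ws"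
  using assms
proof (induction ws arbitrary: s)
  case (Cons w ws)
  hence s: "0 < s" and "luk (step m) (s - 1 + step m w) ws" unfolding luk.simps by blast+
  from Cons.IH[OF this(2)] obtain us where us: "length us = s - 1 + step m w"
    "\<forall>t\<in>set us. qvalid m t" "concat (map dfs us) = ws" by blast
  have "length (take (step m w) us) = step m w" using us by simp
  then obtain bs where bs: "map fst bs = w" "\<forall>(b, ts)\<in>set bs. length ts = m b - 1"
    "concat (map snd bs) = take (step m w) us" using concat_snd_exists by metis
  have "qvalid m t" if "(b, ts) \<in> set bs" "t \<in> set ts" for b ts t
  proof -
    have "t \<in> set (concat (map snd bs))" using that by force
    thus ?thesis using us(2) bs(3) by (metis in_set_takeD)
  qed
  hence "qvalid m (QN bs)" using bs(2) by auto
  moreover have "concat (map dfs (QN bs # drop (step m w) us)) = w # ws"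
    unfolding dfs_forest_Cons bs append_take_drop_id us ..
  moreover have "length (QN bs # drop (step m w) us) = s" using us s by simp
  moreover have "\<forall>t\<in>set (drop (step m w) us). qvalid m t" using us(2) by (meson in_set_dropD)
  ultimately show ?case by (intro exI[of _ "QN bs # drop (step m w) us"]) auto
qed simp

definition qtrees :: "nat \<Rightarrow> (nat \<Rightarrow> nat) \<Rightarrow> qtree set" where
  "qtrees n m = {q. qvalid m q \<and> distinct (concat (dfs q)) \<and> set (concat (dfs q)) = {1..n}}"

lemma sum_step:
  assumes "distinct (concat P)" "set (concat P) = {1..n}"
  shows "sum_list (map (step m) P) = (\<Sum>i=1..n. m i - 1)"
proof -
  have "sum_list (map (step m) P) = (\<Sum>b\<leftarrow>concat P. m b - 1)"
    by (induction P) (auto simp: step_def)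
  thus ?thesis using assms by (metis sum_list_distinct_conv_sum_set)
qed

lemma bij_betw_dfs:
  assumes k: "k = Suc (\<Sum>i=1..n. m i - 1)"
  shows "bij_betw dfs (qtrees n m) {P \<in> word_tuples {1..n} k. luk (step m) 1 P}"
  unfolding bij_betw_def
proof (intro conjI equalityI subsetI)
  show "inj_on dfs (qtrees n m)"
  proof (rule inj_onI)
    fix q q' assume "q \<in> qtrees n m" "q' \<in> qtrees n m" "dfs q = dfs q'"
    thus "q = q'" using dfs_forest_inject[of "[q]" "[q']" m] by (simp add: qtrees_def)
  qed
next
  fix P assume "P \<in> dfs ` qtrees n m"
  then obtain q where q: "q \<in> qtrees n m" "P = dfs q" by blast
  have l: "luk (step m) 1 P" using luk_dfs_forest[of "[q]" m] q by (simp add: qtrees_def)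
  moreover have P: "distinct (concat P)" "set (concat P) = {1..n}" using q by (auto simp: qtrees_def)
  moreover have "length P = k" using l unfolding luk_iff sum_step[OF P] k by simp
  ultimately show "P \<in> {P \<in> word_tuples {1..n} k. luk (step m) 1 P}" by (simp add: word_tuples_def)
next
  fix P assume P: "P \<in> {P \<in> word_tuples {1..n} k. luk (step m) 1 P}"
  then obtain ts where ts: "length ts = 1" "\<forall>t\<in>set ts. qvalid m t" "concat (map dfs ts) = P"
    using dfs_forest_exists by blast
  then obtain q where "ts = [q]" by (cases ts) auto
  hence "q \<in> qtrees n m" "P = dfs q" using ts P by (auto simp: qtrees_def word_tuples_def)
  thus "P \<in> dfs ` qtrees n m" by blast
qed

section \<open>Labeling the vertices\<close>

definition is_Num :: "vetree \<Rightarrow> bool" where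
  "is_Num t \<longleftrightarrow> (\<exists>a. vlab t = Num a)"

context multiplicities
begin

abbreviation "mk_block r \<equiv> \<lambda>(b, ts). if ts = [] then [(b, Node (Sym b) [])]
     else map (\<lambda>(a, t). (b, mk m r (Num a) t)) (zip (fibre m r b) ts)"

lemma vlab_mk [simp]: "vlab (mk m r v q) = v"
  by (cases q) simp

lemma length_fibre [simp]: "length (fibre m r b) = m b - 1"
  by (simp add: fibre_def)

lemma mk_block_labels:
  assumes "length ts = m b - 1" "1 \<le> m b"
  shows "map (\<lambda>(e, t). (e, vlab t)) (mk_block r (b, ts)) = map (Pair b) (labels m r b)"
proof (cases "ts = []")
  case False
  hence "m b \<noteq> 1" using assms by auto
  moreover have "map (\<lambda>(a, t). (b, Num a)) (zip (fibre m r b) ts) =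
      map (\<lambda>a. (b, Num a)) (map fst (zip (fibre m r b) ts))" by (simp add: case_prod_unfold)
  ultimately show ?thesis using False assms(1)
    by (simp add: labels_def o_def case_prod_unfold)
qed (use assms in \<open>simp add: labels_def\<close>)

text \<open>Weaker than membership in \<open>qtrees\<close>, but inherited by subtrees. A subtree
  uses only some of the letters, so covering all of {1..n} could not be kept in an
  induction.\<close>

definition qproper :: "qtree \<Rightarrow> bool" where
  "qproper q \<longleftrightarrow> qvalid m q \<and> (\<forall>w\<in>set (dfs q). distinct w \<and> set w \<subseteq> {1..n})"

lemma qproper_QN: "qproper (QN bs) \<longleftrightarrow> distinct (map fst bs) \<and> fst ` set bs \<subseteq> {1..n} \<and>
    (\<forall>(b, ts)\<in>set bs. length ts = m b - 1 \<and> (\<forall>t\<in>set ts. qproper t))"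
  unfolding qproper_def by (fastforce simp del: distinct_map)

lemma qtrees_qproper: "q \<in> qtrees n m \<Longrightarrow> qproper q"
  unfolding qtrees_def qproper_def distinct_concat_iff by (auto simp: in_set_conv_nth)

text \<open>Symbol leaves have the empty word and \<open>dfs\<close> has no entry for them, hence
  the restriction to integer vertices. The label \<open>a\<close> of the top vertex is arbitrary,
  because a subtree receives its label from the interval of the edge above it.\<close>

lemma mk_facts:
  assumes "qproper q"
  shows "word (mk m r (Num a) q) = hd (dfs q) \<and>
    (\<forall>u\<in>set (vertices (mk m r (Num a) q)). local_ok m r u \<and> (is_Num u \<or> children u = [])) \<and>
    map word (filter is_Num (vertices (mk m r (Num a) q))) = dfs q"
  using assms
proof (induction q arbitrary: a rule: qtree_induct)
  case (QN bs)
  let ?T = "mk m r (Num a) (QN bs)"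
  {
    have mb: "length ts = m b - 1 \<and> 1 \<le> m b" if "(b, ts) \<in> set bs" for b ts
    proof -
      have "b \<in> {1..n}" using that QN.prems unfolding qproper_QN by force
      thus ?thesis using m_pos that QN.prems unfolding qproper_QN by auto
    qed
    have "child_labels ?T = concat (map (\<lambda>c. map (\<lambda>(e, t). (e, vlab t)) (mk_block r c)) bs)"
      by (simp add: child_labels_def map_concat o_def)
    also have "\<dots> = concat (map (\<lambda>c. map (Pair (fst c)) (labels m r (fst c))) bs)"
      using mb mk_block_labels by (intro arg_cong[where f = concat] map_cong refl) auto
    finally have "child_labels ?T = concat (map (\<lambda>b. map (Pair b) (labels m r b)) (map fst bs))"
      by (simp add: o_def)
    note this mb
  } note cl = this
  have "map fst (children ?T) = map fst (child_labels ?T)" by (simp add: child_labels_def case_prod_unfold)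
  also have "\<dots> = concat (map (\<lambda>b. replicate (length (labels m r b)) b) (map fst bs))"
    unfolding cl(1) map_concat map_map o_def by (simp add: map_replicate_const)
  finally have mf: "map fst (children ?T) = \<dots>" .
  \<comment> \<open>Every block is nonempty, also for \<open>m b = 1\<close>, so collapsing runs
    leaves one letter per block.\<close>
  have w: "word ?T = map fst bs" unfolding word_def mf
  proof (rule remdups_adj_concat_replicate)
    show "distinct (map fst bs)" using QN.prems unfolding qproper_QN by blast
    show "\<forall>b\<in>set (map fst bs). length (labels m r b) \<noteq> 0" using cl(2) labels_nonempty by fastforce
  qed
  hence hd: "word ?T = hd (dfs (QN bs))" by simp
  have lo: "local_ok m r ?T" unfolding local_ok_def cl(1) w by simp
  have sub: "qproper t" if "(b, ts) \<in> set bs" "t \<in> set ts" for b ts t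
    using QN.prems that unfolding qproper_QN by blast
  have all_ok: "\<forall>u\<in>set (vertices ?T). local_ok m r u \<and> (is_Num u \<or> children u = [])"
  proof
    fix u assume "u \<in> set (vertices ?T)"
    moreover have "vertices ?T = ?T # concat (map (\<lambda>c. vertices (snd c)) (concat (map (mk_block r) bs)))"
      by (simp add: case_prod_unfold)
    ultimately have "u = ?T \<or> (\<exists>c\<in>set (concat (map (mk_block r) bs)). u \<in> set (vertices (snd c)))" by auto
    moreover have "\<exists>b ts. (b, ts) \<in> set bs \<and> c \<in> set (mk_block r (b, ts))"
      if "c \<in> set (concat (map (mk_block r) bs))" for c
    proof -
      have "\<exists>p\<in>set ps. c \<in> set (f p)" if "c \<in> set (concat (map f ps))"
        for f :: "nat \<times> qtree list \<Rightarrow> (nat \<times> vetree) list" and ps using that by auto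
      from this[OF that] obtain p where "p \<in> set bs" "c \<in> set (mk_block r p)" by blast
      moreover obtain b ts where "p = (b, ts)" by (rule prod.exhaust)
      ultimately show ?thesis by blast
    qed
    ultimately consider "u = ?T"
      | b ts c where "(b, ts) \<in> set bs" "c \<in> set (mk_block r (b, ts))" "u \<in> set (vertices (snd c))"
      by blast
    thus "local_ok m r u \<and> (is_Num u \<or> children u = [])"
    proof cases
      case 1
      then show ?thesis using lo by (simp add: is_Num_def)
    next
      case 2
      show ?thesis
      proof (cases "ts = []")
        case True
        hence "u = Node (Sym b) []" using 2 by simp
        thus ?thesis by (simp add: local_ok_def child_labels_def word_def)
      next
        case False
        then obtain a' t where "t \<in> set ts" "u \<in> set (vertices (mk m r (Num a') t))"
          using 2 by (auto dest: set_zip_rightD)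
        thus ?thesis using QN.IH[OF 2(1), of t a'] sub[OF 2(1)] by blast
      qed
    qed
  qed
  have blk: "map word (filter is_Num (concat (map (\<lambda>(e, t). vertices t) (mk_block r (b, ts))))) =
      concat (map dfs ts)" if c: "(b, ts) \<in> set bs" for b ts
  proof (cases "ts = []")
    case False
    have "map word (filter is_Num (concat (map (\<lambda>(e, t). vertices t) (mk_block r (b, ts))))) =
        concat (map (\<lambda>(a, t). map word (filter is_Num (vertices (mk m r (Num a) t)))) (zip (fibre m r b) ts))"
      using False by (simp add: filter_concat map_concat o_def case_prod_unfold)
    also have "\<dots> = concat (map (\<lambda>(a, t). dfs t) (zip (fibre m r b) ts))"
      using QN.IH[OF c] sub[OF c]
      by (intro arg_cong[where f = concat] map_cong refl) (auto dest: set_zip_rightD)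
    also have "map (\<lambda>(a, t). dfs t) (zip (fibre m r b) ts) = map dfs (map snd (zip (fibre m r b) ts))"
      by (simp add: case_prod_unfold)
    finally show ?thesis using cl(2)[OF c] by simp
  qed (simp add: is_Num_def)
  have "map word (filter is_Num (vertices ?T)) =
      word ?T # concat (map (\<lambda>c. map word (filter is_Num (concat (map (\<lambda>(e, t). vertices t) (mk_block r c))))) bs)"
    by (simp add: is_Num_def filter_concat map_concat o_def concat_map_concat_map)
  also have "\<dots> = map fst bs # concat (map (\<lambda>(b, ts). concat (map dfs ts)) bs)"
    unfolding w using blk by (intro arg_cong2[where f = Cons] arg_cong[where f = concat] map_cong refl) auto
  finally show ?case using hd all_ok by simp
qed

lemma concat_word_is_Num:
  assumes "\<forall>u\<in>set us. is_Num u \<or> children u = []"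
  shows "concat (map word (filter is_Num us)) = concat (map word us)"
  using assms by (induction us) (auto simp: word_def)

lemma concat_word_mk:
  assumes "qproper q"
  shows "concat (map word (vertices (mk m r (Num r) q))) = concat (dfs q)"
  using mk_facts[OF assms, of r r] concat_word_is_Num[of "vertices (mk m r (Num r) q)"] by simp

lemma mk_rooted: "q \<in> qtrees n m \<Longrightarrow> mk m r (Num r) q \<in> rooted_trees n m r"
  using mk_facts[OF qtrees_qproper, of q r r] concat_word_mk[OF qtrees_qproper, of q r]
  by (simp add: qtrees_def rooted_trees_def del: set_concat)

lemma dfs_mk: "q \<in> qtrees n m \<Longrightarrow> map word (filter is_Num (vertices (mk m r (Num r) q))) = dfs q"
  using mk_facts[OF qtrees_qproper] by blast

text \<open>The construction is inverted vertex by vertex from the local conditions. That words at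
  different vertices are disjoint is transferred afterwards by
  \<open>concat_word_mk\<close>.\<close>

lemma mk_surj:
  assumes "vlab T = Num a" "\<forall>u\<in>set (vertices T). local_ok m r u \<and> distinct (word u) \<and> set (word u) \<subseteq> {1..n}"
  shows "\<exists>q. qproper q \<and> mk m r (Num a) q = T"
  using assms
proof (induction T arbitrary: a rule: vertices.induct)
  case (1 v cs)
  have ch: "\<exists>q. qproper q \<and> mk m r (Num a) q = t" if "(e, t) \<in> set cs" "vlab t = Num a" for e t a
  proof (rule "1.IH"[OF that(1) refl that(2)])
    have "set (vertices t) \<subseteq> set (vertices (Node v cs))" using that(1) by fastforce
    thus "\<forall>u\<in>set (vertices t). local_ok m r u \<and> distinct (word u) \<and> set (word u) \<subseteq> {1..n}"
      using 1(3) by blast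
  qed
  have leaf: "children t = []" if "(e, t) \<in> set cs" "vlab t = Sym i" for e t i
  proof -
    have "set (vertices t) \<subseteq> set (vertices (Node v cs))" using that(1) by fastforce
    hence "t \<in> set (vertices (Node v cs))" by (simp add: set_vertices)
    hence "local_ok m r t" using 1(3) by blast
    thus ?thesis using that(2) by (simp add: local_ok_def)
  qed
  have "\<exists>bs. map fst bs = ws \<and> (\<forall>(b, ts)\<in>set bs. length ts = m b - 1 \<and> (\<forall>t\<in>set ts. qproper t)) \<and> concat (map (mk_block r) bs) = ds"
    if "map (\<lambda>(e, t). (e, vlab t)) ds = concat (map (\<lambda>b. map (Pair b) (labels m r b)) ws)"
      "set ds \<subseteq> set cs" "set ws \<subseteq> {1..n}" for ds ws
    using that
  proof (induction ws arbitrary: ds)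
    case Nil
    then show ?case by (intro exI[of _ "[]"]) simp
  next
    case (Cons b ws)
    have b: "1 \<le> m b" using Cons.prems m_pos by auto
    from Cons.prems(1) obtain c ds' where ds: "ds = c @ ds'"
      "map (\<lambda>(e, t). (e, vlab t)) c = map (Pair b) (labels m r b)"
      "map (\<lambda>(e, t). (e, vlab t)) ds' = concat (map (\<lambda>b. map (Pair b) (labels m r b)) ws)"
      by (auto simp: map_eq_append_conv)
    obtain bs where bs: "map fst bs = ws" "\<forall>(b, ts)\<in>set bs. length ts = m b - 1 \<and> (\<forall>t\<in>set ts. qproper t)" "concat (map (mk_block r) bs) = ds'"
      using Cons.IH[OF ds(3)] Cons.prems ds by auto
    have "\<exists>ts. length ts = m b - 1 \<and> (\<forall>t\<in>set ts. qproper t) \<and> mk_block r (b, ts) = c"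
    proof (cases "m b = 1")
      case True
      then obtain t where t: "c = [(b, t)]" "vlab t = Sym b" using ds(2) by (auto simp: labels_def)
      hence "children t = []" using leaf Cons.prems(2) ds(1) by auto
      thus ?thesis using t True by (cases t) (intro exI[of _ "[]"], simp)
    next
      case False
      hence c: "map (\<lambda>(e, t). (e, vlab t)) c = map (\<lambda>a. (b, Num a)) (fibre m r b)"
        using ds(2) by (simp add: labels_def)
      have "\<exists>ts. length ts = length as \<and> (\<forall>t\<in>set ts. qproper t) \<and>
          map (\<lambda>(a, t). (b, mk m r (Num a) t)) (zip as ts) = c"
        if "map (\<lambda>(e, t). (e, vlab t)) c = map (\<lambda>a. (b, Num a)) as" "set c \<subseteq> set cs" for as
        using that
      proof (induction as arbitrary: c)
        case (Cons a as)
        then obtain t c' where c': "c = (b, t) # c'" "vlab t = Num a" by (cases c) auto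
        obtain ts where "length ts = length as" "\<forall>t\<in>set ts. qproper t"
          "map (\<lambda>(a, t). (b, mk m r (Num a) t)) (zip as ts) = c'" using Cons c' by auto
        moreover obtain q where "qproper q" "mk m r (Num a) q = t" using ch[of b t a] Cons.prems(2) c' by auto
        ultimately show ?case using c' by (intro exI[of _ "q # ts"]) simp
      qed simp
      from this[OF c] Cons.prems(2) ds(1) obtain ts where ts: "length ts = m b - 1"
        "\<forall>t\<in>set ts. qproper t" "map (\<lambda>(a, t). (b, mk m r (Num a) t)) (zip (fibre m r b) ts) = c" by auto
      moreover have "ts \<noteq> []" using ts(1) False b by auto
      ultimately show ?thesis by (intro exI[of _ ts]) simp
    qed
    then obtain ts where "length ts = m b - 1" "\<forall>t\<in>set ts. qproper t" "mk_block r (b, ts) = c" by blast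
    thus ?case using bs ds(1) by (intro exI[of _ "(b, ts) # bs"]) simp
  qed
  moreover have ok: "local_ok m r (Node v cs)" "distinct (word (Node v cs))" "set (word (Node v cs)) \<subseteq> {1..n}"
    using 1(3) by auto
  ultimately obtain bs where bs: "map fst bs = word (Node v cs)"
    "\<forall>(b, ts)\<in>set bs. length ts = m b - 1 \<and> (\<forall>t\<in>set ts. qproper t)" "concat (map (mk_block r) bs) = cs"
    unfolding local_ok_def child_labels_def vetree.sel by blast
  have "fst ` set bs \<subseteq> {1..n}" using ok(3) bs(1) by (metis set_map)
  hence "qproper (QN bs)" using bs(1,2) ok(2) unfolding qproper_QN by simp
  moreover have "mk m r (Num a) (QN bs) = Node v cs" using bs(3) 1(2) by simp
  ultimately show ?case by blast
qed

text \<open>Injectivity holds because \<open>dfs q\<close> can be read off the labeled tree and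
  determines \<open>q\<close>.\<close>

lemma bij_betw_mk: "bij_betw (mk m r (Num r)) (qtrees n m) (rooted_trees n m r)"
  unfolding bij_betw_def
proof (intro conjI equalityI subsetI)
  have "inj_on dfs (qtrees n m)" using bij_betw_dfs bij_betw_def by blast
  thus "inj_on (mk m r (Num r)) (qtrees n m)"
    using dfs_mk by (metis inj_on_def)
next
  fix T assume T: "T \<in> rooted_trees n m r"
  have "\<forall>u\<in>set (vertices T). distinct (word u)"
    using T by (auto simp: rooted_trees_def distinct_concat_iff in_set_conv_nth)
  hence "\<forall>u\<in>set (vertices T). local_ok m r u \<and> distinct (word u) \<and> set (word u) \<subseteq> {1..n}"
    and v: "vlab T = Num r" using T by (auto simp: rooted_trees_def)
  then obtain q where q: "qproper q" "mk m r (Num r) q = T" using mk_surj by blast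
  have "concat (map word (vertices T)) = concat (dfs q)"
    using concat_word_mk[OF q(1), of r] q(2) by simp
  hence "q \<in> qtrees n m" using q(1) T by (simp add: qtrees_def qproper_def rooted_trees_def del: set_concat)
  thus "T \<in> mk m r (Num r) ` qtrees n m" using q(2) by blast
qed (use mk_rooted in auto)

end

section \<open>Quasi-Stirling words\<close>

definition abab_free :: "nat list \<Rightarrow> bool" where
  "abab_free w \<longleftrightarrow> \<not> (\<exists>a b. a \<noteq> b \<and> subseq [a, b, a, b] w)"

lemma abab_freeD: "abab_free w \<Longrightarrow> a \<noteq> b \<Longrightarrow> \<not> subseq [a, b, a, b] w"
  unfolding abab_free_def by blast

lemma abab_free_subseq: "abab_free w \<Longrightarrow> subseq v w \<Longrightarrow> abab_free v"
  unfolding abab_free_def using subseq_order.order_trans by blast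

lemma subseq_set: "subseq xs ys \<Longrightarrow> set xs \<subseteq> set ys"
  by (metis notin_set_nthsI subseq_conv_nths subsetI)

lemma abab_free_append:
  assumes "abab_free u" "abab_free v" "set u \<inter> set v = {}"
  shows "abab_free (u @ v)"
  unfolding abab_free_def
proof (intro notI, elim exE conjE)
  fix a b assume ab: "a \<noteq> b" "subseq [a, b, a, b] (u @ v)"
  then obtain us vs where s: "[a, b, a, b] = us @ vs" "subseq us u" "subseq vs v"
    unfolding subseq_append_iff by blast
  have "set us \<inter> set vs = {}" using s(2,3)[THEN subseq_set] assms(3) by blast
  hence "us = [] \<or> vs = []" using s(1) by (auto simp: append_eq_Cons_conv Cons_eq_append_conv)
  hence "subseq [a, b, a, b] u \<or> subseq [a, b, a, b] v" using s by auto
  thus False using assms(1,2) ab(1) unfolding abab_free_def by blast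
qed

text \<open>With a leading \<open>b\<close> this is the block b W b W' b ... b that belongs to one
  edge label.\<close>

definition glue :: "nat \<Rightarrow> nat list list \<Rightarrow> nat list" where
  "glue b ws = concat (map (\<lambda>w. w @ [b]) ws)"

lemma glue_simps [simp]: "glue b [] = []" "glue b (w # ws) = w @ b # glue b ws"
  by (simp_all add: glue_def)

lemma filter_glue: "\<forall>w\<in>set ws. b \<notin> set w \<Longrightarrow> filter (\<lambda>x. x \<noteq> b) (glue b ws) = concat ws"
proof (induction ws)
  case (Cons w ws)
  have "filter (\<lambda>x. x \<noteq> b) w = w" using Cons.prems by (auto simp: filter_id_conv)
  thus ?case using Cons by simp
qed simp

fun separated :: "nat list list \<Rightarrow> bool" where
  "separated [] \<longleftrightarrow> True"
| "separated (w # ws) \<longleftrightarrow> set w \<inter> set (concat ws) = {} \<and> separated ws"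

text \<open>A letter other than \<open>b\<close> lives in a single piece, and no piece contains
  \<open>b\<close>.\<close>

lemma no_aba_glue:
  assumes "\<forall>w\<in>set (ws @ [v]). b \<notin> set w" "separated (ws @ [v])" "y \<noteq> b"
  shows "\<not> subseq [y, b, y] (glue b ws @ v)"
  using assms
proof (induction ws)
  case Nil
  then show ?case by (auto dest!: subseq_set)
next
  case (Cons w ws)
  show ?case
  proof
    assume "subseq [y, b, y] (glue b (w # ws) @ v)"
    then obtain us vs where s: "[y, b, y] = us @ vs" "subseq us w" "subseq vs (b # glue b ws @ v)"
      unfolding glue_simps append_assoc append_Cons subseq_append_iff by blast
    have w: "b \<notin> set us" "set us \<subseteq> set w" using subseq_set[OF s(2)] Cons.prems(1) by auto
    have v: "set vs \<subseteq> insert b (set (concat (ws @ [v])))"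
    proof -
      have "set (b # glue b ws @ v) \<subseteq> insert b (set (concat (ws @ [v])))" by (auto simp: glue_def)
      thus ?thesis using subseq_set[OF s(3)] by blast
    qed
    show False
    proof (cases us)
      case Nil
      hence "subseq [y, b, y] (b # glue b ws @ v)" using s by simp
      hence "subseq [y, b, y] (glue b ws @ v)" using Cons.prems(3) by simp
      thus False using Cons by simp
    next
      case (Cons z us')
      hence "z = y" "y \<in> set w" "y \<in> set vs" using s(1) w by (auto simp: Cons_eq_append_conv)
      thus False using v Cons.prems(2,3) by auto
    qed
  qed
qed

lemma abab_free_concat: "\<forall>w\<in>set ws. abab_free w \<Longrightarrow> separated ws \<Longrightarrow> abab_free (concat ws)"
proof (induction ws)
  case Nil
  then show ?case by (simp add: abab_free_def)
next
  case (Cons w ws)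
  then show ?case by (auto intro!: abab_free_append)
qed

text \<open>A pattern x y x y that uses \<open>b\<close> contains z b z for the other letter z. One
  that avoids \<open>b\<close> survives the deletion of \<open>b\<close>, which leaves the
  concatenation of disjoint abab-free pieces.\<close>

lemma abab_free_glue:
  assumes "\<forall>w\<in>set (ws @ [v]). b \<notin> set w \<and> abab_free w" "separated (ws @ [v])"
  shows "abab_free (b # glue b ws @ v)"
  unfolding abab_free_def
proof (intro notI, elim exE conjE)
  fix x y assume xy: "x \<noteq> y" "subseq [x, y, x, y] (b # glue b ws @ v)"
  have no: "\<not> subseq [z, b, z] (b # glue b ws @ v)" if "z \<noteq> b" for z
    using no_aba_glue[of ws v b z] assms that by simp
  have sub: "subseq [x, y, x] [x, y, x, y]" "subseq [y, x, y] [x, y, x, y]" by auto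
  show False
  proof (cases "x = b \<or> y = b")
    case True
    then show ?thesis using no[of x] no[of y] xy sub by (metis subseq_order.order_trans)
  next
    case False
    have "subseq (filter (\<lambda>z. z \<noteq> b) [x, y, x, y]) (filter (\<lambda>z. z \<noteq> b) (b # glue b ws @ v))"
      using xy(2) by (rule subseq_filter)
    also have "filter (\<lambda>z. z \<noteq> b) (b # glue b ws @ v) = concat (ws @ [v])"
      using assms(1) by (auto simp: filter_glue filter_id_conv)
    finally have "subseq [x, y, x, y] (concat (ws @ [v]))" using False by simp
    moreover have "abab_free (concat (ws @ [v]))" using assms by (intro abab_free_concat) auto
    ultimately show False using xy(1) by (auto simp: abab_free_def)
  qed
qed

lemma glue_exists:
  "\<exists>ws v. w = glue b ws @ v \<and> (\<forall>u\<in>set (ws @ [v]). b \<notin> set u)"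
proof (induction w)
  case Nil
  then show ?case by (intro exI[of _ "[]"]) auto
next
  case (Cons x w)
  then obtain ws v where w: "w = glue b ws @ v" "\<forall>u\<in>set (ws @ [v]). b \<notin> set u" by blast
  consider "x = b" | "x \<noteq> b" "ws = []" | u us where "x \<noteq> b" "ws = u # us" by (cases ws) auto
  thus ?case
  proof cases
    case 1
    thus ?thesis using w by (intro exI[of _ "[] # ws"] exI[of _ v]) auto
  next
    case 2
    thus ?thesis using w by (intro exI[of _ "[]"] exI[of _ "x # v"]) auto
  next
    case 3
    thus ?thesis using w by (intro exI[of _ "(x # u) # us"] exI[of _ v]) auto
  qed
qed

text \<open>A letter y in two different pieces produces y b y. A preceding \<open>b\<close> turns
  this into the forbidden b y b y.\<close>

lemma separated_glue:
  assumes "\<And>y. y \<noteq> b \<Longrightarrow> \<not> subseq [y, b, y] (glue b ws @ v)" "\<forall>u\<in>set (ws @ [v]). b \<notin> set u"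
  shows "separated (ws @ [v])"
  using assms
proof (induction ws)
  case (Cons w ws)
  have "separated (ws @ [v])"
  proof (rule Cons.IH)
    fix y assume "y \<noteq> b"
    hence "\<not> subseq [y, b, y] (w @ b # glue b ws @ v)" using Cons.prems(1) by simp
    thus "\<not> subseq [y, b, y] (glue b ws @ v)"
      by (meson list_emb_append2 list_emb_Cons)
  qed (use Cons.prems in auto)
  moreover have "set w \<inter> set (concat (ws @ [v])) = {}"
  proof (rule ccontr)
    assume "set w \<inter> set (concat (ws @ [v])) \<noteq> {}"
    then obtain y where y: "y \<in> set w" "y \<in> set (concat (ws @ [v]))" by blast
    hence "y \<noteq> b" using Cons.prems(2) by auto
    have "y \<in> set (glue b ws @ v)" using y(2) by (auto simp: glue_def)
    hence "subseq [y] w" "subseq [b, y] (b # glue b ws @ v)" using y by (auto simp: subseq_singleton_left)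
    hence "subseq ([y] @ [b, y]) (w @ b # glue b ws @ v)" by (rule list_emb_append_mono)
    thus False using Cons.prems(1)[OF \<open>y \<noteq> b\<close>] by simp
  qed
  ultimately show ?case by simp
qed simp

lemma append_Cons_inject:
  assumes "u @ b # v = u' @ b # v'" "b \<notin> set u" "b \<notin> set u'"
  shows "u = u' \<and> v = v'"
  using assms
proof (induction u arbitrary: u')
  case Nil
  then show ?case by (cases u') auto
next
  case (Cons x u)
  then show ?case by (cases u') auto
qed

lemma glue_inject:
  assumes "glue b ws @ v = glue b ws' @ v'" "length ws = length ws'"
    "\<forall>u\<in>set ws. b \<notin> set u" "\<forall>u\<in>set ws'. b \<notin> set u"
  shows "ws = ws' \<and> v = v'"
  using assms
proof (induction ws arbitrary: ws')
  case (Cons w ws)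
  then obtain w' us where ws': "ws' = w' # us" by (cases ws') auto
  have "w = w' \<and> glue b ws @ v = glue b us @ v'" using Cons.prems unfolding ws'
    by (intro append_Cons_inject[of _ b]) auto
  thus ?case using Cons ws' by auto
qed simp

section \<open>The word of a plane tree\<close>

abbreviation letters :: "qtree \<Rightarrow> nat list" where
  "letters q \<equiv> concat (dfs q)"

text \<open>The leftmost edge label is removed together with its subtrees, and the rest is again a
  tree. This mirrors cutting the first block off a word.\<close>

lemma qtree_peel_induct [case_names Nil Cons]:
  assumes "P (QN [])" "\<And>b ts bs. (\<And>t. t \<in> set ts \<Longrightarrow> P t) \<Longrightarrow> P (QN bs) \<Longrightarrow> P (QN ((b, ts) # bs))"
  shows "P q"
proof (induction q rule: measure_induct_rule[of size])
  case (less q)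
  obtain bs where q: "q = QN bs" by (cases q)
  show ?case
  proof (cases bs)
    case Nil
    then show ?thesis using assms q by simp
  next
    case (Cons c bs')
    obtain b ts where c: "c = (b, ts)" by (cases c)
    have "P t" if "t \<in> set ts" for t
      using less size_qtree_child[of b ts bs t] that q Cons c by simp
    moreover have "P (QN bs')" using less q Cons by simp
    ultimately show ?thesis using assms q Cons c by blast
  qed
qed

lemma letters_Cons:
  "mset (letters (QN ((b, ts) # bs))) = mset (b # concat (map letters ts) @ letters (QN bs))"
proof -
  have "mset (concat (concat (map dfs ts))) = mset (concat (map letters ts))" by (induction ts) auto
  thus ?thesis by simp
qed

lemma set_letters_Cons:
  "set (letters (QN ((b, ts) # bs))) = insert b (set (concat (map letters ts)) \<union> set (letters (QN bs)))"
  using arg_cong[OF letters_Cons, of set_mset] by (metis list.simps(15) set_append set_mset_mset)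

lemma distinct_letters_Cons:
  "distinct (letters (QN ((b, ts) # bs))) \<longleftrightarrow> distinct (b # concat (map letters ts) @ letters (QN bs))"
  using mset_eq_imp_distinct_iff[OF letters_Cons] .

lemma qword_Cons: "qword (QN ((b, ts) # bs)) = b # glue b (map qword ts) @ qword (QN bs)"
  by (simp add: glue_def o_def)

lemma set_qword: "set (qword q) = set (letters q)"
proof (induction q rule: qtree_peel_induct)
  case (Cons b ts bs)
  have "insert b (set (glue b ws)) = insert b (set (concat ws))" for ws by (auto simp: glue_def)
  moreover have "set (concat (map qword ts)) = set (concat (map letters ts))" using Cons.IH(1) by auto
  ultimately show ?case unfolding qword_Cons set_letters_Cons Cons.IH(2)[symmetric]
    by (metis Un_insert_left list.simps(15) set_append)
qed simp

lemma mset_qword: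
  assumes "qvalid m q" "\<forall>b\<in>set (letters q). 1 \<le> m b"
  shows "mset (qword q) = (\<Sum>b\<in>#mset (letters q). replicate_mset (m b) b)"
  using assms
proof (induction q rule: qtree_peel_induct)
  case (Cons b ts bs)
  have v: "length ts = m b - 1" "\<forall>t\<in>set ts. qvalid m t" "qvalid m (QN bs)" "1 \<le> m b"
    using Cons.prems unfolding set_letters_Cons by auto
  have "\<forall>b\<in>set (letters t). 1 \<le> m b" if "t \<in> set ts" for t
    using Cons.prems(2) that unfolding set_letters_Cons by (auto simp del: dfs.simps)
  hence IH1: "mset (qword t) = (\<Sum>b\<in>#mset (letters t). replicate_mset (m b) b)" if "t \<in> set ts" for t
    using Cons.IH(1) v(2) that by blast
  have "mset (glue b (map qword us)) = replicate_mset (length us) b +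
      (\<Sum>b\<in>#mset (concat (map letters us)). replicate_mset (m b) b)" if "set us \<subseteq> set ts" for us
    using that by (induction us) (auto simp: IH1)
  from this[of ts] have g: "mset (glue b (map qword ts)) = replicate_mset (m b - 1) b +
      (\<Sum>b\<in>#mset (concat (map letters ts)). replicate_mset (m b) b)" by (simp add: v(1))
  have "mset (qword (QN bs)) = (\<Sum>b\<in>#mset (letters (QN bs)). replicate_mset (m b) b)"
    using Cons.IH(2) v(3) Cons.prems(2) unfolding set_letters_Cons by blast
  moreover have "add_mset b (replicate_mset (m b - 1) b) = replicate_mset (m b) b"
    using v(4) by (cases "m b") auto
  ultimately show ?case unfolding qword_Cons letters_Cons mset.simps mset_append g
    by (simp del: dfs.simps qword.simps)
qed simp

lemma separated_if_distinct:
  assumes "distinct (concat us)" "list_all2 (\<lambda>w u. set w = set u) ws us"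
  shows "separated ws"
  using assms(2,1)
proof (induction rule: list_all2_induct)
  case (Cons w ws u us)
  have "set (concat ws) = set (concat us)" using Cons.hyps(2) by (induction rule: list_all2_induct) auto
  thus ?case using Cons by auto
qed simp

lemma distinct_concat_mapD: "distinct (concat (map f xs)) \<Longrightarrow> x \<in> set xs \<Longrightarrow> distinct (f x)"
  by (induction xs) auto

lemma abab_free_qword:
  assumes "distinct (letters q)"
  shows "abab_free (qword q)"
  using assms
proof (induction q rule: qtree_peel_induct)
  case Nil
  then show ?case by (simp add: abab_free_def)
next
  case (Cons b ts bs)
  let ?us = "map letters ts @ [letters (QN bs)]"
  have d: "distinct (concat ?us)" "b \<notin> set (concat ?us)"
    using Cons.prems unfolding distinct_letters_Cons by simp_all
  have dt: "distinct (letters t) \<and> b \<notin> set (letters t)" if "t \<in> set ts" for t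
    using d that distinct_concat_mapD[of letters ts t] by (auto simp del: dfs.simps)
  have db: "distinct (letters (QN bs))" "b \<notin> set (letters (QN bs))" using d by auto
  have "separated (map qword ts @ [qword (QN bs)])"
    by (rule separated_if_distinct[OF d(1)]) (auto simp: list_all2_conv_all_nth nth_append set_qword
        simp del: dfs.simps qword.simps)
  moreover have "\<forall>w\<in>set (map qword ts @ [qword (QN bs)]). b \<notin> set w \<and> abab_free w"
    using Cons.IH dt db by (auto simp: set_qword simp del: dfs.simps qword.simps)
  ultimately show ?case unfolding qword_Cons by (intro abab_free_glue)
qed

text \<open>The first letter is the first edge label \<open>b\<close>, and \<open>qvalid\<close>
  fixes the number of pieces that end in \<open>b\<close>, so the word can be cut in one way
  only.\<close>

lemma qword_inject:
  assumes "qword q = qword q'" "qvalid m q" "qvalid m q'" "distinct (letters q)" "distinct (letters q')"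
  shows "q = q'"
  using assms
proof (induction q arbitrary: q' rule: qtree_peel_induct)
  case Nil
  obtain bs where "q' = QN bs" by (cases q')
  then show ?case using Nil by (cases bs) auto
next
  case (Cons b ts bs)
  obtain bs0 where q0: "q' = QN bs0" by (cases q')
  then obtain ts' bs' where q': "q' = QN ((b, ts') # bs')" using Cons.prems(1)
    by (cases bs0) (auto simp: qword_Cons simp del: qword.simps, simp)
  have len: "length ts = length ts'" using Cons.prems(2,3) q' by simp
  have nb: "\<forall>u\<in>set (map qword ts). b \<notin> set u" "\<forall>u\<in>set (map qword ts'). b \<notin> set u"
    using Cons.prems(4,5) unfolding q' distinct_letters_Cons by (auto simp: set_qword)
  have "map qword ts = map qword ts' \<and> qword (QN bs) = qword (QN bs')"
    using Cons.prems(1) len nb unfolding q' qword_Cons by (intro glue_inject) auto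
  hence eq: "map qword ts = map qword ts'" "qword (QN bs) = qword (QN bs')" by auto
  have dts: "distinct (concat (map letters ts))" "distinct (concat (map letters ts'))"
    using Cons.prems(4,5) unfolding q' distinct_letters_Cons by auto
  have "ts = ts'"
  proof (rule nth_equalityI[OF len])
    fix i assume i: "i < length ts"
    have "qword (ts ! i) = qword (ts' ! i)" using eq(1) i len by (metis nth_map)
    moreover have "qvalid m (ts ! i)" "qvalid m (ts' ! i)" using Cons.prems(2,3) i len q' by auto
    ultimately show "ts ! i = ts' ! i"
      using Cons.IH(1)[of "ts ! i" "ts' ! i"] distinct_concat_mapD[OF dts(1), of "ts ! i"]
        distinct_concat_mapD[OF dts(2), of "ts' ! i"] i len by simp
  qed
  moreover have "QN bs = QN bs'"
    using Cons.IH(2)[OF eq(2)] Cons.prems(2-5) unfolding q' distinct_letters_Cons by simp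
  ultimately show ?case using q' by simp
qed

lemma mon_glue: "mon (b # glue b ws @ v) = (\<Prod>w\<leftarrow>ws. mon (b # w @ [b])) * mon (b # v)"
proof (induction ws)
  case (Cons w ws)
  have "mon (b # glue b (w # ws) @ v) = mon ((b # w) @ b # glue b ws @ v)" by simp
  also have "\<dots> = mon ((b # w) @ [b]) * mon (b # glue b ws @ v)" by (rule mon_append)
  finally show ?case using Cons by (simp add: mult.assoc)
qed simp

text \<open>At the end of its block the word is back at \<open>c\<close>. The passages between
  blocks are therefore the steps of the word of edge labels, and each piece between two copies of
  \<open>c\<close> is a closed word of its own.\<close>

lemma mon_qword: "mon (b # qword q @ [b]) = qweight b q"
proof (induction q arbitrary: b rule: qtree_induct)
  case (QN bs)
  \<comment> \<open>The starting letter \<open>a\<close> is separated from the closing letter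
    \<open>b\<close>, because after one block the rest of the word starts from
    \<open>c\<close>.\<close>
  have "mon (a # qword (QN cs) @ [b]) = mon (a # map fst cs @ [b]) * (\<Prod>(c, ts)\<leftarrow>cs. \<Prod>t\<leftarrow>ts. qweight c t)"
    if "set cs \<subseteq> set bs" for a cs
    using that
  proof (induction cs arbitrary: a)
    case (Cons p cs)
    obtain c ts where p: "p = (c, ts)" by (cases p)
    have IH: "mon (c # qword t @ [c]) = qweight c t" if "t \<in> set ts" for t
      using QN.IH[of c ts t] that Cons.prems p by auto
    have "mon (a # qword (QN (p # cs)) @ [b]) = mon ([a] @ c # glue c (map qword ts) @ qword (QN cs) @ [b])"
      unfolding p qword_Cons by (simp del: qword.simps)
    also have "\<dots> = mon ([a] @ [c]) * mon (c # glue c (map qword ts) @ qword (QN cs) @ [b])"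
      by (rule mon_append)
    also have "mon (c # glue c (map qword ts) @ qword (QN cs) @ [b]) =
        (\<Prod>w\<leftarrow>map qword ts. mon (c # w @ [c])) * mon (c # qword (QN cs) @ [b])"
      by (rule mon_glue)
    also have "(\<Prod>w\<leftarrow>map qword ts. mon (c # w @ [c])) = (\<Prod>t\<leftarrow>ts. qweight c t)"
      unfolding map_map o_def using IH by (intro arg_cong[where f = prod_list] map_cong) auto
    also have "mon (c # qword (QN cs) @ [b]) =
        mon (c # map fst cs @ [b]) * (\<Prod>(c, ts)\<leftarrow>cs. \<Prod>t\<leftarrow>ts. qweight c t)"
      using Cons.prems by (intro Cons.IH) auto
    finally show ?case using mon_append[of "[a]" c "map fst cs @ [b]"] p by (simp add: mult_ac)
  qed simp
  from this[of bs b] show ?case by simp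
qed

lemma set_concat_map_cong:
  assumes "\<And>u. u \<in> set us \<Longrightarrow> set (f u) = set u"
  shows "set (concat (map f us)) = set (concat us)"
  using assms by auto

context multiplicities
begin

text \<open>That every occurring letter occurs \<open>m x\<close> times is inherited by the pieces:
  a letter other than \<open>b\<close> lies in one piece with all its copies. Asking for all letters
  of {1..n} would not be inherited.\<close>

lemma qword_exists:
  assumes "abab_free w" "\<forall>x\<in>set w. x \<in> {1..n} \<and> count (mset w) x = m x"
  shows "\<exists>q. qvalid m q \<and> distinct (letters q) \<and> qword q = w"
  using assms
proof (induction w rule: length_induct)
  case (1 w)
  show ?case
  proof (cases w)
    case Nil
    then show ?thesis by (intro exI[of _ "QN []"]) simp
  next
    case (Cons b w')
    obtain ws v where w': "w' = glue b ws @ v" and nb: "\<forall>u\<in>set (ws @ [v]). b \<notin> set u"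
      using glue_exists by blast
    have "\<not> subseq [y, b, y] (glue b ws @ v)" if "y \<noteq> b" for y
    proof
      assume "subseq [y, b, y] (glue b ws @ v)"
      hence "subseq [b, y, b, y] w" unfolding Cons w' by simp
      thus False using abab_freeD[OF 1(2) that[symmetric]] by contradiction
    qed
    hence sep: "separated (ws @ [v])" using nb by (rule separated_glue)
    have cnt: "count (mset w) x = (\<Sum>u\<leftarrow>ws @ [v]. count (mset u) x)" if "x \<noteq> b" for x
    proof -
      have "count (mset (glue b ws)) x = (\<Sum>u\<leftarrow>ws. count (mset u) x)" using that by (induction ws) auto
      thus ?thesis using that unfolding Cons w' by simp
    qed
    \<comment> \<open>The copies of \<open>b\<close> are the leading one and one behind each piece
      of \<open>ws\<close>. So \<open>ws\<close> provides the \<open>m b - 1\<close> subtrees, while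
      \<open>v\<close> holds the later blocks of the root.\<close>
    have cb: "count (mset w) b = Suc (length ws)"
    proof -
      have "count (mset (glue b us)) b = length us" if "\<forall>u\<in>set us. b \<notin> set u" for us
        using that
      proof (induction us)
        case (Cons u us)
        have "count (mset u) b = 0" using Cons.prems by (simp add: count_eq_zero_iff)
        thus ?case using Cons by simp
      qed simp
      moreover have "count (mset v) b = 0" using nb by (simp add: count_eq_zero_iff)
      ultimately show ?thesis using nb unfolding Cons w' by simp
    qed
    have piece: "\<exists>q. qvalid m q \<and> distinct (letters q) \<and> qword q = u" if u: "u \<in> set (ws @ [v])" for u
    proof -
      have sub: "subseq u w"
      proof -
        have "subseq u (glue b us @ v)" if "u \<in> set (us @ [v])" for us
          using that by (induction us) (auto intro: list_emb_append2 list_emb_append_mono)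
        thus ?thesis using u unfolding Cons w' by auto
      qed
      have "length u < length w"
      proof -
        have "length u \<le> length (glue b us @ v)" if "u \<in> set (us @ [v])" for us
          using that by (induction us) auto
        from this[OF u] show ?thesis unfolding Cons w' by simp
      qed
      moreover have "abab_free u" using 1(2) sub by (rule abab_free_subseq)
      moreover have "x \<in> {1..n} \<and> count (mset u) x = m x" if x: "x \<in> set u" for x
      proof -
        have "x \<noteq> b" using nb u x by auto
        have "(\<Sum>u\<leftarrow>us. count (mset u) x) = count (mset u) x" if "u \<in> set us" "separated us" for us
          using that
        proof (induction us)
          case (Cons u' us)
          have z: "(\<Sum>u\<leftarrow>us. count (mset u) x) = 0" if "x \<notin> set (concat us)"
            using that by (induction us) (auto simp: count_mset_0_iff)
          show ?case
          proof (cases "x \<in> set u'")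
            case True
            hence "x \<notin> set (concat us)" using Cons.prems by auto
            moreover from this have "u \<notin> set us" using x by auto
            ultimately show ?thesis using z Cons.prems by auto
          next
            case False
            hence "u \<noteq> u'" using x by auto
            thus ?thesis using Cons False by (simp add: count_mset_0_iff)
          qed
        qed simp
        from this[OF u sep] have "count (mset w) x = count (mset u) x" using cnt[OF \<open>x \<noteq> b\<close>] by simp
        moreover have "x \<in> set w" using x sub subseq_set by blast
        ultimately show ?thesis using 1(3) by auto
      qed
      ultimately show ?thesis using 1(1) by blast
    qed
    then obtain Q where Q: "\<And>u. u \<in> set (ws @ [v]) \<Longrightarrow> qvalid m (Q u) \<and> distinct (letters (Q u)) \<and> qword (Q u) = u"
      by metis
    have LQ: "set (letters (Q u)) = set u" if "u \<in> set (ws @ [v])" for u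
      using set_qword[of "Q u"] Q[OF that] by argo
    obtain bs where bs: "Q v = QN bs" by (cases "Q v")
    let ?q = "QN ((b, map Q ws) # bs)"
    have "map qword (map Q ws) = ws" unfolding map_map by (rule map_idI) (use Q in simp)
    hence "qword ?q = w" unfolding qword_Cons bs[symmetric] Cons w' using Q[of v] by simp
    moreover have "qvalid m ?q"
    proof -
      have "m b = Suc (length ws)" using 1(3) cb Cons by simp
      thus ?thesis using Q[of v] Q bs by auto
    qed
    moreover have "distinct (letters ?q)"
    proof -
      have "distinct (concat (map (\<lambda>u. letters (Q u)) us))"
        if "separated us" "set us \<subseteq> set (ws @ [v])" for us
        using that
      proof (induction us)
        case (Cons u us)
        have "set (letters (Q u)) = set u" by (rule LQ) (use Cons.prems(2) in auto)
        moreover have "set (concat (map (\<lambda>u. letters (Q u)) us)) = set (concat us)"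
          by (rule set_concat_map_cong, rule LQ) (use Cons.prems(2) in auto)
        moreover have "distinct (letters (Q u))" using Q[of u] Cons.prems(2) by auto
        ultimately show ?case using Cons by simp
      qed simp
      from this[OF sep] have "distinct (concat (map letters (map Q ws)) @ letters (QN bs))"
        by (simp add: o_def bs del: dfs.simps)
      moreover have "b \<notin> set (concat (map letters (map Q ws)) @ letters (QN bs))"
      proof
        assume "b \<in> set (concat (map letters (map Q ws)) @ letters (QN bs))"
        then obtain u where "u \<in> set (ws @ [v])" "b \<in> set (letters (Q u))"
          unfolding bs[symmetric] by (auto simp del: dfs.simps)
        thus False using LQ nb by blast
      qed
      ultimately show ?thesis unfolding distinct_letters_Cons by simp
    qed
    ultimately show ?thesis by blast
  qed
qed

lemma bij_betw_qword: "bij_betw qword (qtrees n m) (quasi_stirling n m)"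
  unfolding bij_betw_def
proof (intro conjI equalityI subsetI)
  show "inj_on qword (qtrees n m)"
    by (rule inj_onI) (auto simp: qtrees_def intro: qword_inject)
next
  fix w assume "w \<in> qword ` qtrees n m"
  then obtain q where q: "q \<in> qtrees n m" "w = qword q" by blast
  have L: "qvalid m q" "distinct (letters q)" "set (letters q) = {1..n}" using q by (auto simp: qtrees_def)
  hence "mset w = (\<Sum>b\<in>#mset (letters q). replicate_mset (m b) b)"
    unfolding q using m_pos by (intro mset_qword) auto
  also have "mset (letters q) = mset_set {1..n}" using L by (metis mset_set_set)
  finally have "mset w = (\<Sum>i=1..n. replicate_mset (m i) i)" by (simp add: sum_unfold_sum_mset)
  thus "w \<in> quasi_stirling n m" using abab_free_qword[OF L(2)] q(2)
    by (simp add: quasi_stirling_def abab_free_def permutations_of_multisetI)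
next
  fix w assume w: "w \<in> quasi_stirling n m"
  hence w': "mset w = (\<Sum>i=1..n. replicate_mset (m i) i)" "abab_free w"
    by (auto simp: quasi_stirling_def abab_free_def dest: permutations_of_multisetD)
  have cnt: "count (mset w) x = (if x \<in> {1..n} then m x else 0)" for x
    unfolding w' count_sum count_replicate_mset by simp
  have sw: "set w = {1..n}"
  proof (rule set_eqI)
    fix x
    have "x \<in> set w \<longleftrightarrow> 0 < count (mset w) x" by simp
    thus "x \<in> set w \<longleftrightarrow> x \<in> {1..n}" unfolding cnt using m_pos[of x] by (cases "x \<in> {1..n}") auto
  qed
  obtain q where q: "qvalid m q" "distinct (letters q)" "qword q = w"
    using qword_exists[OF w'(2)] cnt sw by auto
  hence "q \<in> qtrees n m" using sw set_qword[of q] by (simp add: qtrees_def)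
  thus "w \<in> qword ` qtrees n m" using q(3) by blast
qed

end

section \<open>Weights of trees\<close>

lemma cnt_remdups_adj_append:
  assumes "\<And>a. \<not> R a a"
  shows "cnt R (a # remdups_adj xs @ ys) = cnt R (a # xs @ ys)"
proof (induction xs arbitrary: a rule: remdups_adj.induct)
  case (3 x y xs)
  show ?case
  proof (cases "x = y")
    case True
    then show ?thesis using 3(1)[of a] assms by simp
  next
    case False
    then show ?thesis using 3(2)[of x] by simp
  qed
qed simp_all

definition tree_weight :: "vetree \<Rightarrow> pol3" where
  "tree_weight T = ind_x ^ cdes_tree T * ind_y ^ casc_tree T * ind_z ^ leaf_star T"

text \<open>A leaf \<open>Sym i\<close> gets weight 1: its closed word b b would contribute a
  plateau, but \<open>leaf_star\<close> does not count it.\<close>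

definition node_weight :: "nat \<Rightarrow> vetree \<Rightarrow> pol3" where
  "node_weight b t = (if is_Num t then mon (b # word t @ [b]) else 1)"

definition rooted_weight :: "nat \<Rightarrow> vetree \<Rightarrow> pol3" where
  "rooted_weight b T = (\<Prod>(b, t)\<in>#mset ((b, T) # nonroot T). node_weight b t)"

lemma rooted_weight_Node:
  "rooted_weight b (Node v cs) = node_weight b (Node v cs) * (\<Prod>(e, t)\<leftarrow>cs. rooted_weight e t)"
proof -
  have "(\<Prod>(b, t)\<in>#mset cs + (\<Sum>(e, t)\<leftarrow>cs. mset (nonroot t)). node_weight b t) =
      (\<Prod>(e, t)\<leftarrow>cs. rooted_weight e t)"
    by (induction cs) (auto simp: rooted_weight_def mult_ac)
  thus ?thesis by (simp add: rooted_weight_def nonroot_Node)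
qed

lemma sum_list_cdes_mon:
  fixes N :: "(nat \<times> vetree) list"
  assumes "\<And>b t. (b, t) \<in> set N \<Longrightarrow> ind_x ^ f b t * ind_y ^ g b t * ind_z ^ h b t = node_weight b t"
  shows "ind_x ^ (\<Sum>(b, t)\<leftarrow>N. f b t) * ind_y ^ (\<Sum>(b, t)\<leftarrow>N. g b t) * ind_z ^ (\<Sum>(b, t)\<leftarrow>N. h b t) =
    (\<Prod>(b, t)\<leftarrow>N. node_weight b t)"
  using assms
proof (induction N)
  case (Cons p N)
  obtain b t where p: "p = (b, t)" by (cases p)
  have "node_weight b t = ind_x ^ f b t * ind_y ^ g b t * ind_z ^ h b t" using Cons.prems p by simp
  moreover have "(\<Prod>(b, t)\<leftarrow>N. node_weight b t) =
      ind_x ^ (\<Sum>(b, t)\<leftarrow>N. f b t) * ind_y ^ (\<Sum>(b, t)\<leftarrow>N. g b t) * ind_z ^ (\<Sum>(b, t)\<leftarrow>N. h b t)"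
    using Cons by simp
  ultimately show ?case using p by (simp add: power_add mult_ac)
qed simp

lemma size_child: "(e, t) \<in> set cs \<Longrightarrow> size t < size (Node v cs)"
proof -
  assume "(e, t) \<in> set cs"
  hence "size_prod (\<lambda>_. 0) size (e, t) \<le> size_list (size_prod (\<lambda>_. 0) size) cs"
    by (induction cs) auto
  thus ?thesis by simp
qed

context multiplicities
begin

lemma rooted_weight_mk: "qproper q \<Longrightarrow> rooted_weight b (mk m r (Num a) q) = qweight b q"
proof (induction q arbitrary: a b rule: qtree_induct)
  case (QN bs)
  have "word (mk m r (Num a) (QN bs)) = map fst bs" using mk_facts[OF QN.prems] by simp
  hence nw: "node_weight b (mk m r (Num a) (QN bs)) = mon (b # map fst bs @ [b])"
    by (simp add: node_weight_def is_Num_def)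
  have blk: "(\<Prod>(e, t)\<leftarrow>mk_block r (c, ts). rooted_weight e t) = (\<Prod>t\<leftarrow>ts. qweight c t)"
    if c: "(c, ts) \<in> set bs" for c ts
  proof (cases "ts = []")
    case True
    then show ?thesis by (simp add: rooted_weight_Node node_weight_def is_Num_def)
  next
    case False
    have qp: "qproper t" if "t \<in> set ts" for t using QN.prems c that unfolding qproper_QN by blast
    have len: "length (fibre m r c) = length ts" using QN.prems c unfolding qproper_QN by auto
    have "(\<Prod>(e, t)\<leftarrow>mk_block r (c, ts). rooted_weight e t) =
        prod_list (map (\<lambda>(a, t). rooted_weight c (mk m r (Num a) t)) (zip (fibre m r c) ts))"
      using False by (simp add: o_def case_prod_unfold)
    also have "\<dots> = prod_list (map (\<lambda>(a, t). qweight c t) (zip (fibre m r c) ts))"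
      using QN.IH[OF c] qp
      by (intro arg_cong[where f = prod_list] map_cong refl) (auto dest: set_zip_rightD)
    also have "map (\<lambda>(a, t). qweight c t) (zip (fibre m r c) ts) = map (qweight c) (map snd (zip (fibre m r c) ts))"
      by (simp add: case_prod_unfold)
    also have "map snd (zip (fibre m r c) ts) = ts" using len by (rule map_snd_zip)
    finally show ?thesis .
  qed
  have cat: "(\<Prod>(e, t)\<leftarrow>concat (map f ps). rooted_weight e t) =
      (\<Prod>p\<leftarrow>ps. \<Prod>(e, t)\<leftarrow>f p. rooted_weight e t)" for f and ps :: "(nat \<times> qtree list) list"
    by (induction ps) auto
  have "rooted_weight b (mk m r (Num a) (QN bs)) =
      mon (b # map fst bs @ [b]) * (\<Prod>(e, t)\<leftarrow>concat (map (mk_block r) bs). rooted_weight e t)"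
    unfolding nw[symmetric] by (simp add: rooted_weight_Node)
  also have "(\<Prod>(e, t)\<leftarrow>concat (map (mk_block r) bs). rooted_weight e t) =
      (\<Prod>(c, ts)\<leftarrow>bs. \<Prod>t\<leftarrow>ts. qweight c t)"
    unfolding cat using blk by (intro arg_cong[where f = prod_list] map_cong refl) auto
  finally show ?case by simp
qed

text \<open>A letter occurs in the word of one vertex only, and the parent's word already contains
  \<open>b\<close>; above the root stands 0, which is not a letter. Hence the word closed by
  \<open>b\<close> has a plateau only at a leaf.\<close>

lemma tree_weight_rooted:
  assumes T: "T \<in> rooted_trees n m r" and r: "r \<le> K"
  shows "tree_weight T = rooted_weight 0 T"
    and "\<And>b t. (b, t) \<in> set ((0, T) # nonroot T) \<Longrightarrow> b \<notin> set (word t)"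
proof -
  let ?N = "(0, T) # nonroot T"
  show nb: "b \<notin> set (word t)" if "(b, t) \<in> set ?N" for b t
  proof
    assume bt: "b \<in> set (word t)"
    have t: "t \<in> set (vertices T)" using that by (force simp: set_vertices)
    show False
    proof (cases "(b, t) = (0, T)")
      case True
      have "0 \<in> {1..n}" using rooted_word_range[OF T r t] bt True by blast
      thus False by simp
    next
      case False
      hence "(b, t) \<in> set (nonroot T)" using that by auto
      then obtain u where u: "u \<in> set (vertices T)" "(b, t) \<in> set (children u)"
        by (auto simp: in_nonroot_iff)
      hence "b \<in> set (word u)" by (force simp: set_word)
      hence "u = t" using distinct_concat_map_eq[OF rooted_distinct[OF T r] u(1) t] bt by blast
      thus False using u(2) size_child[of b t "children u" "vlab u"] by (cases u) auto
    qed
  qed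
  let ?h = "\<lambda>t. if children t = [] \<and> is_Num t then 1 else 0 :: nat"
  have "cdes_tree T = (\<Sum>(b, t)\<leftarrow>?N. cdes (b # map fst (children t)))"
    by (simp add: cdes_tree_def cdes_Cons des_conv_cnt)
  moreover have "casc_tree T = (\<Sum>(b, t)\<leftarrow>?N. casc (b # map fst (children t)))"
    by (simp add: casc_tree_def casc_Cons asc_conv_cnt)
  moreover have "leaf_star T = (\<Sum>(b, t)\<leftarrow>?N. ?h t)"
  proof -
    have "length (filter (\<lambda>t. children t = [] \<and> is_Num t) us) = (\<Sum>t\<leftarrow>us. ?h t)" for us
      by (induction us) auto
    hence "leaf_star T = (\<Sum>t\<leftarrow>vertices T. ?h t)"
      unfolding leaf_star_def is_Num_def[symmetric] .
    also have "\<dots> = (\<Sum>t\<in>#mset (vertices T). ?h t)" by (simp only: mset_map[symmetric] sum_mset_sum_list)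
    also have "\<dots> = (\<Sum>(b, t)\<in>#mset ?N. ?h t)"
      unfolding mset_vertices by (simp add: image_mset.compositionality o_def case_prod_unfold)
    also have "\<dots> = (\<Sum>(b, t)\<leftarrow>?N. ?h t)" by (simp only: mset_map[symmetric] sum_mset_sum_list)
    finally show ?thesis .
  qed
  ultimately have "tree_weight T = ind_x ^ (\<Sum>(b, t)\<leftarrow>?N. cdes (b # map fst (children t))) *
      ind_y ^ (\<Sum>(b, t)\<leftarrow>?N. casc (b # map fst (children t))) * ind_z ^ (\<Sum>(b, t)\<leftarrow>?N. ?h t)"
    unfolding tree_weight_def by simp
  also have "\<dots> = (\<Prod>(b, t)\<leftarrow>?N. node_weight b t)"
  proof (rule sum_list_cdes_mon)
    fix b t assume bt: "(b, t) \<in> set ?N"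
    hence t: "t \<in> set (vertices T)" by (force simp: set_vertices)
    have dw: "distinct (word t)" by (rule rooted_distinct_word[OF T r t])
    have "word t = [] \<longleftrightarrow> children t = []" by (simp add: word_def)
    hence z: "cnt (=) (b # word t @ [b]) = (if children t = [] then 1 else 0)"
      using cnt_eq_closed[OF dw nb[OF bt]] by simp
    have c: "cdes (b # map fst (children t)) = cnt (>) (b # word t @ [b])"
      "casc (b # map fst (children t)) = cnt (<) (b # word t @ [b])"
      unfolding cdes_Cons casc_Cons word_def by (simp_all add: cnt_remdups_adj_append)
    have leaf: "children t = []" if "\<not> is_Num t"
      using that rooted_local_ok[OF T r t] by (cases "vlab t") (auto simp: is_Num_def local_ok_def)
    show "ind_x ^ cdes (b # map fst (children t)) * ind_y ^ casc (b # map fst (children t)) *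
        ind_z ^ ?h t = node_weight b t"
    proof (cases "is_Num t")
      case True
      then show ?thesis unfolding c by (simp add: node_weight_def mon_def z)
    next
      case False
      moreover from this leaf have "children t = []" "word t = []" by (auto simp: word_def)
      ultimately show ?thesis unfolding c by (simp add: node_weight_def)
    qed
  qed
  also have "\<dots> = rooted_weight 0 T"
    unfolding rooted_weight_def by (simp only: mset_map[symmetric] prod_mset_prod_list)
  finally show "tree_weight T = rooted_weight 0 T" .
qed

lemma tree_weight_mk:
  assumes "q \<in> qtrees n m" "r \<le> K"
  shows "tree_weight (mk m r (Num r) q) = mon (0 # qword q @ [0])"
  using tree_weight_rooted(1)[OF mk_rooted[OF assms(1)] assms(2)]
    rooted_weight_mk[OF qtrees_qproper[OF assms(1)]] mon_qword by simp

section \<open>The words of a tree indexed by vertex labels\<close>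

definition vertex :: "vetree \<Rightarrow> nat \<Rightarrow> vetree" where
  "vertex T a = (THE u. u \<in> set (vertices T) \<and> vlab u = Num a)"

text \<open>The same words as in \<open>dfs\<close>, but at positions that survive a reordering of
  children.\<close>

definition word_list :: "vetree \<Rightarrow> nat list list" where
  "word_list T = map (\<lambda>a. word (vertex T a)) [0..<Suc K]"

text \<open>Computed from \<open>r\<close> and \<open>a\<close> alone, so that it is constant on a
  class of trees.\<close>

definition parent_label :: "nat \<Rightarrow> nat \<Rightarrow> nat" where
  "parent_label r a = (if a = r then 0 else THE b. b \<in> {1..n} \<and> a \<in> set (fibre m r b))"

context
  fixes T :: vetree and r :: nat
  assumes T: "T \<in> rooted_trees n m r" and r_le: "r \<le> K"
begin

lemma vertex_eq: "u \<in> set (vertices T) \<Longrightarrow> vlab u = Num a \<Longrightarrow> vertex T a = u"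
  unfolding vertex_def using rooted_distinct_labels[OF T r_le]
  by (intro the_equality) (auto simp: distinct_map inj_on_def)

lemma vertex_exists:
  assumes "a \<le> K"
  shows "vertex T a \<in> set (vertices T)" "vlab (vertex T a) = Num a"
proof -
  have "Num a \<in> set (map vlab (vertices T))" using assms unfolding rooted_label_set[OF T r_le] by simp
  then obtain u where "u \<in> set (vertices T)" "vlab u = Num a" by auto
  thus "vertex T a \<in> set (vertices T)" "vlab (vertex T a) = Num a" using vertex_eq by auto
qed

lemma mset_Num_vertices: "mset (filter is_Num (vertices T)) = mset (map (vertex T) [0..<Suc K])"
proof -
  have d: "distinct (filter is_Num (vertices T))"
    using rooted_distinct_labels[OF T r_le] by (simp add: distinct_map)
  have "inj_on (vertex T) {..K}"
    using vertex_exists(2) by (intro inj_onI) (metis atMost_iff vlabel.inject(1))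
  hence d': "distinct (map (vertex T) [0..<Suc K])"
    by (simp only: distinct_map distinct_upt set_upt atLeast0LessThan lessThan_Suc_atMost)
  have "set (filter is_Num (vertices T)) = vertex T ` {..K}"
  proof (intro equalityI subsetI)
    fix u assume "u \<in> set (filter is_Num (vertices T))"
    then obtain a where a: "u \<in> set (vertices T)" "vlab u = Num a" by (auto simp: is_Num_def)
    hence "Num a \<in> set (map vlab (vertices T))" by force
    hence "a \<le> K" unfolding rooted_label_set[OF T r_le] by auto
    thus "u \<in> vertex T ` {..K}" using vertex_eq[OF a] by force
  next
    fix u assume "u \<in> vertex T ` {..K}"
    thus "u \<in> set (filter is_Num (vertices T))" using vertex_exists by (auto simp: is_Num_def)
  qed
  hence "set (filter is_Num (vertices T)) = set (map (vertex T) [0..<Suc K])"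
    by (simp only: set_map set_upt atLeast0LessThan lessThan_Suc_atMost)
  thus ?thesis using set_eq_iff_mset_eq_distinct[OF d d'] by blast
qed

lemma mset_word_list: "mset (word_list T) = mset (map word (filter is_Num (vertices T)))"
  unfolding word_list_def mset_map mset_Num_vertices by (simp add: image_mset.compositionality o_def)

lemma parent_label_eq:
  assumes "(b, t) \<in> set ((0, T) # nonroot T)" "vlab t = Num a"
  shows "parent_label r a = b"
proof (cases "(b, t) = (0, T)")
  case True
  then show ?thesis using rooted_root[OF T r_le] assms(2) by (simp add: parent_label_def)
next
  case False
  hence nr: "(b, t) \<in> set (nonroot T)" using assms(1) by auto
  hence b: "b \<in> {1..n}" "Num a \<in> set (labels m r b)"
    using rooted_nonroot_iff[OF T r_le, of b "Num a"] assms(2) by blast+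
  have "Num r \<notin> set (map (\<lambda>(e, t). vlab t) (nonroot T))"
    using rooted_distinct_labels[OF T r_le] mset_vertex_labels[of T] rooted_root[OF T r_le]
    by (metis distinct.simps(2) mset.simps(2) mset_eq_imp_distinct_iff)
  hence "a \<noteq> r" using nr assms(2) by force
  moreover have "(THE b. b \<in> {1..n} \<and> a \<in> set (fibre m r b)) = b"
  proof (rule the_equality)
    show "b \<in> {1..n} \<and> a \<in> set (fibre m r b)" using b m_pos Num_in_labels_iff by auto
  next
    fix c assume c: "c \<in> {1..n} \<and> a \<in> set (fibre m r c)"
    hence "Num a \<in> set (labels m r c)" using m_pos Num_in_labels_iff by auto
    thus "c = b" using labels_disjoint[of b c m r] b c by auto
  qed
  ultimately show ?thesis by (simp add: parent_label_def)
qed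

lemma parent_label_notin:
  assumes "a \<le> K"
  shows "parent_label r a \<notin> set (word (vertex T a))"
proof -
  have "vertex T a \<in> snd ` set ((0, T) # nonroot T)" using vertex_exists(1)[OF assms] by (auto simp: set_vertices)
  then obtain b where b: "(b, vertex T a) \<in> set ((0, T) # nonroot T)" by (metis imageE prod.collapse)
  thus ?thesis using parent_label_eq[OF b vertex_exists(2)[OF assms]] tree_weight_rooted(2)[OF T r_le b] by simp
qed

text \<open>The tree enters only through its words, while the closing letters are common to its
  class. The class sum thus becomes a sum over independent rearrangements.\<close>

lemma tree_weight_word_list:
  "tree_weight T = (\<Prod>(b, w)\<leftarrow>zip (map (parent_label r) [0..<Suc K]) (word_list T). mon (b # w @ [b]))"
proof -
  define g where "g u = (if is_Num u then mon (parent_label r (THE a. vlab u = Num a) # word u @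
    [parent_label r (THE a. vlab u = Num a)]) else 1)" for u
  have "tree_weight T = (\<Prod>(b, t)\<in>#mset ((0, T) # nonroot T). node_weight b t)"
    using tree_weight_rooted(1)[OF T r_le] by (simp add: rooted_weight_def)
  also have "\<dots> = (\<Prod>(b, t)\<in>#mset ((0, T) # nonroot T). g t)"
  proof (intro arg_cong[where f = prod_mset] image_mset_cong, clarify)
    fix b t assume "(b, t) \<in># mset ((0, T) # nonroot T)"
    thus "node_weight b t = g t" using parent_label_eq[of b t]
      by (auto simp: node_weight_def g_def is_Num_def)
  qed
  also have "\<dots> = (\<Prod>u\<in>#mset (vertices T). g u)"
    unfolding mset_vertices by (simp add: image_mset.compositionality o_def case_prod_unfold)
  also have "\<dots> = (\<Prod>u\<in>#mset (filter is_Num (vertices T)). g u)"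
  proof -
    have "(\<Prod>u\<leftarrow>us. g u) = (\<Prod>u\<leftarrow>filter is_Num us. g u)" for us
      by (induction us) (auto simp: g_def)
    from this[of "vertices T"] show ?thesis by (simp only: mset_map[symmetric] prod_mset_prod_list)
  qed
  also have "\<dots> = (\<Prod>a\<leftarrow>[0..<Suc K]. g (vertex T a))"
    unfolding mset_Num_vertices prod_mset_prod_list[symmetric] by (simp add: image_mset.compositionality o_def)
  also have "\<dots> = (\<Prod>a\<leftarrow>[0..<Suc K]. mon (parent_label r a # word (vertex T a) @ [parent_label r a]))"
  proof (intro arg_cong[where f = prod_list] map_cong refl)
    fix a assume "a \<in> set [0..<Suc K]"
    hence "vlab (vertex T a) = Num a" by (intro vertex_exists) (auto simp: less_Suc_eq_le)
    thus "g (vertex T a) = mon (parent_label r a # word (vertex T a) @ [parent_label r a])"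
      by (simp add: g_def is_Num_def)
  qed
  also have "\<dots> = (\<Prod>(b, w)\<leftarrow>zip (map (parent_label r) [0..<Suc K]) (word_list T). mon (b # w @ [b]))"
    unfolding word_list_def zip_map1 zip_map2 zip_same_conv_map map_map by (simp add: o_def)
  finally show ?thesis .
qed

end

end

section \<open>Equivalence classes\<close>

definition rearrangements :: "nat list list \<Rightarrow> nat list list set" where
  "rearrangements us = {ws. list_all2 (\<lambda>u w. mset w = mset u) us ws}"

lemma rearrangements_Nil: "rearrangements [] = {[]}"
  by (simp add: rearrangements_def)

lemma rearrangements_Cons:
  assumes "distinct u"
  shows "rearrangements (u # us) = (\<lambda>(w, ws). w # ws) ` (permutations_of_set (set u) \<times> rearrangements us)"
proof -
  have "mset w = mset u \<longleftrightarrow> w \<in> permutations_of_set (set u)" for w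
    using assms by (metis permutations_of_setD permutations_of_setI mset_eq_imp_distinct_iff mset_eq_setD set_eq_iff_mset_eq_distinct)
  thus ?thesis by (force simp: rearrangements_def list_all2_Cons1)
qed

lemma inj_case_prod_Cons: "inj_on (\<lambda>(w, ws). w # ws) A"
  by (auto simp: inj_on_def)

lemma card_rearrangements:
  "\<forall>u\<in>set us. distinct u \<Longrightarrow> card (rearrangements us) = (\<Prod>u\<leftarrow>us. fact (length u))"
  by (induction us) (auto simp: rearrangements_Nil rearrangements_Cons card_image[OF inj_case_prod_Cons]
      card_cartesian_product distinct_card)

text \<open>The closing letters may differ from word to word; \<open>sum_mon_closed\<close> removes
  them factor by factor. All of them 0 gives the case of partitions, parent labels give the case of
  trees.\<close>

lemma sum_rearrangements:
  assumes "\<forall>u\<in>set us. distinct u" "list_all2 (\<lambda>b u. b \<notin> set u) bs us"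
  shows "(\<Sum>ws\<in>rearrangements us. \<Prod>(b, w)\<leftarrow>zip bs ws. mon (b # w @ [b])) = (\<Prod>u\<leftarrow>us. block_poly (length u))"
  using assms(2,1)
proof (induction rule: list_all2_induct)
  case Nil
  then show ?case by (simp add: rearrangements_Nil)
next
  case (Cons b bs u us)
  have "distinct u" using Cons.prems by simp
  hence "(\<Sum>ws\<in>rearrangements (u # us). \<Prod>(b, w)\<leftarrow>zip (b # bs) ws. mon (b # w @ [b])) =
      (\<Sum>(w, ws)\<in>permutations_of_set (set u) \<times> rearrangements us.
        mon (b # w @ [b]) * (\<Prod>(b, w)\<leftarrow>zip bs ws. mon (b # w @ [b])))"
    unfolding rearrangements_Cons[OF \<open>distinct u\<close>] sum.reindex[OF inj_case_prod_Cons]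
    by (simp add: case_prod_unfold)
  also have "\<dots> = (\<Sum>w\<in>permutations_of_set (set u). mon (b # w @ [b])) *
      (\<Sum>ws\<in>rearrangements us. \<Prod>(b, w)\<leftarrow>zip bs ws. mon (b # w @ [b]))"
    by (simp add: sum_product sum.cartesian_product)
  also have "(\<Sum>w\<in>permutations_of_set (set u). mon (b # w @ [b])) = block_poly (length u)"
    using Cons sum_mon_closed[of "set u" b] by (simp add: distinct_card)
  finally show ?case using Cons by simp
qed

text \<open>The value \<open>f b\<close> occurs in the class sums of exactly the
  \<open>card (C b)\<close> members of its class, each time with weight 1 /
  \<open>card (C b)\<close>.\<close>

lemma sum_class_averages:
  fixes f :: "'a \<Rightarrow> pol3"
  assumes fin: "finite A" and C: "\<And>a. a \<in> A \<Longrightarrow> a \<in> C a" "\<And>a. a \<in> A \<Longrightarrow> C a \<subseteq> A"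
    "\<And>a b. a \<in> A \<Longrightarrow> b \<in> C a \<Longrightarrow> C b = C a"
  shows "sum f A = (\<Sum>a\<in>A. const3 (1 / of_nat (card (C a))) * sum f (C a))"
proof -
  let ?c = "\<lambda>a. const3 (1 / of_nat (card (C a)))"
  have sym: "b \<in> C a \<longleftrightarrow> a \<in> C b" if "a \<in> A" "b \<in> A" for a b
    using C that by metis
  have "(\<Sum>a\<in>A. ?c a * sum f (C a)) = (\<Sum>a\<in>A. \<Sum>b\<in>{b \<in> A. b \<in> C a}. ?c b * f b)"
  proof (intro sum.cong refl)
    fix a assume a: "a \<in> A"
    have "{b \<in> A. b \<in> C a} = C a" using C(2)[OF a] by blast
    moreover have "?c b = ?c a" if "b \<in> C a" for b using C(3)[OF a that] by simp
    ultimately show "?c a * sum f (C a) = (\<Sum>b\<in>{b \<in> A. b \<in> C a}. ?c b * f b)"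
      by (simp add: sum_distrib_left)
  qed
  also have "\<dots> = (\<Sum>b\<in>A. \<Sum>a\<in>{a \<in> A. b \<in> C a}. ?c b * f b)"
    using fin by (rule sum.swap_restrict) fact
  also have "\<dots> = (\<Sum>b\<in>A. f b)"
  proof (intro sum.cong refl)
    fix b assume b: "b \<in> A"
    have eq: "{a \<in> A. b \<in> C a} = C b" using C(2)[OF b] sym b by blast
    have "finite (C b)" using C(2)[OF b] fin by (rule finite_subset)
    hence "card (C b) \<noteq> 0" using C(1)[OF b] by auto
    hence "of_nat (card (C b)) * ?c b = const3 1"
      unfolding const3_of_nat[symmetric] const3_mult by simp
    also have "\<dots> = 1" using const3_of_nat[of 1] by simp
    finally show "(\<Sum>a\<in>{a \<in> A. b \<in> C a}. ?c b * f b) = f b" unfolding eq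
      by (simp add: mult.assoc[symmetric])
  qed
  finally show ?thesis by simp
qed

text \<open>
  Only meaningful if \<open>\<omega> a\<close> lists the child edge labels of \<open>Num a\<close> once each and the vertices \<open>Sym i\<close> are
  leaves; otherwise subtrees are lost or duplicated.
\<close>

function reorder :: "(nat \<Rightarrow> nat list) \<Rightarrow> vetree \<Rightarrow> vetree" where
  "reorder \<omega> (Node v cs) = Node v (concat (map (\<lambda>b. filter (\<lambda>c. fst c = b)
     (map (\<lambda>(e, t). (e, reorder \<omega> t)) cs)) (case v of Num a \<Rightarrow> \<omega> a | Sym i \<Rightarrow> [])))"
  by pat_completeness auto
termination by (relation "measure (\<lambda>(\<omega>, T). size T)") (auto dest: size_child)

lemma vlab_reorder [simp]: "vlab (reorder \<omega> T) = vlab T"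
  by (cases T) simp

lemma mset_concat_filter:
  assumes "distinct bs" "fst ` set cs \<subseteq> set bs"
  shows "mset (concat (map (\<lambda>b. filter (\<lambda>c. fst c = b) cs) bs)) = mset cs"
proof (rule multiset_eqI)
  fix x
  have "count (mset (concat (map (\<lambda>b. filter (\<lambda>c. fst c = b) cs) bs))) x =
      (\<Sum>b\<leftarrow>bs. if fst x = b then count (mset cs) x else 0)"
    by (induction bs) auto
  also have "\<dots> = (\<Sum>b\<in>set bs. if fst x = b then count (mset cs) x else 0)"
    using assms(1) by (rule sum_list_distinct_conv_sum_set)
  also have "\<dots> = (if fst x \<in> set bs then count (mset cs) x else 0)" by simp
  also have "\<dots> = count (mset cs) x" using assms(2) by (auto simp: count_eq_zero_iff)
  finally show "count (mset (concat (map (\<lambda>b. filter (\<lambda>c. fst c = b) cs) bs))) x = count (mset cs) x" .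
qed

definition reordering :: "(nat \<Rightarrow> nat list) \<Rightarrow> vetree \<Rightarrow> bool" where
  "reordering \<omega> u \<longleftrightarrow> (\<forall>a. vlab u = Num a \<longrightarrow> distinct (\<omega> a) \<and> set (\<omega> a) = set (word u)) \<and>
     (\<forall>i. vlab u = Sym i \<longrightarrow> children u = [])"

lemma mset_children_reorder:
  assumes "reordering \<omega> u"
  shows "mset (children (reorder \<omega> u)) = image_mset (\<lambda>(e, t). (e, reorder \<omega> t)) (mset (children u))"
proof -
  obtain v cs where u: "u = Node v cs" by (cases u)
  show ?thesis
  proof (cases v)
    case (Num a)
    have "distinct (\<omega> a)" "fst ` set (map (\<lambda>(e, t). (e, reorder \<omega> t)) cs) \<subseteq> set (\<omega> a)"
      using assms u Num by (force simp: reordering_def set_word)+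
    from mset_concat_filter[OF this] show ?thesis using u Num by simp
  next
    case (Sym i)
    thus ?thesis using assms u by (simp add: reordering_def)
  qed
qed

lemma mset_vertices_Node: "mset (vertices (Node v cs)) = add_mset (Node v cs) (\<Sum>(e, t)\<in>#mset cs. mset (vertices t))"
proof -
  have "mset (concat (map (\<lambda>(e, t). vertices t) cs)) = (\<Sum>(e, t)\<in>#mset cs. mset (vertices t))"
    by (induction cs) auto
  thus ?thesis by simp
qed

lemma mset_vertices_reorder:
  assumes "\<forall>u\<in>set (vertices T). reordering \<omega> u"
  shows "mset (vertices (reorder \<omega> T)) = image_mset (reorder \<omega>) (mset (vertices T))"
  using assms
proof (induction T rule: vertices.induct)
  case (1 v cs)
  let ?T' = "reorder \<omega> (Node v cs)"
  have "reordering \<omega> (Node v cs)" using 1(2) by simp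
  from mset_children_reorder[OF this]
  have ch: "mset (children ?T') = image_mset (\<lambda>(e, t). (e, reorder \<omega> t)) (mset cs)" by (simp del: reorder.simps)
  have "mset (vertices ?T') = mset (vertices (Node v (children ?T')))" by simp
  also have "\<dots> = add_mset ?T' (\<Sum>(e, t)\<in>#mset (children ?T'). mset (vertices t))"
    unfolding mset_vertices_Node by simp
  also have "(\<Sum>(e, t)\<in>#mset (children ?T'). mset (vertices t)) =
      (\<Sum>(e, t)\<in>#mset cs. mset (vertices (reorder \<omega> t)))"
    unfolding ch by (simp add: image_mset.compositionality o_def case_prod_unfold)
  also have "\<dots> = (\<Sum>(e, t)\<in>#mset cs. image_mset (reorder \<omega>) (mset (vertices t)))"
  proof (intro arg_cong[where f = sum_mset] image_mset_cong, clarify)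
    fix e t assume et: "(e, t) \<in># mset cs"
    hence "set (vertices t) \<subseteq> set (vertices (Node v cs))" by fastforce
    thus "mset (vertices (reorder \<omega> t)) = image_mset (reorder \<omega>) (mset (vertices t))"
      using 1(1)[of "(e, t)" e t] et 1(2) by auto
  qed
  also have "\<dots> = image_mset (reorder \<omega>) (\<Sum>(e, t)\<in>#mset cs. mset (vertices t))"
    by (induction cs) auto
  finally show ?case unfolding mset_vertices_Node by (simp del: reorder.simps)
qed

section \<open>Reordering children, and recovering a tree from its words\<close>

context multiplicities
begin

lemma filter_blocks:
  assumes "distinct bs" "b \<in> set bs"
  shows "filter (\<lambda>c. fst c = b) (concat (map (\<lambda>b. map (Pair b) (l b)) bs)) = map (Pair b) (l b)"
  using assms
proof (induction bs)
  case (Cons c bs)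
  have none: "filter (\<lambda>c. fst c = b) (map (Pair c) xs) = []" if "c \<noteq> b" for c and xs :: "vlabel list"
    using that by (induction xs) auto
  have all: "filter (\<lambda>c. fst c = b) (map (Pair b) xs) = map (Pair b) xs" for xs :: "vlabel list"
    by (induction xs) auto
  have nones: "filter (\<lambda>c. fst c = b) (concat (map (\<lambda>b. map (Pair b) (l b)) cs)) = []" if "b \<notin> set cs" for cs
    using that by (induction cs) (auto simp: none)
  show ?case using Cons by (cases "c = b") (auto simp: none all nones)
qed simp

lemma word_from_child_labels:
  assumes "child_labels u = concat (map (\<lambda>b. map (Pair b) (labels m r b)) ws)" "distinct ws" "set ws \<subseteq> {1..n}"
  shows "word u = ws"
proof -
  have "map fst (children u) = map fst (child_labels u)" by (simp add: child_labels_def case_prod_unfold)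
  also have "\<dots> = concat (map (\<lambda>b. replicate (length (labels m r b)) b) ws)"
    unfolding assms(1) map_concat map_map o_def by (simp add: map_replicate_const)
  finally show ?thesis unfolding word_def
    using remdups_adj_concat_replicate[OF assms(2)] labels_nonempty m_pos assms(3)
    by (metis length_0_conv subsetD)
qed

lemma child_labels_reorder:
  assumes u: "vlab u = Num a" "child_labels u = concat (map (\<lambda>b. map (Pair b) (labels m r b)) (word u))"
    "distinct (word u)" and \<omega>: "set (\<omega> a) = set (word u)"
  shows "child_labels (reorder \<omega> u) = concat (map (\<lambda>b. map (Pair b) (labels m r b)) (\<omega> a))"
proof -
  obtain cs where cs: "u = Node (Num a) cs" using u(1) by (cases u) auto
  have "child_labels (reorder \<omega> u) = concat (map (\<lambda>b. filter (\<lambda>c. fst c = b) (child_labels u)) (\<omega> a))"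
    unfolding cs by (simp add: child_labels_def map_concat o_def filter_map case_prod_unfold)
  also have "\<dots> = concat (map (\<lambda>b. map (Pair b) (labels m r b)) (\<omega> a))"
    unfolding u(2) using filter_blocks[OF u(3)] \<omega> by (intro arg_cong[where f = concat] map_cong refl) auto
  finally show ?thesis .
qed

context
  fixes T :: vetree and r :: nat
  assumes T: "T \<in> rooted_trees n m r" and r_le: "r \<le> K"
begin

text \<open>The right-hand side involves only \<open>r\<close> and the letter sets at the integer
  vertices. For trees with the same root label this reduces equivalence to equality of letter
  sets.\<close>

lemma set_edges_rooted:
  "set (edges T) = (\<Union>a\<in>{..K}. \<Union>b\<in>set (word (vertex T a)). (\<lambda>l. (l, b, Num a)) ` set (labels m r b))"
    (is "_ = ?R")
proof (intro equalityI subsetI)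
  fix x assume x: "x \<in> set (edges T)"
  obtain s e v where sev: "x = (s, e, v)" by (cases x)
  then obtain u where u: "u \<in> set (vertices T)" "vlab u = v" "e \<in> set (word u)" "s \<in> set (labels m r e)"
    using rooted_in_edges[OF T r_le] x by blast
  obtain a where a: "v = Num a"
    using u rooted_local_ok[OF T r_le u(1)] by (cases v) (auto simp: local_ok_def word_def)
  have "Num a \<in> set (map vlab (vertices T))" using u a by force
  hence "a \<le> K" unfolding rooted_label_set[OF T r_le] by auto
  moreover have "vertex T a = u" using vertex_eq[OF T r_le u(1)] u(2) a by simp
  ultimately show "x \<in> ?R" using u sev a by auto
next
  fix x assume "x \<in> ?R"
  then obtain a b l where x: "a \<le> K" "b \<in> set (word (vertex T a))" "x = (l, b, Num a)" "l \<in> set (labels m r b)"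
    by auto
  have v: "vertex T a \<in> set (vertices T)" "vlab (vertex T a) = Num a" using vertex_exists[OF T r_le x(1)] by auto
  have "(b, l) \<in> set (child_labels (vertex T a))"
    unfolding rooted_child_labels[OF T r_le v(1)] using x by auto
  thus "x \<in> set (edges T)" using v x by (auto simp: in_edges_iff)
qed

lemma distinct_edges: "distinct (edges T)"
proof -
  have "distinct (map (\<lambda>(e, t). vlab t) (nonroot T))"
    using rooted_distinct_labels[OF T r_le] mset_vertex_labels[of T]
    by (metis distinct.simps(2) mset.simps(2) mset_eq_imp_distinct_iff)
  moreover have "map (\<lambda>(e, t). vlab t) (nonroot T) = map fst (map (\<lambda>(s, e, v). (s, e)) (edges T))"
    unfolding edges_nonroot by (simp add: case_prod_unfold)
  ultimately show ?thesis by (metis distinct_map)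
qed

text \<open>All trees have the same set of vertex labels, so equal edge sets force equal root
  labels.\<close>

lemma root_from_edges: "set (map vlab (vertices T)) - fst ` set (edges T) = {Num r}"
proof -
  have "map fst (edges T) = map fst (map (\<lambda>(s, e, v). (s, e)) (edges T))"
    by (simp add: case_prod_unfold)
  also have "\<dots> = map (\<lambda>(e, t). vlab t) (nonroot T)"
    unfolding edges_nonroot by (simp add: case_prod_unfold)
  finally have f: "fst ` set (edges T) = set (map (\<lambda>(e, t). vlab t) (nonroot T))"
    by (metis set_map)
  have "set (map vlab (vertices T)) = insert (Num r) (fst ` set (edges T))"
    using arg_cong[OF mset_vertex_labels[of T], of set_mset] rooted_root[OF T r_le] f
    by (metis set_mset_add_mset_insert set_mset_mset)
  moreover have "Num r \<notin> fst ` set (edges T)" unfolding f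
    using rooted_distinct_labels[OF T r_le] mset_vertex_labels[of T] rooted_root[OF T r_le]
    by (metis distinct.simps(2) mset.simps(2) mset_eq_imp_distinct_iff)
  ultimately show ?thesis by (simp only: insert_Diff_if Diff_cancel if_False)
qed

text \<open>Any choice of rearranged words, one for each integer vertex, is realised by a tree with
  the same root label. The forced labels travel with their edges, so they stay correct.\<close>

lemma reorder_rooted:
  assumes \<omega>: "\<And>a. a \<le> K \<Longrightarrow> mset (\<omega> a) = mset (word (vertex T a))"
  shows "reorder \<omega> T \<in> rooted_trees n m r"
    and "a \<le> K \<Longrightarrow> word (vertex (reorder \<omega> T) a) = \<omega> a"
proof -
  have vx: "a \<le> K \<and> vertex T a = u" if "u \<in> set (vertices T)" "vlab u = Num a" for u a
  proof -
    have "Num a \<in> set (map vlab (vertices T))" using that by force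
    thus ?thesis unfolding rooted_label_set[OF T r_le] using vertex_eq[OF T r_le that] by auto
  qed
  have \<omega>': "distinct (\<omega> a) \<and> set (\<omega> a) = set (word u) \<and> mset (\<omega> a) = mset (word u)"
    if "u \<in> set (vertices T)" "vlab u = Num a" for u a
    using \<omega>[of a] vx[OF that] rooted_distinct_word[OF T r_le that(1)]
    by (metis mset_eq_imp_distinct_iff mset_eq_setD)
  have Sym: "children u = []" if "u \<in> set (vertices T)" "vlab u = Sym i" for u i
    using rooted_local_ok[OF T r_le that(1)] that(2) by (simp add: local_ok_def)
  have Sym': "children (reorder \<omega> u) = []" if "u \<in> set (vertices T)" "vlab u = Sym i" for u i
    using that(2) Sym[OF that] by (cases u) simp
  have re: "\<forall>u\<in>set (vertices T). reordering \<omega> u" using \<omega>' Sym by (auto simp: reordering_def)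
  have vs: "mset (vertices (reorder \<omega> T)) = image_mset (reorder \<omega>) (mset (vertices T))"
    by (rule mset_vertices_reorder[OF re])
  hence svs: "set (vertices (reorder \<omega> T)) = reorder \<omega> ` set (vertices T)"
    by (metis set_image_mset set_mset_mset)
  have cl: "child_labels (reorder \<omega> u) = concat (map (\<lambda>b. map (Pair b) (labels m r b)) (\<omega> a))"
    if "u \<in> set (vertices T)" "vlab u = Num a" for u a
    using child_labels_reorder[OF that(2) rooted_child_labels[OF T r_le that(1)]
        rooted_distinct_word[OF T r_le that(1)]] \<omega>'[OF that] by blast
  have wd: "word (reorder \<omega> u) = \<omega> a" if "u \<in> set (vertices T)" "vlab u = Num a" for u a
    using word_from_child_labels[OF cl[OF that]] \<omega>'[OF that] rooted_word_range[OF T r_le that(1)] by blast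
  have mw: "mset (word (reorder \<omega> u)) = mset (word u)" if "u \<in> set (vertices T)" for u
    using wd[OF that] \<omega>'[OF that] Sym[OF that] Sym'[OF that] by (cases "vlab u") (auto simp: word_def)
  have lo: "local_ok m r (reorder \<omega> u)" if "u \<in> set (vertices T)" for u
    using cl[OF that] wd[OF that] Sym'[OF that]
    by (cases "vlab u") (auto simp: local_ok_def child_labels_def word_def)
  have "mset (concat (map word (vertices (reorder \<omega> T)))) =
      (\<Sum>u\<in>#mset (vertices (reorder \<omega> T)). mset (word u))"
    by (simp add: mset_concat_map sum_mset_sum_list[symmetric])
  also have "\<dots> = (\<Sum>u\<in>#mset (vertices T). mset (word (reorder \<omega> u)))"
    unfolding vs by (simp add: image_mset.compositionality o_def)
  also have "\<dots> = (\<Sum>u\<in>#mset (vertices T). mset (word u))"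
    using mw by (intro arg_cong[where f = sum_mset] image_mset_cong) auto
  also have "\<dots> = mset (concat (map word (vertices T)))"
    by (simp add: mset_concat_map sum_mset_sum_list[symmetric])
  finally have W: "mset (concat (map word (vertices (reorder \<omega> T)))) = \<dots>" .
  show R: "reorder \<omega> T \<in> rooted_trees n m r"
    unfolding rooted_trees_def mem_Collect_eq svs
    using lo rooted_root[OF T r_le] rooted_distinct[OF T r_le] rooted_letters[OF T r_le]
      mset_eq_imp_distinct_iff[OF W] mset_eq_setD[OF W] by simp
  show "word (vertex (reorder \<omega> T) a) = \<omega> a" if a: "a \<le> K"
  proof -
    have v: "vertex T a \<in> set (vertices T)" "vlab (vertex T a) = Num a" using vertex_exists[OF T r_le a] by auto
    have "vertex (reorder \<omega> T) a = reorder \<omega> (vertex T a)"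
      by (rule vertex_eq[OF R r_le]) (use v svs in auto)
    thus ?thesis using wd[OF v] by simp
  qed
qed

end

text \<open>Equal words force equal labels of the children, and equally labeled vertices of the two
  trees are then compared by induction on size.\<close>

lemma rooted_inject:
  assumes T: "T \<in> rooted_trees n m r" "T' \<in> rooted_trees n m r" and r: "r \<le> K"
    and eq: "\<And>a. a \<le> K \<Longrightarrow> word (vertex T a) = word (vertex T' a)"
  shows "T = T'"
proof -
  have "u = u'" if "u \<in> set (vertices T)" "u' \<in> set (vertices T')" "vlab u = vlab u'" for u u'
    using that
  proof (induction "size u" arbitrary: u u' rule: less_induct)
    case less
    have cl: "child_labels u = child_labels u'"
    proof (cases "vlab u")
      case (Num a)
      have "Num a \<in> set (map vlab (vertices T))" using less(2) Num by force
      hence "a \<le> K" unfolding rooted_label_set[OF T(1) r] by auto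
      hence "word u = word u'"
        using eq vertex_eq[OF T(1) r less(2) Num] vertex_eq[OF T(2) r less(3)] less(4) Num by metis
      thus ?thesis using rooted_child_labels[OF T(1) r less(2)] rooted_child_labels[OF T(2) r less(3)] by simp
    next
      case (Sym i)
      thus ?thesis using rooted_local_ok[OF T(1) r less(2)] rooted_local_ok[OF T(2) r less(3)] less(4)
        by (simp add: local_ok_def child_labels_def)
    qed
    have "children u = children u'"
    proof (rule nth_equalityI)
      show len: "length (children u) = length (children u')"
        using arg_cong[OF cl, of length] by (simp add: child_labels_def)
      fix i assume i: "i < length (children u)"
      obtain e t e' t' where c: "children u ! i = (e, t)" "children u' ! i = (e', t')" by (meson surj_pair)
      have "child_labels u ! i = child_labels u' ! i" using cl by simp
      hence l: "e = e'" "vlab t = vlab t'" using c i len by (auto simp: child_labels_def)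
      have m: "(e, t) \<in> set (children u)" "(e', t') \<in> set (children u')" using c i len by (metis nth_mem)+
      have "(e, t) \<in> set (nonroot T)" "(e', t') \<in> set (nonroot T')"
        unfolding in_nonroot_iff using m less(2,3) by blast+
      hence "t \<in> set (vertices T)" "t' \<in> set (vertices T')"
        unfolding set_vertices by force+
      moreover have "size t < size u" using size_child[OF m(1)] by (cases u) auto
      ultimately have "t = t'" using l(2) by (intro less(1))
      thus "children u ! i = children u' ! i" using l(1) c by simp
    qed
    thus ?case using less(4) by (rule vetree.expand[OF conjI, rotated])
  qed
  from this[of T T'] show ?thesis
    using rooted_root[OF T(1) r] rooted_root[OF T(2) r] by (simp add: set_vertices)
qed

end

lemma mset_concat_cong:
  assumes "mset xs = mset ys"
  shows "mset (concat xs) = mset (concat ys)"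
proof -
  have "mset (concat zs) = (\<Sum>z\<in>#mset zs. mset z)" for zs :: "'a list list"
    by (induction zs) auto
  thus ?thesis using assms by simp
qed

lemma mset_rotate: "mset (rotate d xs) = mset xs"
  unfolding rotate_drop_take by (metis append_take_drop_id mset_append union_commute)

lemma prod_list_mset_cong:
  assumes "mset xs = mset ys"
  shows "(\<Prod>x\<leftarrow>xs. f x :: 'b::comm_monoid_mult) = (\<Prod>y\<leftarrow>ys. f y)"
proof -
  have "(\<Prod>z\<leftarrow>zs. f z) = (\<Prod>z\<in>#mset zs. f z)" for zs
    by (induction zs) auto
  thus ?thesis using assms by simp
qed

section \<open>Weights and classes of ordered partitions\<close>

definition part_weight :: "nat list list \<Rightarrow> pol3" where
  "part_weight P = ind_x ^ des_part P * ind_y ^ asc_part P * ind_z ^ emp_part P"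

lemma part_weight_conv: "part_weight P = (\<Prod>w\<leftarrow>P. mon (0 # w @ [0]))"
proof (induction P)
  case (Cons w P)
  then show ?case
    by (simp add: part_weight_def des_part_def asc_part_def emp_part_def mon_def
        des_conv_cnt asc_conv_cnt plat_conv_cnt power_add mult_ac)
qed (simp add: part_weight_def des_part_def asc_part_def emp_part_def)

lemma part_class_conv:
  assumes "P \<in> partitions n k"
  shows "part_class n k P = rearrangements P"
proof -
  have "P' \<in> partitions n k" if "list_all2 (\<lambda>w w'. mset w' = mset w) P P'" for P'
  proof -
    have "mset (concat P') = mset (concat P)" using that by (induction rule: list_all2_induct) auto
    hence "distinct (concat P') \<longleftrightarrow> distinct (concat P)" "set (concat P') = set (concat P)"
      by (rule mset_eq_imp_distinct_iff, rule mset_eq_setD)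
    moreover have "length P' = length P" using that by (simp add: list_all2_lengthD)
    ultimately show ?thesis using assms unfolding partitions_conv word_tuples_def by simp
  qed
  thus ?thesis unfolding part_class_def rearrangements_def part_equiv_def by blast
qed

lemma partitions_distinct: "P \<in> partitions n k \<Longrightarrow> w \<in> set P \<Longrightarrow> distinct w"
  by (auto simp: partitions_def in_set_conv_nth)

lemma sum_part_class:
  assumes P: "P \<in> partitions n k"
  shows "sum part_weight (part_class n k P) = (\<Prod>w\<leftarrow>P. block_poly (length w))"
proof -
  let ?bs = "replicate (length P) (0::nat)"
  have "part_weight ws = (\<Prod>(b, w)\<leftarrow>zip ?bs ws. mon (b # w @ [b]))" if "ws \<in> rearrangements P" for ws
  proof -
    have "length ws = length P" using that by (auto simp: rearrangements_def dest: list_all2_lengthD)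
    hence "(\<Prod>(b, w)\<leftarrow>zip ?bs ws. mon (b # w @ [b])) = (\<Prod>w\<leftarrow>map snd (zip ?bs ws). mon (0 # w @ [0]))"
      by (intro arg_cong[where f = prod_list]) (auto simp: zip_replicate1 case_prod_unfold)
    thus ?thesis using \<open>length ws = length P\<close> by (simp add: part_weight_conv)
  qed
  hence "sum part_weight (part_class n k P) =
      (\<Sum>ws\<in>rearrangements P. \<Prod>(b, w)\<leftarrow>zip ?bs ws. mon (b # w @ [b]))"
    unfolding part_class_conv[OF P] by (intro sum.cong) auto
  also have "\<dots> = (\<Prod>w\<leftarrow>P. block_poly (length w))"
  proof (rule sum_rearrangements)
    have "0 \<notin> set w" if "w \<in> set P" for w
    proof
      assume "0 \<in> set w"
      hence "0 \<in> set (concat P)" using that by auto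
      moreover have "set (concat P) = {1..n}" using P unfolding partitions_conv word_tuples_def by blast
      ultimately show False by (metis atLeastAtMost_iff not_one_le_zero)
    qed
    thus "list_all2 (\<lambda>b u. b \<notin> set u) ?bs P" by (simp add: list_all2_conv_all_nth)
  qed (use partitions_distinct[OF P] in blast)
  finally show ?thesis .
qed

section \<open>Classes of trees, the bijection and the total sums\<close>

context multiplicities
begin

lemma tree_equiv_iff:
  assumes "distinct (edges T)" "distinct (edges T')"
  shows "tree_equiv T T' \<longleftrightarrow> set (edges T) = set (edges T')"
proof
  assume eq: "tree_equiv T T'"
  have "(s, e, v) \<in> set (edges T) \<longleftrightarrow> (s, e, v) \<in> set (edges T')" for s e v
    using mset_eq_setD[OF eq[unfolded tree_equiv_def, rule_format, of v]] by auto
  thus "set (edges T) = set (edges T')" by auto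
next
  assume "set (edges T) = set (edges T')"
  hence "mset (edges T) = mset (edges T')" using assms set_eq_iff_mset_eq_distinct by blast
  thus "tree_equiv T T'" by (simp add: tree_equiv_def)
qed

text \<open>The edge set determines the root label first and then the letter set at each integer
  vertex. Words are distinct, so letter sets and multisets carry the same information.\<close>

lemma tree_class_rooted:
  assumes T: "T \<in> rooted_trees n m r" and r: "r \<le> K"
  shows "tree_class n m T = {T' \<in> rooted_trees n m r. \<forall>a\<le>K. mset (word (vertex T' a)) = mset (word (vertex T a))}"
proof (intro equalityI subsetI)
  fix T' assume T': "T' \<in> tree_class n m T"
  then obtain r' where R: "T' \<in> rooted_trees n m r'" "r' \<le> K"
    unfolding tree_class_def VE_trees_conv by blast
  have E: "set (edges T) = set (edges T')"
    using T' tree_equiv_iff[OF distinct_edges[OF T r] distinct_edges[OF R]] by (simp add: tree_class_def)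
  have "{Num r} = {Num r'}"
    unfolding root_from_edges[OF T r, symmetric] root_from_edges[OF R, symmetric] E
      rooted_label_set[OF T r] rooted_label_set[OF R] ..
  hence R': "T' \<in> rooted_trees n m r" using R(1) by simp
  moreover have "mset (word (vertex T' a)) = mset (word (vertex T a))" if a: "a \<le> K" for a
  proof -
    have w: "set (word (vertex S a)) = {b. \<exists>l. (l, b, Num a) \<in> set (edges S)}"
      if S: "S \<in> rooted_trees n m r" for S
    proof -
      have "b \<in> set (word (vertex S a)) \<longleftrightarrow> (\<exists>l. (l, b, Num a) \<in> set (edges S))" for b
      proof
        assume b: "b \<in> set (word (vertex S a))"
        have "labels m r b \<noteq> []"
          using labels_nonempty m_pos rooted_word_range[OF S r vertex_exists(1)[OF S r a] b] by simp
        hence "hd (labels m r b) \<in> set (labels m r b)" by simp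
        thus "\<exists>l. (l, b, Num a) \<in> set (edges S)" unfolding set_edges_rooted[OF S r] using a b by blast
      qed (unfold set_edges_rooted[OF S r], blast)
      thus ?thesis by blast
    qed
    have "distinct (word (vertex T a))" "distinct (word (vertex T' a))"
      using rooted_distinct_word[OF T r vertex_exists(1)[OF T r a]]
        rooted_distinct_word[OF R' r vertex_exists(1)[OF R' r a]] by auto
    thus ?thesis using w[OF T] w[OF R'] E set_eq_iff_mset_eq_distinct by metis
  qed
  ultimately show "T' \<in> {T' \<in> rooted_trees n m r. \<forall>a\<le>K. mset (word (vertex T' a)) = mset (word (vertex T a))}"
    by blast
next
  fix T' assume "T' \<in> {T' \<in> rooted_trees n m r. \<forall>a\<le>K. mset (word (vertex T' a)) = mset (word (vertex T a))}"
  hence T': "T' \<in> rooted_trees n m r" "\<And>a. a \<le> K \<Longrightarrow> set (word (vertex T' a)) = set (word (vertex T a))"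
    by (auto dest: mset_eq_setD)
  have "set (edges T) = set (edges T')"
    unfolding set_edges_rooted[OF T r] set_edges_rooted[OF T'(1) r] using T'(2) by simp
  hence "tree_equiv T T'" using tree_equiv_iff[OF distinct_edges[OF T r] distinct_edges[OF T'(1) r]] by blast
  thus "T' \<in> tree_class n m T" using rooted_VE[OF T'(1) r] by (simp add: tree_class_def)
qed

lemma length_word_list [simp]: "length (word_list T) = Suc K"
  by (simp add: word_list_def)

lemma nth_word_list: "a \<le> K \<Longrightarrow> word_list T ! a = word (vertex T a)"
  unfolding word_list_def by (subst nth_map) (simp_all del: upt_Suc)

lemma bij_betw_word_list:
  assumes T: "T \<in> rooted_trees n m r" and r: "r \<le> K"
  shows "bij_betw word_list (tree_class n m T) (rearrangements (word_list T))"
  unfolding bij_betw_def tree_class_rooted[OF T r]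
proof (intro conjI equalityI subsetI)
  show "inj_on word_list {T' \<in> rooted_trees n m r. \<forall>a\<le>K. mset (word (vertex T' a)) = mset (word (vertex T a))}"
  proof (rule inj_onI, clarify)
    fix S S' assume S: "S \<in> rooted_trees n m r" "S' \<in> rooted_trees n m r" and eq: "word_list S = word_list S'"
    show "S = S'" by (rule rooted_inject[OF S r]) (metis eq nth_word_list)
  qed
next
  fix ws assume "ws \<in> word_list ` {T' \<in> rooted_trees n m r. \<forall>a\<le>K. mset (word (vertex T' a)) = mset (word (vertex T a))}"
  then obtain T' where T': "\<forall>a\<le>K. mset (word (vertex T' a)) = mset (word (vertex T a))" "ws = word_list T'" by blast
  show "ws \<in> rearrangements (word_list T)" unfolding rearrangements_def mem_Collect_eq list_all2_conv_all_nth
    using T' by (simp add: nth_word_list less_Suc_eq_le)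
next
  fix ws assume ws: "ws \<in> rearrangements (word_list T)"
  hence len: "length ws = Suc K" by (auto simp: rearrangements_def dest: list_all2_lengthD)
  have \<omega>: "mset (ws ! a) = mset (word (vertex T a))" if "a \<le> K" for a
    using ws that unfolding rearrangements_def mem_Collect_eq list_all2_conv_all_nth
    by (metis length_word_list le_imp_less_Suc nth_word_list)
  let ?T = "reorder (\<lambda>a. ws ! a) T"
  have R: "?T \<in> rooted_trees n m r" "\<And>a. a \<le> K \<Longrightarrow> word (vertex ?T a) = ws ! a"
    using reorder_rooted[OF T r, of "\<lambda>a. ws ! a"] \<omega> by blast+
  have "word_list ?T = ws"
    by (rule nth_equalityI) (auto simp: len nth_word_list less_Suc_eq_le R(2))
  thus "ws \<in> word_list ` {T' \<in> rooted_trees n m r. \<forall>a\<le>K. mset (word (vertex T' a)) = mset (word (vertex T a))}"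
    using R \<omega> by (intro image_eqI[of _ _ ?T]) auto
qed

lemma distinct_word_list:
  assumes T: "T \<in> rooted_trees n m r" and r: "r \<le> K" and w: "w \<in> set (word_list T)"
  shows "distinct w"
proof -
  obtain a where "a \<le> K" "w = word (vertex T a)"
    using w unfolding word_list_def by (auto simp: less_Suc_eq_le simp del: upt_Suc)
  thus ?thesis using rooted_distinct_word[OF T r vertex_exists(1)[OF T r]] by simp
qed

lemma sum_tree_class:
  assumes T: "T \<in> rooted_trees n m r" and r: "r \<le> K"
  shows "sum tree_weight (tree_class n m T) = (\<Prod>w\<leftarrow>word_list T. block_poly (length w))"
proof -
  let ?bs = "map (parent_label r) [0..<Suc K]"
  have "sum tree_weight (tree_class n m T) =
      (\<Sum>T'\<in>tree_class n m T. \<Prod>(b, w)\<leftarrow>zip ?bs (word_list T'). mon (b # w @ [b]))"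
  proof (intro sum.cong refl)
    fix T' assume "T' \<in> tree_class n m T"
    hence "T' \<in> rooted_trees n m r" unfolding tree_class_rooted[OF T r] by blast
    from tree_weight_word_list[OF this r]
    show "tree_weight T' = (\<Prod>(b, w)\<leftarrow>zip ?bs (word_list T'). mon (b # w @ [b]))" .
  qed
  also have "\<dots> = (\<Sum>ws\<in>rearrangements (word_list T). \<Prod>(b, w)\<leftarrow>zip ?bs ws. mon (b # w @ [b]))"
    by (rule sum.reindex_bij_betw[OF bij_betw_word_list[OF T r]])
  also have "\<dots> = (\<Prod>w\<leftarrow>word_list T. block_poly (length w))"
  proof (rule sum_rearrangements)
    show "\<forall>u\<in>set (word_list T). distinct u" using distinct_word_list[OF T r] by blast
    show "list_all2 (\<lambda>b u. b \<notin> set u) ?bs (word_list T)"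
      unfolding list_all2_conv_all_nth
    proof (intro conjI allI impI)
      fix a assume "a < length ?bs"
      hence "a \<le> K" by simp
      thus "?bs ! a \<notin> set (word_list T ! a)"
        using parent_label_notin[OF T r, of a] by (simp add: nth_word_list del: upt_Suc)
    qed simp
  qed
  finally show ?thesis .
qed

lemma bij_betw_rooted_VE:
  "bij_betw (\<lambda>(r, q). mk m r (Num r) q) ({..<Suc K} \<times> qtrees n m) (VE_trees n m)"
  unfolding bij_betw_def
proof (intro conjI)
  show "inj_on (\<lambda>(r, q). mk m r (Num r) q) ({..<Suc K} \<times> qtrees n m)"
  proof (rule inj_onI, clarify)
    fix r q r' q' assume q: "q \<in> qtrees n m" "q' \<in> qtrees n m" and eq: "mk m r (Num r) q = mk m r' (Num r') q'"
    have "r = r'" using arg_cong[OF eq, of vlab] by simp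
    thus "r = r' \<and> q = q'" using q eq bij_betw_mk[of r] by (auto simp: bij_betw_def dest: inj_onD)
  qed
  have "(\<lambda>(r, q). mk m r (Num r) q) ` ({..<Suc K} \<times> qtrees n m) = (\<Union>r\<in>{..K}. mk m r (Num r) ` qtrees n m)"
    by (force simp: less_Suc_eq_le)
  also have "\<dots> = VE_trees n m" unfolding VE_trees_conv using bij_betw_mk by (simp add: bij_betw_def)
  finally show "(\<lambda>(r, q). mk m r (Num r) q) ` ({..<Suc K} \<times> qtrees n m) = VE_trees n m" .
qed

lemma bij_betw_rotate_dfs:
  "bij_betw (\<lambda>(r, q). rotate r (dfs q)) ({..<Suc K} \<times> qtrees n m) (partitions n (Suc K))"
proof -
  let ?L = "{P \<in> word_tuples {1..n} (Suc K). luk (step m) 1 P}"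
  have "bij_betw (map_prod id dfs) ({..<Suc K} \<times> qtrees n m) ({..<Suc K} \<times> ?L)"
    by (intro bij_betw_map_prod bij_betw_id bij_betw_dfs refl)
  moreover have "bij_betw (\<lambda>(r, ws). rotate r ws) ({..<Suc K} \<times> ?L) (word_tuples {1..n} (Suc K))"
  proof (rule luk_bij_betw_rotate)
    fix ws assume ws: "ws \<in> word_tuples {1..n} (Suc K)"
    thus "length ws = Suc K \<and> 1 + sum_list (map (step m) ws) = Suc K"
      using sum_step[of ws n m] by (simp add: word_tuples_def)
    fix d
    have c: "mset (concat (rotate d ws)) = mset (concat ws)" by (intro mset_concat_cong mset_rotate)
    show "rotate d ws \<in> word_tuples {1..n} (Suc K)"
      using ws mset_eq_imp_distinct_iff[OF c] mset_eq_setD[OF c] unfolding word_tuples_def by simp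
  qed
  ultimately have "bij_betw ((\<lambda>(r, ws). rotate r ws) \<circ> map_prod id dfs) ({..<Suc K} \<times> qtrees n m)
      (word_tuples {1..n} (Suc K))" by (rule bij_betw_trans)
  thus ?thesis unfolding partitions_conv by (simp add: o_def case_prod_unfold map_prod_def)
qed

text \<open>Pairs of a root label and an unlabeled plane tree parametrise both sides, once by
  labeling the vertices and once by rotating the preorder tuple.\<close>

definition \<Psi> :: "vetree \<Rightarrow> nat list list" where
  "\<Psi> T = (case inv_into ({..<Suc K} \<times> qtrees n m) (\<lambda>(r, q). mk m r (Num r) q) T of (r, q) \<Rightarrow> rotate r (dfs q))"

lemma bij_betw_\<Psi>: "bij_betw \<Psi> (VE_trees n m) (partitions n (Suc K))"
  using bij_betw_trans[OF bij_betw_inv_into[OF bij_betw_rooted_VE] bij_betw_rotate_dfs]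
  by (simp add: \<Psi>_def[abs_def] o_def)

lemma VE_trees_cases:
  assumes T: "T \<in> VE_trees n m"
  obtains r where "T \<in> rooted_trees n m r" "r \<le> K" "mset (\<Psi> T) = mset (word_list T)"
proof -
  let ?A = "{..<Suc K} \<times> qtrees n m" and ?f = "\<lambda>(r, q). mk m r (Num r) q"
  obtain r q where rq: "inv_into ?A ?f T = (r, q)" by (meson surj_pair)
  have "inv_into ?A ?f T \<in> ?A" "?f (inv_into ?A ?f T) = T"
    using bij_betw_rooted_VE T by (auto simp: bij_betw_def intro: inv_into_into f_inv_into_f)
  hence *: "r \<le> K" "q \<in> qtrees n m" "mk m r (Num r) q = T" unfolding rq by (auto simp: less_Suc_eq_le)
  have R: "T \<in> rooted_trees n m r" using mk_rooted[OF *(2), of r] *(3) by simp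
  have "mset (\<Psi> T) = mset (word_list T)"
    unfolding mset_word_list[OF R *(1)] unfolding *(3)[symmetric] dfs_mk[OF *(2)]
    unfolding *(3) \<Psi>_def rq prod.case by (rule mset_rotate)
  thus thesis using that R * by blast
qed

text \<open>All four quantities are products over the same multiset of words. The sizes are products
  of factorials of the word lengths.\<close>

lemma class_sums:
  assumes T: "T \<in> VE_trees n m"
  shows "sum tree_weight (tree_class n m T) = sum part_weight (part_class n (Suc K) (\<Psi> T))"
    and "card (tree_class n m T) = card (part_class n (Suc K) (\<Psi> T))"
proof -
  obtain r where r: "T \<in> rooted_trees n m r" "r \<le> K" "mset (\<Psi> T) = mset (word_list T)"
    using VE_trees_cases[OF T] by blast
  have P: "\<Psi> T \<in> partitions n (Suc K)" using bij_betw_\<Psi> T by (auto simp: bij_betw_def)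
  show "sum tree_weight (tree_class n m T) = sum part_weight (part_class n (Suc K) (\<Psi> T))"
    unfolding sum_tree_class[OF r(1,2)] sum_part_class[OF P] by (rule prod_list_mset_cong[OF r(3)[symmetric]])
  have "card (tree_class n m T) = (\<Prod>w\<leftarrow>word_list T. fact (length w))"
    using bij_betw_same_card[OF bij_betw_word_list[OF r(1,2)]] distinct_word_list[OF r(1,2)]
    by (simp add: card_rearrangements)
  also have "\<dots> = (\<Prod>w\<leftarrow>\<Psi> T. fact (length w))" by (rule prod_list_mset_cong[OF r(3)[symmetric]])
  also have "\<dots> = card (part_class n (Suc K) (\<Psi> T))"
    unfolding part_class_conv[OF P] using partitions_distinct[OF P] by (simp add: card_rearrangements)
  finally show "card (tree_class n m T) = card (part_class n (Suc K) (\<Psi> T))" .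
qed

lemma total_sums: "sum tree_weight (VE_trees n m) = sum part_weight (partitions n (Suc K))"
proof -
  have finP: "finite (partitions n (Suc K))" unfolding partitions_conv by (rule finite_word_tuples) simp
  hence finT: "finite (VE_trees n m)" using bij_betw_finite[OF bij_betw_\<Psi>] by simp
  have "sum tree_weight (VE_trees n m) =
      (\<Sum>T\<in>VE_trees n m. const3 (1 / of_nat (card (tree_class n m T))) * sum tree_weight (tree_class n m T))"
    by (rule sum_class_averages[OF finT]) (auto simp: tree_class_def tree_equiv_def)
  \<comment> \<open>Class sums and class sizes agree along \<open>\<Psi>\<close>, hence so do the
    averages, although the classes themselves need not correspond.\<close>
  also have "\<dots> = (\<Sum>T\<in>VE_trees n m. const3 (1 / of_nat (card (part_class n (Suc K) (\<Psi> T)))) *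
      sum part_weight (part_class n (Suc K) (\<Psi> T)))"
    by (intro sum.cong refl) (simp add: class_sums)
  also have "\<dots> = (\<Sum>P\<in>partitions n (Suc K). const3 (1 / of_nat (card (part_class n (Suc K) P))) *
      sum part_weight (part_class n (Suc K) P))"
    by (rule sum.reindex_bij_betw[OF bij_betw_\<Psi>])
  also have "\<dots> = sum part_weight (partitions n (Suc K))"
  proof (rule sum_class_averages[OF finP, symmetric])
    fix P P' assume "P \<in> partitions n (Suc K)"
    thus "P \<in> part_class n (Suc K) P"
      by (simp add: part_class_def part_equiv_def list_all2_refl)
    assume "P' \<in> part_class n (Suc K) P"
    hence "part_equiv P P'" by (simp add: part_class_def)
    hence "part_equiv P Q \<longleftrightarrow> part_equiv P' Q" for Q
      by (auto simp: part_equiv_def list_all2_conv_all_nth)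
    thus "part_class n (Suc K) P' = part_class n (Suc K) P" by (simp add: part_class_def)
  qed (auto simp: part_class_def)
  finally show ?thesis .
qed

text \<open>The weight of \<open>mk m r (Num r) q\<close> does not depend on \<open>r\<close>, which
  yields the factor \<open>Suc K\<close>.\<close>

lemma Qbar_sum: "of_nat (Suc K) * Qbar n m = sum tree_weight (VE_trees n m)"
proof -
  have "Qbar n m = (\<Sum>w\<in>quasi_stirling n m. mon (0 # w @ [0]))"
    unfolding Qbar_def mon_def des_conv_cnt asc_conv_cnt plat_conv_cnt ..
  also have "\<dots> = (\<Sum>q\<in>qtrees n m. mon (0 # qword q @ [0]))"
    by (rule sum.reindex_bij_betw[OF bij_betw_qword, symmetric])
  finally have "of_nat (Suc K) * Qbar n m = (\<Sum>r<Suc K. \<Sum>q\<in>qtrees n m. mon (0 # qword q @ [0]))" by simp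
  also have "\<dots> = (\<Sum>(r, q)\<in>{..<Suc K} \<times> qtrees n m. mon (0 # qword q @ [0]))"
    by (rule sum.cartesian_product)
  also have "\<dots> = (\<Sum>p\<in>{..<Suc K} \<times> qtrees n m. tree_weight ((\<lambda>(r, q). mk m r (Num r) q) p))"
    by (intro sum.cong refl) (auto simp: tree_weight_mk)
  also have "\<dots> = sum tree_weight (VE_trees n m)"
    by (rule sum.reindex_bij_betw[OF bij_betw_rooted_VE])
  finally show ?thesis .
qed

lemma sum_part_weight: "sum part_weight (partitions n (Suc K)) =
    fact n * fps_nth ((eulerian_egf - 1 + fps_const ind_z) ^ Suc K) n"
  unfolding partitions_conv part_weight_conv[abs_def] using sum_word_tuples_mon[of "{1..n}" "Suc K"] by simp

end

theorem theorem3p1: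
  fixes n M k :: nat and m :: "nat \<Rightarrow> nat"
  assumes "\<forall>i \<in> {1..n}. m i \<ge> 1"
    and "M = (\<Sum>i=1..n. m i)"
    and "k = M - n + 1"
  shows
    "(\<exists>\<Psi>. bij_betw \<Psi> (VE_trees n m) (partitions n k) \<and>
        (\<forall>T \<in> VE_trees n m.
          (\<Sum>T' \<in> tree_class n m T.
             ind_x ^ cdes_tree T' * ind_y ^ casc_tree T' * ind_z ^ leaf_star T') =
          (\<Sum>P' \<in> part_class n k (\<Psi> T).
             ind_x ^ des_part P' * ind_y ^ asc_part P' * ind_z ^ emp_part P'))) \<and>
     (\<Sum>T \<in> VE_trees n m.
        ind_x ^ cdes_tree T * ind_y ^ casc_tree T * ind_z ^ leaf_star T) =
     (\<Sum>P \<in> partitions n k.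
        ind_x ^ des_part P * ind_y ^ asc_part P * ind_z ^ emp_part P) \<and>
     of_nat (M - n + 1) * Qbar n m =
     fact n * fps_nth ((eulerian_egf - 1 + fps_const ind_z) ^ (M - n + 1)) n"
proof -
  interpret multiplicities n m using assms(1) by unfold_locales auto
  have k: "M - n + 1 = Suc K" "k = Suc K" using sum_minus_n assms(2,3) by simp_all
  show ?thesis unfolding k tree_weight_def[symmetric] part_weight_def[symmetric]
    using bij_betw_\<Psi> class_sums(1) total_sums Qbar_sum sum_part_weight
    by (intro conjI exI[of _ \<Psi>]) auto
qed

end
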